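(* Consider $SO(5)$ acting on the unit sphere $S(\Lambda^2\mathbb R^5)=S^9$. Every unit bivector is $SO(5)$-conjugate to $$b_\theta=\cos\theta\,e_{12}+\sin\theta\,e_{34},\qquad 0\le\theta\le\tfrac{\pi}{4}.$$ The orbit space of $S(\Lambda^2\mathbb R^5)=S^9$ is this interval. Its group diagram is $$T^2\subset\left\{SO(2)\times SO(3),\ U(2)\right\}\subset SO(5).$$ Thus the principal and singular orbits are $$P=SO(5)/T^2,\qquad B_-=SO(5)/(SO(2)\times SO(3))\cong\widetilde G_2(\mathbb R^5),\qquad B_+=SO(5)/U(2)\cong\mathbb{CP}^3.$$ Moreover, with $K_-=SO(2)\times SO(3)$ and $K_+=U(2)$, one has $K_\pm/T^2\cong S^2$, so both singular orbits have codimension three and $$S^9\cong SO(5)\times_{SO(2)\times SO(3)}D^3\ \cup_{SO(5)/T^2}\ SO(5)\times_{U(2)}D^3.$$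
   Context: $(e_1,\dots,e_5)$ is the standard orthonormal basis of $\mathbb R^5$ and $e_{ij}=e_i\wedge e_j$; $\Lambda^2\mathbb R^5$ has the inner product making $\{e_{ij}\}_{i<j}$ orthonormal and is identified with $\mathfrak{so}(5)$, so that the natural $SO(5)$-action is the adjoint action. $\widetilde G_2(\mathbb R^5)$ is the Grassmannian of oriented $2$-planes in $\mathbb R^5$. The group diagram $H\subset\{K_-,K_+\}\subset G$ of the action means: $H$ is the isotropy group at interior points $0<\theta<\pi/4$ of the orbit interval (principal isotropy), $K_-$ the isotropy group at $\theta=0$, and $K_+$ the isotropy group at $\theta=\pi/4$; $T^2$ is the maximal torus of rotations in the planes $\langle e_1,e_2\rangle$ and $\langle e_3,e_4\rangle$. $G\times_KD^3$ is the disk bundle over $G/K$ associated to a linear $K$-action on $D^3$ that is transitive on $\partial D^3\cong K/H$, and the union glues the two disk bundles along their common boundary sphere bundle $SO(5)/T^2$. *)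

theory Defs
  imports "HOL-Analysis.Analysis" "HOL-Algebra.Group_Action"
begin

section \<open>Smooth maps and smooth structures\<close>

primrec C_k_on :: "nat \<Rightarrow> 'a::euclidean_space set \<Rightarrow> ('a \<Rightarrow> 'b::euclidean_space) \<Rightarrow> bool" where
  "C_k_on 0 U f \<longleftrightarrow> continuous_on U f"
| "C_k_on (Suc k) U f \<longleftrightarrow>
     (\<exists>f'. (\<forall>x\<in>U. (f has_derivative f' x) (at x)) \<and> (\<forall>v. C_k_on k U (\<lambda>x. f' x v)))"

text \<open>A map on an arbitrary subset of a Euclidean space is smooth if it extends locally to a
  \<open>C\<^sup>\<infinity>\<close> map on an open set of the ambient space.\<close>

definition smooth_on :: "'a::euclidean_space set \<Rightarrow> ('a \<Rightarrow> 'b::euclidean_space) \<Rightarrow> bool" where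
  "smooth_on S f \<longleftrightarrow>
     (\<forall>x\<in>S. \<exists>U F. open U \<and> x \<in> U \<and> (\<forall>k. C_k_on k U F) \<and> (\<forall>y\<in>S \<inter> U. f y = F y))"

text \<open>A smooth structure (of a manifold, possibly with boundary) is recorded by its algebra of
  smooth real functions; a bijection of manifolds is a diffeomorphism iff it identifies these
  algebras.  Functions are total, only their values on the points matter.\<close>

record 'a diff_space =
  points :: "'a set"
  smooth_funs :: "('a \<Rightarrow> real) set"

definition diffeomorphism :: "'a diff_space \<Rightarrow> 'b diff_space \<Rightarrow> ('a \<Rightarrow> 'b) \<Rightarrow> bool" where
  "diffeomorphism M N \<phi> \<longleftrightarrow>
     bij_betw \<phi> (points M) (points N) \<and>
     (\<forall>f. f \<in> smooth_funs N \<longleftrightarrow> f \<circ> \<phi> \<in> smooth_funs M)"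

definition diffeomorphic :: "'a diff_space \<Rightarrow> 'b diff_space \<Rightarrow> bool" where
  "diffeomorphic M N \<longleftrightarrow> (\<exists>\<phi>. diffeomorphism M N \<phi>)"

definition sub_diff :: "'a::euclidean_space set \<Rightarrow> 'a diff_space" where
  "sub_diff S = \<lparr>points = S, smooth_funs = {f. smooth_on S f}\<rparr>"

text \<open>The structure on \<open>p ` S\<close> for which a function is smooth iff its pullback along \<open>p\<close> is.
  When \<open>p\<close> is the projection of a submanifold \<open>S\<close> onto its quotient by a free proper action of a
  Lie group, this is the manifold structure making \<open>p\<close> a submersion.\<close>

definition quotient_diff :: "'a::euclidean_space set \<Rightarrow> ('a \<Rightarrow> 'b) \<Rightarrow> 'b diff_space" where
  "quotient_diff S p = \<lparr>points = p ` S, smooth_funs = {f. smooth_on S (f \<circ> p)}\<rparr>"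

text \<open>Smooth \<open>d\<close>-dimensional submanifolds of a Euclidean space; open subsets of a
  \<open>d\<close>-dimensional linear subspace \<open>T\<close> play the role of open subsets of \<open>\<real>\<^sup>d\<close>.\<close>

definition smooth_submanifold :: "nat \<Rightarrow> 'a::euclidean_space set \<Rightarrow> bool" where
  "smooth_submanifold d S \<longleftrightarrow>
     (\<forall>x\<in>S. \<exists>U (T :: 'a set) W \<phi>. open U \<and> x \<in> U \<and> subspace T \<and> dim T = d \<and>
        openin (top_of_set T) W \<and> diffeomorphism (sub_diff W) (sub_diff (S \<inter> U)) \<phi>)"

definition has_codimension :: "'a::euclidean_space set \<Rightarrow> 'a set \<Rightarrow> nat \<Rightarrow> bool" where
  "has_codimension B M c \<longleftrightarrow> B \<subseteq> M \<and> B \<noteq> {} \<and>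
     (\<exists>d. smooth_submanifold d B \<and> smooth_submanifold (d + c) M)"


section \<open>Quotient topology\<close>

definition quotient_topology :: "'a topology \<Rightarrow> ('a \<Rightarrow> 'b) \<Rightarrow> 'b topology" where
  "quotient_topology X p =
     topology (\<lambda>V. V \<subseteq> p ` topspace X \<and> openin X {x \<in> topspace X. p x \<in> V})"

lemma openin_quotient_topology:
  "openin (quotient_topology X p) V \<longleftrightarrow>
     V \<subseteq> p ` topspace X \<and> openin X {x \<in> topspace X. p x \<in> V}"
proof -
  have 1: "{x \<in> topspace X. p x \<in> S \<inter> T} =
      {x \<in> topspace X. p x \<in> S} \<inter> {x \<in> topspace X. p x \<in> T}" for S T
    by auto
  have 2: "{x \<in> topspace X. p x \<in> \<Union>\<K>} = (\<Union>K\<in>\<K>. {x \<in> topspace X. p x \<in> K})" for \<K>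
    by auto
  have "istopology (\<lambda>V. V \<subseteq> p ` topspace X \<and> openin X {x \<in> topspace X. p x \<in> V})"
    unfolding istopology_def 1 2 by blast
  then show ?thesis
    by (simp add: quotient_topology_def topology_inverse')
qed

lemma topspace_quotient_topology [simp]:
  "topspace (quotient_topology X p) = p ` topspace X"
proof -
  have "{x \<in> topspace X. p x \<in> p ` topspace X} = topspace X"
    by auto
  then have "openin (quotient_topology X p) (p ` topspace X)"
    by (simp add: openin_quotient_topology)
  then show ?thesis
    by (meson openin_quotient_topology openin_subset openin_topspace subset_antisym)
qed


section \<open>The action of \<open>SO(5)\<close> on unit bivectors\<close>

definition SO5 :: "(real^5^5) monoid" where
  "SO5 = \<lparr>carrier = {g. rotation_matrix g}, mult = (**), one = mat 1\<rparr>"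

text \<open>\<open>\<Lambda>\<^sup>2\<real>\<^sup>5 = \<ss>\<oo>(5)\<close> is the space of skew-symmetric matrices.\<close>

definition bivectors :: "(real^5^5) set" where
  "bivectors = {A. transpose A = - A}"

definition wedge :: "real^5 \<Rightarrow> real^5 \<Rightarrow> real^5^5" where
  "wedge u v = (\<chi> i j. u $ i * v $ j - v $ i * u $ j)"

definition biv_inner :: "real^5^5 \<Rightarrow> real^5^5 \<Rightarrow> real" where
  "biv_inner A B = (A \<bullet> B) / 2"

text \<open>The factor \<open>1/2\<close> makes the \<open>e\<^sub>i \<and> e\<^sub>j\<close>, \<open>i < j\<close>, orthonormal:\<close>

lemma biv_inner_wedge:
  "biv_inner (wedge a b) (wedge c d) = (a \<bullet> c) * (b \<bullet> d) - (a \<bullet> d) * (b \<bullet> c)"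
proof -
  have "wedge a b \<bullet> wedge c d =
     (\<Sum>i\<in>UNIV. \<Sum>j\<in>UNIV. (a$i * c$i) * (b$j * d$j) - (a$i * d$i) * (b$j * c$j)
        - (b$i * c$i) * (a$j * d$j) + (b$i * d$i) * (a$j * c$j))"
    by (simp add: inner_vec_def wedge_def algebra_simps)
  also have "\<dots> = (a \<bullet> c) * (b \<bullet> d) - (a \<bullet> d) * (b \<bullet> c) - (b \<bullet> c) * (a \<bullet> d) + (b \<bullet> d) * (a \<bullet> c)"
    by (simp only: inner_vec_def sum.distrib sum_subtractf sum_product inner_real_def)
  finally show ?thesis
    by (simp add: biv_inner_def)
qed

definition unit_bivectors :: "(real^5^5) set" where
  "unit_bivectors = {A \<in> bivectors. biv_inner A A = 1}"

definition conj_action :: "real^5^5 \<Rightarrow> real^5^5 \<Rightarrow> real^5^5" where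
  "conj_action g = (\<lambda>A\<in>unit_bivectors. g ** A ** transpose g)"

lemma conj_wedge: "g ** wedge u v ** transpose g = wedge (g *v u) (g *v v)"
proof -
  have "(g ** wedge u v ** transpose g) $ i $ j = wedge (g *v u) (g *v v) $ i $ j" for i j
  proof -
    have "(g ** wedge u v ** transpose g) $ i $ j =
        (\<Sum>l\<in>UNIV. \<Sum>k\<in>UNIV. (g$i$k * u$k) * (g$j$l * v$l) - (g$i$k * v$k) * (g$j$l * u$l))"
      by (simp add: matrix_matrix_mult_def transpose_def wedge_def sum_distrib_left sum_distrib_right algebra_simps)
    also have "\<dots> = (\<Sum>k\<in>UNIV. \<Sum>l\<in>UNIV. (g$i$k * u$k) * (g$j$l * v$l) - (g$i$k * v$k) * (g$j$l * u$l))"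
      by (rule sum.swap)
    also have "\<dots> = wedge (g *v u) (g *v v) $ i $ j"
      by (simp only: wedge_def vec_lambda_beta matrix_vector_mult_def sum_subtractf sum_product)
    finally show ?thesis .
  qed
  then show ?thesis
    by (simp add: vec_eq_iff)
qed

definition e_vec :: "5 \<Rightarrow> real^5" where
  "e_vec i = axis i 1"

definition b_vec :: "real \<Rightarrow> real^5^5" where
  "b_vec \<theta> = cos \<theta> *\<^sub>R wedge (e_vec 1) (e_vec 2) + sin \<theta> *\<^sub>R wedge (e_vec 3) (e_vec 4)"

lemma b_vec_in_unit_bivectors: "b_vec \<theta> \<in> unit_bivectors"
proof -
  have o: "e_vec 1 \<bullet> e_vec 1 = 1" "e_vec 2 \<bullet> e_vec 2 = 1" "e_vec 3 \<bullet> e_vec 3 = 1" "e_vec 4 \<bullet> e_vec 4 = 1"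
    "e_vec 1 \<bullet> e_vec 2 = 0" "e_vec 1 \<bullet> e_vec 3 = 0" "e_vec 1 \<bullet> e_vec 4 = 0" "e_vec 2 \<bullet> e_vec 3 = 0" "e_vec 2 \<bullet> e_vec 4 = 0"
    "e_vec 3 \<bullet> e_vec 4 = 0"
    by (simp_all add: e_vec_def inner_axis_axis)
  have lin: "biv_inner (x *\<^sub>R A + y *\<^sub>R B) (x *\<^sub>R A + y *\<^sub>R B) =
      x\<^sup>2 * biv_inner A A + 2 * x * y * biv_inner A B + y\<^sup>2 * biv_inner B B" for x y A B
    by (simp add: biv_inner_def inner_add_left inner_add_right inner_commute[of B A]
        power2_eq_square field_simps)
  have "biv_inner (b_vec \<theta>) (b_vec \<theta>) = 1"
    unfolding b_vec_def lin biv_inner_wedge using o by (simp add: inner_commute)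
  moreover have "b_vec \<theta> \<in> bivectors"
    by (simp add: bivectors_def b_vec_def wedge_def transpose_def vec_eq_iff algebra_simps)
  ultimately show ?thesis
    by (simp add: unit_bivectors_def)
qed

definition biv_orbit_space :: "(real^5^5) set topology" where
  "biv_orbit_space = quotient_topology (top_of_set unit_bivectors) (orbit SO5 conj_action)"

abbreviation isotropy :: "real^5^5 \<Rightarrow> (real^5^5) set" where
  "isotropy A \<equiv> stabilizer SO5 conj_action A"


section \<open>The isotropy groups\<close>

definition block_rotation :: "real^2^2 \<Rightarrow> real^3^3 \<Rightarrow> real^5^5" where
  "block_rotation A B = vector
     [vector [A$1$1, A$1$2, 0, 0, 0],
      vector [A$2$1, A$2$2, 0, 0, 0],
      vector [0, 0, B$1$1, B$1$2, B$1$3],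
      vector [0, 0, B$2$1, B$2$2, B$2$3],
      vector [0, 0, B$3$1, B$3$2, B$3$3]]"

text \<open>\<open>\<complex>\<^sup>2 = \<real>\<^sup>4 \<subset> \<real>\<^sup>5\<close> via \<open>z\<^sub>1 = x\<^sub>1 + \<i> x\<^sub>2\<close>, \<open>z\<^sub>2 = x\<^sub>3 + \<i> x\<^sub>4\<close>; the fifth coordinate is fixed.\<close>

definition realify :: "complex^2^2 \<Rightarrow> real^5^5" where
  "realify A = vector
     [vector [Re (A$1$1), - Im (A$1$1), Re (A$1$2), - Im (A$1$2), 0],
      vector [Im (A$1$1),   Re (A$1$1), Im (A$1$2),   Re (A$1$2), 0],
      vector [Re (A$2$1), - Im (A$2$1), Re (A$2$2), - Im (A$2$2), 0],
      vector [Im (A$2$1),   Re (A$2$1), Im (A$2$2),   Re (A$2$2), 0],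
      vector [0, 0, 0, 0, 1]]"

definition unitary_matrix :: "complex^'n^'n \<Rightarrow> bool" where
  "unitary_matrix A \<longleftrightarrow> A ** transpose (map_matrix cnj A) = mat 1"

definition torus_rotation :: "real \<Rightarrow> real \<Rightarrow> real^5^5" where
  "torus_rotation s t = vector
     [vector [cos s, - sin s, 0, 0, 0],
      vector [sin s,   cos s, 0, 0, 0],
      vector [0, 0, cos t, - sin t, 0],
      vector [0, 0, sin t,   cos t, 0],
      vector [0, 0, 0, 0, 1]]"

definition T2 :: "(real^5^5) set" where
  "T2 = {torus_rotation s t | s t. True}"

datatype side = Minus | Plus

primrec K_side :: "side \<Rightarrow> (real^5^5) set" where
  "K_side Minus = {block_rotation A B | A B. rotation_matrix A \<and> rotation_matrix B}"
| "K_side Plus = {realify A | A. unitary_matrix A}"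

primrec singular_angle :: "side \<Rightarrow> real" where
  "singular_angle Minus = 0"
| "singular_angle Plus = pi / 4"


section \<open>Homogeneous spaces, the oriented Grassmannian and projective space\<close>

definition homogeneous_space :: "(real^5^5) set \<Rightarrow> (real^5^5) set \<Rightarrow> (real^5^5) set diff_space" where
  "homogeneous_space G H = quotient_diff G (\<lambda>g. g <#\<^bsub>SO5\<^esub> H)"

text \<open>The orbit of \<open>A\<close> is \<open>G/H\<close>, through the orbit map \<open>gH \<mapsto> g \<cdot> A\<close>.\<close>

definition orbit_is_homogeneous :: "real^5^5 \<Rightarrow> (real^5^5) set \<Rightarrow> bool" where
  "orbit_is_homogeneous A H \<longleftrightarrow>
     (\<exists>\<phi>. diffeomorphism (homogeneous_space (carrier SO5) H)
            (sub_diff (orbit SO5 conj_action A)) \<phi> \<and>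
          (\<forall>g\<in>carrier SO5. \<phi> (g <#\<^bsub>SO5\<^esub> H) = conj_action g A))"

definition orthonormal_pairs :: "((real^5) \<times> (real^5)) set" where
  "orthonormal_pairs = {(u, v). norm u = 1 \<and> norm v = 1 \<and> u \<bullet> v = 0}"

text \<open>An oriented plane is represented by the set of its positively oriented orthonormal bases;
  the determinant below is that of the change of basis from \<open>(u, v)\<close> to \<open>(x, y)\<close>.\<close>

definition oriented_plane :: "(real^5) \<times> (real^5) \<Rightarrow> ((real^5) \<times> (real^5)) set" where
  "oriented_plane = (\<lambda>(u, v). {(x, y) \<in> orthonormal_pairs. span {x, y} = span {u, v} \<and>
     (u \<bullet> x) * (v \<bullet> y) - (u \<bullet> y) * (v \<bullet> x) > 0})"

definition oriented_Grassmannian :: "((real^5) \<times> (real^5)) set diff_space" where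
  "oriented_Grassmannian = quotient_diff orthonormal_pairs oriented_plane"

definition complex_line :: "complex^4 \<Rightarrow> (complex^4) set" where
  "complex_line z = range (\<lambda>c. c *s z)"

definition CP3 :: "(complex^4) set diff_space" where
  "CP3 = quotient_diff (UNIV - {0}) complex_line"


section \<open>Disk bundles and their union\<close>

definition linear_disk_action :: "(real^5^5 \<Rightarrow> real^3^3) \<Rightarrow> real^5^5 \<Rightarrow> real^3 \<Rightarrow> real^3" where
  "linear_disk_action \<rho> k = (\<lambda>x\<in>cball 0 1. \<rho> k *v x)"

text \<open>\<open>L\<close> acts on \<open>D\<^sup>3\<close> linearly and smoothly, transitively on \<open>\<partial>D\<^sup>3\<close>, with isotropy group \<open>H\<close>
  at the point \<open>v\<close> of \<open>\<partial>D\<^sup>3\<close>.\<close>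

definition disk_representation ::
    "(real^5^5) set \<Rightarrow> (real^5^5) set \<Rightarrow> (real^5^5 \<Rightarrow> real^3^3) \<Rightarrow> real^3 \<Rightarrow> bool" where
  "disk_representation L H \<rho> v \<longleftrightarrow>
     group_action (SO5\<lparr>carrier := L\<rparr>) (cball 0 1) (linear_disk_action \<rho>) \<and>
     smooth_on L \<rho> \<and>
     v \<in> sphere 0 1 \<and>
     orbit (SO5\<lparr>carrier := L\<rparr>) (linear_disk_action \<rho>) v = sphere 0 1 \<and>
     stabilizer (SO5\<lparr>carrier := L\<rparr>) (linear_disk_action \<rho>) v = H"

text \<open>\<open>[g, x] \<in> SO(5) \<times>\<^sub>L D\<^sup>3\<close>, the orbit of \<open>(g, x)\<close> under \<open>k \<cdot> (g, x) = (g k\<^sup>-\<^sup>1, \<rho> k x)\<close>.\<close>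

definition assoc_point ::
    "(real^5^5) set \<Rightarrow> (real^5^5 \<Rightarrow> real^3^3) \<Rightarrow> (real^5^5) \<times> (real^3) \<Rightarrow> ((real^5^5) \<times> (real^3)) set" where
  "assoc_point L \<rho> = (\<lambda>(g, x). {(g ** matrix_inv k, \<rho> k *v x) | k. k \<in> L})"

definition disk_bundle ::
    "(real^5^5) set \<Rightarrow> (real^5^5 \<Rightarrow> real^3^3) \<Rightarrow> ((real^5^5) \<times> (real^3)) set diff_space" where
  "disk_bundle L \<rho> = quotient_diff (carrier SO5 \<times> cball 0 1) (assoc_point L \<rho>)"

definition disk_bundle_topology ::
    "(real^5^5) set \<Rightarrow> (real^5^5 \<Rightarrow> real^3^3) \<Rightarrow> ((real^5^5) \<times> (real^3)) set topology" where
  "disk_bundle_topology L \<rho> =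
     quotient_topology (top_of_set (carrier SO5 \<times> cball 0 1)) (assoc_point L \<rho>)"

text \<open>If \<open>v s\<close> has isotropy group \<open>H\<close> under \<open>\<rho> s\<close>, both boundary sphere bundles are identified
  with \<open>SO(5)/H\<close> by \<open>gH \<mapsto> [g, v s]\<close>; the union glues them along this identification.\<close>

definition glue ::
    "(side \<Rightarrow> real^5^5 \<Rightarrow> real^3^3) \<Rightarrow> (side \<Rightarrow> real^3) \<Rightarrow>
     side \<times> ((real^5^5) \<times> (real^3)) set \<Rightarrow> (side \<times> ((real^5^5) \<times> (real^3)) set) set" where
  "glue \<rho> v p = {q. equivclp (\<lambda>x y. \<exists>g\<in>carrier SO5.
       x = (Minus, assoc_point (K_side Minus) (\<rho> Minus) (g, v Minus)) \<and>
       y = (Plus, assoc_point (K_side Plus) (\<rho> Plus) (g, v Plus))) p q}"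

definition double_disk_topology ::
    "(side \<Rightarrow> real^5^5 \<Rightarrow> real^3^3) \<Rightarrow> (side \<Rightarrow> real^3) \<Rightarrow>
     (side \<times> ((real^5^5) \<times> (real^3)) set) set topology" where
  "double_disk_topology \<rho> v =
     quotient_topology (sum_topology (\<lambda>s. disk_bundle_topology (K_side s) (\<rho> s)) UNIV) (glue \<rho> v)"

text \<open>The smooth structure of the union is the one (unique up to diffeomorphism) for which the
  two disk bundles are smoothly embedded as closed domains with common boundary.  A
  diffeomorphism from the union to a submanifold \<open>M\<close> is thus a homeomorphism that maps each of the
  disk bundles diffeomorphically onto its image.  The decomposition is one of \<open>SO(5)\<close>-manifolds,
  so the diffeomorphism is moreover required to be equivariant for \<open>h \<cdot> [g, x] = [h g, x]\<close>.\<close>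

definition double_disk_decomposition ::
    "(side \<Rightarrow> real^5^5 \<Rightarrow> real^3^3) \<Rightarrow> (side \<Rightarrow> real^3) \<Rightarrow> (real^5^5) set \<Rightarrow> bool" where
  "double_disk_decomposition \<rho> v M \<longleftrightarrow>
     (\<exists>\<Phi>. homeomorphic_map (double_disk_topology \<rho> v) (top_of_set M) \<Phi> \<and>
        (\<forall>s. let \<Phi>\<^sub>s = (\<lambda>c. \<Phi> (glue \<rho> v (s, c))) in
           diffeomorphism (disk_bundle (K_side s) (\<rho> s))
             (sub_diff (\<Phi>\<^sub>s ` points (disk_bundle (K_side s) (\<rho> s)))) \<Phi>\<^sub>s \<and>
           (\<forall>h\<in>carrier SO5. \<forall>g\<in>carrier SO5. \<forall>x\<in>cball 0 1.
              \<Phi>\<^sub>s (assoc_point (K_side s) (\<rho> s) (h ** g, x)) =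
              conj_action h (\<Phi>\<^sub>s (assoc_point (K_side s) (\<rho> s) (g, x))))))"

end

theory Submission
  imports Defs
begin

text \<open>Conjugation by \<open>SO(5)\<close> on the space of skew-symmetric matrices is the adjoint representation, so
  the orbit through a bivector meets the plane spanned by \<open>e\<^sub>1\<^sub>2\<close> and \<open>e\<^sub>3\<^sub>4\<close>, and the Weyl group (exchange
  of the two coefficients, change of their signs) brings the point of intersection into the chamber
  \<open>0 \<le> \<theta> \<le> \<pi>/4\<close>.  A maximum of a linear height function over the compact orbit is such a point
  (\<open>bivector_normal_form\<close>).  The invariant \<open>|A\<^sup>2|\<^sup>2\<close> takes the value \<open>2 - sin\<^sup>2 2\<theta>\<close> at \<open>b\<^sub>\<theta>\<close> and is
  injective on the chamber; hence it separates the orbits, the angle is a continuous function on the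
  sphere, and the orbit space is the interval.  The isotropy group of \<open>b\<^sub>\<theta>\<close> is its centraliser, which
  depends only on coincidences between the eigenvalues \<open>\<plusminus>i cos \<theta>\<close>, \<open>\<plusminus>i sin \<theta>\<close>, \<open>0\<close>
  (\<open>commutes_b_vec\<close>).

  All diffeomorphisms come from one principle: a smooth surjection with smooth local sections
  identifies the quotient of its source by its fibres with its image
  (\<open>diffeomorphism_quotient_diff\<close>).  For an orbit map \<open>g \<mapsto> g b\<^sub>\<theta> g\<^sup>T\<close> a local section is an
  orthonormal frame adapted to the bivector that depends smoothly on it: polynomials in the bivector
  project to its invariant planes, and the Gram-Schmidt process does the rest
  (\<open>has_local_sections_b_vec\<close>).  This proves that the orbits are the homogeneous spaces \<open>G/H\<close>, and all
  other sections are built from these.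

  The normal space of a singular orbit at \<open>b\<^sub>s\<close> is the orthogonal complement of \<open>b\<^sub>s\<close> in its
  centraliser; it is a copy of \<open>\<real>\<^sup>3\<close>, on which the isotropy group \<open>K\<close> acts linearly.  The tube
  \<open>[g, x] \<mapsto> g (b\<^sub>s + r\<^sub>s x) g\<^sup>T / |b\<^sub>s + r\<^sub>s x|\<close> has an equivariant smooth retraction \<open>core\<close> to the singular
  orbit, given by an odd polynomial in the bivector.  An element of \<open>SO(5)\<close> that maps a point of the
  slice to a point of the slice thus fixes \<open>b\<^sub>s\<close> and lies in \<open>K\<close> (\<open>core_fixes_K_side\<close>).  Since the
  points of the slice at a given distance from \<open>b\<^sub>s\<close> have the same invariant, they lie in one orbit of
  \<open>SO(5)\<close> and therefore in one orbit of \<open>K\<close>: the slice representation is transitive on the sphere, with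
  isotropy group \<open>T\<^sup>2\<close>, and the tube is the disk bundle.  The radii \<open>r\<^sub>s\<close> are \<open>1/3\<close> and \<open>1/2\<close>; because
  \<open>arctan (1/3) + arctan (1/2) = \<pi>/4\<close>, the two tubes fill the sphere and meet exactly in the orbit at the
  angle \<open>arctan (1/3)\<close>.  The induced map of the glued space is a continuous bijection from a compact
  space onto the sphere, hence a homeomorphism.

  The orbit at \<open>\<theta> = 0\<close> consists of the bivectors \<open>u \<and> v\<close> of orthonormal pairs, which determine
  and are determined by the oriented plane that \<open>(u, v)\<close> spans.  The orbit at \<open>\<theta> = \<pi>/4\<close> is the image of the moment map of the
  spin representation of \<open>Spin(5) = Sp(2)\<close> on \<open>\<complex>\<^sup>4\<close>.  With \<open>A\<close> in this orbit and \<open>n\<close> the unit vector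
  in the kernel of \<open>A\<close> with the appropriate sign, the Hermitian matrix \<open>1 + n \<cdot> \<gamma> + \<surd>2 A \<cdot> \<gamma>\<gamma>\<close> has
  rank one, and the line that it spans is the inverse image of \<open>A\<close> in \<open>\<complex>P\<^sup>3\<close>.  The codimensions are
  read off from explicit charts, of dimension \<open>6\<close> for the singular orbits and \<open>9\<close> for the sphere.\<close>


section \<open>Calculus of smooth maps\<close>

lemma C_k_on_subset: "C_k_on k U f \<Longrightarrow> V \<subseteq> U \<Longrightarrow> C_k_on k V f"
  by (induction k arbitrary: f) (auto intro: continuous_on_subset, blast)

lemma C_k_on_Suc_D: "C_k_on (Suc k) U f \<Longrightarrow> C_k_on k U f"
proof (induction k arbitrary: f)
  case 0
  then show ?case
    by (auto simp: intro!: continuous_at_imp_continuous_on dest: has_derivative_continuous)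
next
  case (Suc k)
  then obtain f' where "\<forall>x\<in>U. (f has_derivative f' x) (at x)" "\<forall>v. C_k_on (Suc k) U (\<lambda>x. f' x v)"
    by auto
  then show ?case using Suc.IH by (auto intro!: exI[of _ f'])
qed

lemma C_k_on_const: "C_k_on k U (\<lambda>x. c)"
  by (induction k arbitrary: c) (auto intro!: exI[of _ "\<lambda>_ _. 0"])

lemma C_k_on_linear: "bounded_linear f \<Longrightarrow> C_k_on k U f"
  by (cases k)
     (auto intro!: exI[of _ "\<lambda>_. f"] C_k_on_const bounded_linear_imp_has_derivative
        linear_continuous_on)

lemma C_k_on_compose_linear:
  assumes "bounded_linear h" shows "C_k_on k U f \<Longrightarrow> C_k_on k U (\<lambda>x. h (f x))"
proof (induction k arbitrary: f)
  case 0
  then show ?case using bounded_linear.continuous_on[OF assms] by simp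
next
  case (Suc k)
  then obtain f' where "\<forall>x\<in>U. (f has_derivative f' x) (at x)" "\<forall>v. C_k_on k U (\<lambda>x. f' x v)"
    by auto
  then show ?case using Suc.IH
    by (auto intro!: exI[of _ "\<lambda>x v. h (f' x v)"] bounded_linear.has_derivative[OF assms])
qed

lemma C_k_on_add: "C_k_on k U f \<Longrightarrow> C_k_on k U g \<Longrightarrow> C_k_on k U (\<lambda>x. f x + g x)"
proof (induction k arbitrary: f g)
  case 0
  then show ?case by (simp add: continuous_on_add)
next
  case (Suc k)
  then obtain f' g' where
    "\<forall>x\<in>U. (f has_derivative f' x) (at x)" "\<forall>v. C_k_on k U (\<lambda>x. f' x v)"
    "\<forall>x\<in>U. (g has_derivative g' x) (at x)" "\<forall>v. C_k_on k U (\<lambda>x. g' x v)"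
    by auto
  then show ?case using Suc.IH
    by (auto intro!: exI[of _ "\<lambda>x v. f' x v + g' x v"] has_derivative_add)
qed

lemma C_k_on_sum: "(\<And>i. i \<in> I \<Longrightarrow> C_k_on k U (f i)) \<Longrightarrow> C_k_on k U (\<lambda>x. \<Sum>i\<in>I. f i x)"
  by (induction I rule: infinite_finite_induct) (auto intro: C_k_on_const C_k_on_add)

lemma C_k_on_bilinear:
  assumes "bounded_bilinear h"
  shows "C_k_on k U f \<Longrightarrow> C_k_on k U g \<Longrightarrow> C_k_on k U (\<lambda>x. h (f x) (g x))"
proof (induction k arbitrary: f g)
  case 0
  then show ?case by (simp add: bounded_bilinear.continuous_on[OF assms])
next
  case (Suc k)
  then obtain f' g' where *:
    "\<forall>x\<in>U. (f has_derivative f' x) (at x)" "\<forall>v. C_k_on k U (\<lambda>x. f' x v)"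
    "\<forall>x\<in>U. (g has_derivative g' x) (at x)" "\<forall>v. C_k_on k U (\<lambda>x. g' x v)"
    by auto
  have "\<forall>x\<in>U. ((\<lambda>x. h (f x) (g x)) has_derivative (\<lambda>v. h (f x) (g' x v) + h (f' x v) (g x))) (at x)"
    using bounded_bilinear.FDERIV[OF assms] * by blast
  moreover have "\<forall>v. C_k_on k U (\<lambda>x. h (f x) (g' x v) + h (f' x v) (g x))"
    using * Suc.IH C_k_on_Suc_D[OF Suc.prems(1)] C_k_on_Suc_D[OF Suc.prems(2)]
    by (simp add: C_k_on_add)
  ultimately show ?case
    by (auto intro!: exI[of _ "\<lambda>x v. h (f x) (g' x v) + h (f' x v) (g x)"])
qed

text \<open>The derivative of \<open>g \<circ> f\<close> is expanded along a basis, so that it becomes a sum of products of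
  a component of \<open>f'\<close> and a function of the form \<open>(D\<^sub>b g) \<circ> f\<close>; the latter are covered by the
  induction hypothesis.\<close>

lemma C_k_on_compose:
  "C_k_on k V g \<Longrightarrow> C_k_on k U f \<Longrightarrow> f ` U \<subseteq> V \<Longrightarrow> C_k_on k U (\<lambda>x. g (f x))"
proof (induction k arbitrary: g)
  case 0
  then show ?case using continuous_on_compose2 by auto
next
  case (Suc k)
  then obtain f' g' where *:
    "\<forall>x\<in>U. (f has_derivative f' x) (at x)" "\<forall>v. C_k_on k U (\<lambda>x. f' x v)"
    "\<forall>x\<in>V. (g has_derivative g' x) (at x)" "\<forall>v. C_k_on k V (\<lambda>x. g' x v)"
    by auto
  let ?d = "\<lambda>x v. \<Sum>b\<in>Basis. (f' x v \<bullet> b) *\<^sub>R g' (f x) b"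
  have "((\<lambda>x. g (f x)) has_derivative ?d x) (at x)" if "x \<in> U" for x
  proof -
    have g: "(g has_derivative g' (f x)) (at (f x))" using * Suc.prems that by auto
    have e: "g' (f x) w = (\<Sum>b\<in>Basis. (w \<bullet> b) *\<^sub>R g' (f x) b)" for w
    proof -
      have l: "linear (g' (f x))" using g has_derivative_linear by blast
      have "g' (f x) w = g' (f x) (\<Sum>b\<in>Basis. (w \<bullet> b) *\<^sub>R b)"
        by (simp only: euclidean_representation)
      also have "\<dots> = (\<Sum>b\<in>Basis. (w \<bullet> b) *\<^sub>R g' (f x) b)"
        using l by (simp add: linear_sum linear_scale)
      finally show ?thesis .
    qed
    have "?d x = (\<lambda>v. g' (f x) (f' x v))" by (rule ext) (rule e[symmetric])
    then show ?thesis using has_derivative_compose[of f "f' x" x UNIV g "g' (f x)"] g * that by auto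
  qed
  moreover have "C_k_on k U (\<lambda>x. ?d x v)" for v
  proof -
    have "C_k_on k U (\<lambda>x. f' x v \<bullet> b)" for b
      using * by (auto intro: C_k_on_compose_linear[OF bounded_linear_inner_left])
    moreover have "C_k_on k U (\<lambda>x. g' (f x) b)" for b
      using Suc.IH[of "\<lambda>y. g' y b"] * C_k_on_Suc_D[OF Suc.prems(2)] Suc.prems(3) by simp
    ultimately show ?thesis
      by (intro C_k_on_sum C_k_on_bilinear[OF bounded_bilinear_scaleR]) auto
  qed
  ultimately show ?case by (auto intro!: exI[of _ ?d])
qed

lemma C_k_on_inverse: "C_k_on k (- {0}) (inverse :: real \<Rightarrow> real)"
proof (induction k)
  case 0
  then show ?case by (auto intro!: continuous_intros)
next
  case (Suc k)
  have "((inverse :: real \<Rightarrow> real) has_derivative (\<lambda>v. - (inverse x * v * inverse x))) (at x)"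
    if "x \<in> - {0}" for x
    using that by (intro has_derivative_inverse') auto
  moreover have "C_k_on k (- {0}) (\<lambda>x::real. - (inverse x * v * inverse x))" for v
    by (intro C_k_on_compose_linear[OF bounded_linear_minus[OF bounded_linear_ident]]
        C_k_on_bilinear[OF bounded_bilinear_mult] Suc C_k_on_const)
  ultimately show ?case by (auto intro!: exI[of _ "\<lambda>x v. - (inverse x * v * inverse x)"])
qed

lemma C_k_on_sqrt: "C_k_on k {0<..} sqrt"
proof (induction k)
  case 0
  then show ?case by (auto intro!: continuous_intros)
next
  case (Suc k)
  have "(sqrt has_derivative (\<lambda>v. v * (inverse (sqrt x) / 2))) (at x)"
    if "x \<in> {0<..}" for x
  proof -
    have "(*) (inverse (sqrt x) / 2) = (\<lambda>v. v * (inverse (sqrt x) / 2))" by (simp add: fun_eq_iff)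
    then show ?thesis using that DERIV_real_sqrt[of x] by (simp add: has_field_derivative_def)
  qed
  moreover have "C_k_on k {0<..} (\<lambda>x. v * (inverse (sqrt x) / 2))" for v
  proof -
    have "C_k_on k {0<..} (\<lambda>x. inverse (sqrt x))"
      by (rule C_k_on_compose[OF C_k_on_inverse Suc]) auto
    then have "C_k_on k {0<..} (\<lambda>x. v * (inverse (sqrt x) * (1/2)))"
      by (intro C_k_on_bilinear[OF bounded_bilinear_mult] C_k_on_const)
    then show ?thesis by simp
  qed
  ultimately show ?case by (auto intro!: exI[of _ "\<lambda>x v. v * (inverse (sqrt x) / 2)"])
qed

text \<open>Smoothness is needed pointwise, because the square roots and quotients below are smooth only near
  the points under consideration; the pointwise form turns it into a system of introduction rules
  whose side conditions refer to the value at one point.\<close>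

definition smooth_at :: "'a::euclidean_space set \<Rightarrow> 'a \<Rightarrow> ('a \<Rightarrow> 'b::euclidean_space) \<Rightarrow> bool" where
  "smooth_at S x f \<longleftrightarrow>
     (\<exists>U F. open U \<and> x \<in> U \<and> (\<forall>k. C_k_on k U F) \<and> (\<forall>y\<in>S \<inter> U. f y = F y))"

lemma smooth_on_iff_smooth_at: "smooth_on S f \<longleftrightarrow> (\<forall>x\<in>S. smooth_at S x f)"
  by (auto simp: smooth_on_def smooth_at_def)

lemma smooth_onD: "smooth_on S f \<Longrightarrow> x \<in> S \<Longrightarrow> smooth_at S x f"
  by (auto simp: smooth_on_iff_smooth_at)

abbreviation near :: "'a::euclidean_space set \<Rightarrow> 'a \<Rightarrow> 'a filter" where
  "near S x \<equiv> inf (nhds x) (principal S)"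

lemma eventually_near:
  "eventually P (near S x) \<longleftrightarrow> (\<exists>U. open U \<and> x \<in> U \<and> (\<forall>y\<in>S \<inter> U. P y))"
  by (auto simp: eventually_inf_principal eventually_nhds)

lemma eventually_near_self: "eventually P (near S x) \<Longrightarrow> x \<in> S \<Longrightarrow> P x"
  by (auto simp: eventually_near)

lemma eventually_near_mem: "eventually (\<lambda>y. y \<in> S) (near S x)"
  by (auto simp: eventually_inf_principal)

lemma smooth_at_cong:
  assumes "eventually (\<lambda>y. f y = g y) (near S x)" "smooth_at S x f"
  shows "smooth_at S x g"
proof -
  obtain U F where U: "open U" "x \<in> U" "\<forall>k. C_k_on k U F" "\<forall>y\<in>S \<inter> U. f y = F y"
    using assms(2) by (auto simp: smooth_at_def)
  obtain V where V: "open V" "x \<in> V" "\<forall>y\<in>S \<inter> V. g y = f y"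
    using assms(1) by (auto simp: eventually_near eq_commute)
  show ?thesis unfolding smooth_at_def using U V
    by (intro exI[of _ "U \<inter> V"] exI[of _ F]) (auto intro: C_k_on_subset)
qed

lemma smooth_on_cong: "(\<And>x. x \<in> S \<Longrightarrow> f x = g x) \<Longrightarrow> smooth_on S f \<longleftrightarrow> smooth_on S g"
  by (simp add: smooth_on_def)

lemma smooth_at_tendsto:
  assumes "smooth_at S x f" "x \<in> S"
  shows "(f \<longlongrightarrow> f x) (near S x)"
proof -
  obtain U F where U: "open U" "x \<in> U" "\<forall>k. C_k_on k U F" "\<forall>y\<in>S \<inter> U. f y = F y"
    using assms(1) by (auto simp: smooth_at_def)
  have "continuous_on U F" using U(3) C_k_on.simps(1) by blast
  then have "isCont F x" using U by (simp add: continuous_on_eq_continuous_at)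
  then have "(F \<longlongrightarrow> F x) (nhds x)"
    by (simp add: continuous_at tendsto_at_iff_tendsto_nhds)
  then have "(F \<longlongrightarrow> F x) (near S x)"
    by (rule tendsto_mono[rotated]) simp
  moreover have "eventually (\<lambda>y. F y = f y) (near S x)" using U by (auto simp: eventually_near)
  moreover have "F x = f x" using U assms by auto
  ultimately show ?thesis using tendsto_cong by fastforce
qed

lemma smooth_on_imp_continuous_on: "smooth_on S f \<Longrightarrow> continuous_on S f"
  unfolding continuous_on_def
proof
  fix x assume "smooth_on S f" "x \<in> S"
  then have "(f \<longlongrightarrow> f x) (near S x)" by (simp add: smooth_at_tendsto smooth_onD)
  then show "(f \<longlongrightarrow> f x) (at x within S)"
    by (rule tendsto_mono[rotated]) (simp only: at_within_def, rule inf_mono, auto)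
qed

lemma smooth_at_const: "smooth_at S x (\<lambda>y. c)"
  unfolding smooth_at_def by (intro exI[of _ UNIV] exI[of _ "\<lambda>_. c"]) (auto intro: C_k_on_const)

lemma smooth_at_linear: "linear f \<Longrightarrow> smooth_at S x f"
  unfolding smooth_at_def
  by (intro exI[of _ UNIV] exI[of _ f]) (auto intro!: C_k_on_linear linear_conv_bounded_linear[THEN iffD1])

lemma smooth_at_ident: "smooth_at S x (\<lambda>y. y)"
  by (rule smooth_at_linear) (rule linear_id[unfolded id_def])

lemma smooth_at_compose:
  assumes g: "smooth_at T (f x) g" and f: "smooth_at S x f" and x: "x \<in> S"
    and T: "eventually (\<lambda>y. f y \<in> T) (near S x)"
  shows "smooth_at S x (\<lambda>y. g (f y))"
proof -
  obtain U F where U: "open U" "x \<in> U" "\<forall>k. C_k_on k U F" "\<forall>y\<in>S \<inter> U. f y = F y"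
    using f by (auto simp: smooth_at_def)
  obtain V G where V: "open V" "f x \<in> V" "\<forall>k. C_k_on k V G" "\<forall>y\<in>T \<inter> V. g y = G y"
    using g by (auto simp: smooth_at_def)
  have "continuous_on U F" using U(3) C_k_on.simps(1) by blast
  then have o: "open (U \<inter> F -` V)"
    using U V by (auto intro: continuous_open_preimage)
  have "smooth_at S x (\<lambda>y. G (F y))"
    unfolding smooth_at_def
    using U V o x
    by (intro exI[of _ "U \<inter> F -` V"] exI[of _ "\<lambda>y. G (F y)"])
      (auto intro!: C_k_on_compose[of _ V G _ F] intro: C_k_on_subset)
  moreover have "eventually (\<lambda>y. y \<in> U \<inter> F -` V) (near S x)"
    unfolding eventually_near using o U V x by (intro exI[of _ "U \<inter> F -` V"]) auto
  then have "eventually (\<lambda>y. G (F y) = g (f y)) (near S x)"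
    using T eventually_near_mem[of S x] by eventually_elim (use U V in auto)
  ultimately show ?thesis by (rule smooth_at_cong[rotated])
qed

lemma smooth_at_compose_open:
  assumes "\<And>k. C_k_on k V G" "open V" "f x \<in> V" "smooth_at S x f" "x \<in> S"
  shows "smooth_at S x (\<lambda>y. G (f y))"
  by (rule smooth_at_compose[where T=UNIV and g=G])
    (use assms in \<open>auto simp: smooth_at_def intro!: exI[of _ V] exI[of _ G]\<close>)

lemma smooth_at_inverse:
  fixes f :: "_ \<Rightarrow> real"
  shows "smooth_at S x f \<Longrightarrow> x \<in> S \<Longrightarrow> f x \<noteq> 0 \<Longrightarrow> smooth_at S x (\<lambda>y. inverse (f y))"
  by (rule smooth_at_compose_open[OF C_k_on_inverse]) auto

lemma smooth_at_sqrt: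
  "smooth_at S x f \<Longrightarrow> x \<in> S \<Longrightarrow> 0 < f x \<Longrightarrow> smooth_at S x (\<lambda>y. sqrt (f y))"
  by (rule smooth_at_compose_open[OF C_k_on_sqrt]) auto

lemma smooth_at_binop:
  fixes S :: "'a::euclidean_space set"
  assumes "\<And>k (U :: 'a set) f g. C_k_on k U f \<Longrightarrow> C_k_on k U g \<Longrightarrow> C_k_on k U (\<lambda>x. h (f x) (g x))"
    and "smooth_at S x f" "smooth_at S x g"
  shows "smooth_at S x (\<lambda>y. h (f y) (g y))"
proof -
  obtain U F where U: "open U" "x \<in> U" "\<forall>k. C_k_on k U F" "\<forall>y\<in>S \<inter> U. f y = F y"
    using assms by (auto simp: smooth_at_def)
  obtain V G where V: "open V" "x \<in> V" "\<forall>k. C_k_on k V G" "\<forall>y\<in>S \<inter> V. g y = G y"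
    using assms by (auto simp: smooth_at_def)
  show ?thesis unfolding smooth_at_def using U V assms(1)
    by (intro exI[of _ "U \<inter> V"] exI[of _ "\<lambda>y. h (F y) (G y)"]) (auto intro!: assms(1)[of _ "U \<inter> V"] intro: C_k_on_subset)
qed

lemma smooth_at_add: "smooth_at S x f \<Longrightarrow> smooth_at S x g \<Longrightarrow> smooth_at S x (\<lambda>y. f y + g y)"
  by (rule smooth_at_binop) (rule C_k_on_add)

lemma smooth_at_bilinear:
  "bounded_bilinear h \<Longrightarrow> smooth_at S x f \<Longrightarrow> smooth_at S x g \<Longrightarrow> smooth_at S x (\<lambda>y. h (f y) (g y))"
  by (rule smooth_at_binop) (rule C_k_on_bilinear)

lemma smooth_at_compose_linear:
  assumes "linear h" "smooth_at S x f"
  shows "smooth_at S x (\<lambda>y. h (f y))"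
  using smooth_at_binop[of "\<lambda>a b. h a" S x f f] assms
  by (auto intro!: C_k_on_compose_linear simp: linear_conv_bounded_linear)

lemma smooth_at_minus: "smooth_at S x f \<Longrightarrow> smooth_at S x (\<lambda>y. - f y)"
  by (rule smooth_at_compose_linear) (auto intro: linear_uminus)

lemma smooth_at_diff: "smooth_at S x f \<Longrightarrow> smooth_at S x g \<Longrightarrow> smooth_at S x (\<lambda>y. f y - g y)"
  using smooth_at_add[of S x f "\<lambda>y. - g y"] smooth_at_minus by auto

lemma smooth_at_sum: "(\<And>i. i \<in> I \<Longrightarrow> smooth_at S x (f i)) \<Longrightarrow> smooth_at S x (\<lambda>y. \<Sum>i\<in>I. f i y)"
  by (induction I rule: infinite_finite_induct) (auto intro: smooth_at_const smooth_at_add)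

lemma smooth_at_Pair: "smooth_at S x f \<Longrightarrow> smooth_at S x g \<Longrightarrow> smooth_at S x (\<lambda>y. (f y, g y))"
proof -
  assume "smooth_at S x f" "smooth_at S x g"
  then have "smooth_at S x (\<lambda>y. (f y, 0) + (0, g y))"
    by (intro smooth_at_add smooth_at_compose_linear[of "\<lambda>a. (a, 0)"]
        smooth_at_compose_linear[of "\<lambda>a. (0, a)"]) (auto intro!: linearI)
  then show ?thesis by simp
qed

lemmas smooth_at_fst = smooth_at_compose_linear[OF linear_fst]
lemmas smooth_at_snd = smooth_at_compose_linear[OF linear_snd]
lemmas smooth_at_scaleR = smooth_at_bilinear[OF bounded_bilinear_scaleR]
lemmas smooth_at_inner = smooth_at_bilinear[OF bounded_bilinear_inner]

lemma smooth_at_mult: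
  fixes f g :: "_ \<Rightarrow> 'b::{euclidean_space, real_normed_algebra}"
  shows "smooth_at S x f \<Longrightarrow> smooth_at S x g \<Longrightarrow> smooth_at S x (\<lambda>y. f y * g y)"
  by (rule smooth_at_bilinear[OF bounded_bilinear_mult])

lemma smooth_at_divide:
  fixes f g :: "_ \<Rightarrow> real"
  shows "smooth_at S x f \<Longrightarrow> smooth_at S x g \<Longrightarrow> x \<in> S \<Longrightarrow> g x \<noteq> 0 \<Longrightarrow> smooth_at S x (\<lambda>y. f y / g y)"
  unfolding divide_inverse by (intro smooth_at_mult smooth_at_inverse)

lemma smooth_at_power:
  fixes f :: "_ \<Rightarrow> real"
  shows "smooth_at S x f \<Longrightarrow> smooth_at S x (\<lambda>y. f y ^ n)"
  by (induction n) (auto intro: smooth_at_const smooth_at_mult)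

lemma smooth_at_vec_nth:
  fixes f :: "_ \<Rightarrow> ('b::euclidean_space)^'n"
  shows "smooth_at S x f \<Longrightarrow> smooth_at S x (\<lambda>y. f y $ i)"
  by (rule smooth_at_compose_linear) (auto intro!: linearI)

lemma smooth_at_vec:
  fixes f :: "_ \<Rightarrow> ('b::euclidean_space)^'n"
  assumes "\<And>i. smooth_at S x (\<lambda>y. f y $ i)"
  shows "smooth_at S x f"
proof -
  have "f = (\<lambda>y. \<Sum>i\<in>UNIV. axis i (f y $ i))"
    by (auto simp: vec_eq_iff axis_def)
  moreover have "linear (axis i :: 'b \<Rightarrow> 'b^'n)" for i
    by (rule linearI) (auto simp: vec_eq_iff axis_def)
  then have "smooth_at S x (\<lambda>y. \<Sum>i\<in>UNIV. axis i (f y $ i))"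
    by (intro smooth_at_sum smooth_at_compose_linear[of "axis _"] assms)
  ultimately show ?thesis by simp
qed

lemma smooth_at_matrix_mult:
  fixes f :: "_ \<Rightarrow> real^'n^'m" and g :: "_ \<Rightarrow> real^'k^'n"
  shows "smooth_at S x f \<Longrightarrow> smooth_at S x g \<Longrightarrow> smooth_at S x (\<lambda>y. f y ** g y)"
  by (rule smooth_at_vec, rule smooth_at_vec)
    (auto simp: matrix_matrix_mult_def intro!: smooth_at_sum smooth_at_mult smooth_at_vec_nth)

lemma smooth_at_matrix_vector_mult:
  fixes f :: "_ \<Rightarrow> real^'n^'m" and g :: "_ \<Rightarrow> real^'n"
  shows "smooth_at S x f \<Longrightarrow> smooth_at S x g \<Longrightarrow> smooth_at S x (\<lambda>y. f y *v g y)"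
  by (rule smooth_at_vec)
    (auto simp: matrix_vector_mult_def intro!: smooth_at_sum smooth_at_mult smooth_at_vec_nth)

lemma smooth_at_transpose:
  fixes f :: "_ \<Rightarrow> real^'n^'m"
  shows "smooth_at S x f \<Longrightarrow> smooth_at S x (\<lambda>y. transpose (f y))"
  by (rule smooth_at_vec, rule smooth_at_vec)
    (auto simp: transpose_def intro!: smooth_at_vec_nth)

lemmas smooth_intros = smooth_at_const smooth_at_ident smooth_at_add smooth_at_diff smooth_at_minus
  smooth_at_scaleR smooth_at_mult smooth_at_inner smooth_at_Pair smooth_at_fst smooth_at_snd
  smooth_at_matrix_mult smooth_at_matrix_vector_mult smooth_at_transpose smooth_at_sum
  smooth_at_vec_nth smooth_at_power smooth_at_inverse smooth_at_divide smooth_at_sqrt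


section \<open>Quotient structures and local sections\<close>

text \<open>Together with smoothness and surjectivity, this plays the role of being a submersion.\<close>

definition has_local_sections ::
    "'a::euclidean_space set \<Rightarrow> 'b::euclidean_space set \<Rightarrow> ('a \<Rightarrow> 'b) \<Rightarrow> bool" where
  "has_local_sections S D q \<longleftrightarrow>
     (\<forall>y\<in>D. \<exists>\<sigma>. smooth_at D y \<sigma> \<and> eventually (\<lambda>z. \<sigma> z \<in> S \<and> q (\<sigma> z) = z) (near D y))"

text \<open>If \<open>f \<circ> q\<close> is smooth then so is \<open>f = (f \<circ> q) \<circ> \<sigma>\<close> for every local section \<open>\<sigma>\<close>.\<close>

lemma smooth_on_pullback_iff:
  assumes q: "smooth_on S q" "q ` S \<subseteq> D" and sec: "has_local_sections S D q"
  shows "smooth_on D f \<longleftrightarrow> smooth_on S (\<lambda>x. f (q x))"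
proof
  assume f: "smooth_on D f"
  show "smooth_on S (\<lambda>x. f (q x))"
    unfolding smooth_on_iff_smooth_at
  proof
    fix x assume "x \<in> S"
    then show "smooth_at S x (\<lambda>x. f (q x))"
      using q f by (intro smooth_at_compose[of D q x f S])
        (auto simp: smooth_on_iff_smooth_at eventually_inf_principal image_subset_iff)
  qed
next
  assume f: "smooth_on S (\<lambda>x. f (q x))"
  show "smooth_on D f"
    unfolding smooth_on_iff_smooth_at
  proof
    fix y assume y: "y \<in> D"
    then obtain \<sigma> where \<sigma>: "smooth_at D y \<sigma>" "eventually (\<lambda>z. \<sigma> z \<in> S \<and> q (\<sigma> z) = z) (near D y)"
      using sec by (auto simp: has_local_sections_def)
    have "\<sigma> y \<in> S" using eventually_near_self[OF \<sigma>(2) y] by simp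
    then have "smooth_at D y (\<lambda>z. f (q (\<sigma> z)))"
      using f \<sigma> y by (intro smooth_at_compose[of S \<sigma> y "\<lambda>x. f (q x)" D])
        (auto simp: smooth_on_iff_smooth_at elim: eventually_mono)
    then show "smooth_at D y f"
      by (rule smooth_at_cong[rotated]) (use \<sigma>(2) in \<open>auto elim: eventually_mono\<close>)
  qed
qed

text \<open>The principle behind every diffeomorphism of the theory: a quotient by the fibres of \<open>q\<close> carries the
  structure of the image of \<open>q\<close>.\<close>

lemma diffeomorphism_quotient_diff:
  assumes q: "smooth_on S q" "q ` S = D" and sec: "has_local_sections S D q"
    and fib: "\<And>x y. x \<in> S \<Longrightarrow> y \<in> S \<Longrightarrow> p x = p y \<longleftrightarrow> q x = q y"
    and \<phi>: "\<And>x. x \<in> S \<Longrightarrow> \<phi> (p x) = q x"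
  shows "diffeomorphism (quotient_diff S p) (sub_diff D) \<phi>"
proof -
  have "bij_betw \<phi> (p ` S) D"
    unfolding bij_betw_def inj_on_def using q fib \<phi> by (auto simp: image_image)
  moreover have "smooth_on D f \<longleftrightarrow> smooth_on S (f \<circ> \<phi> \<circ> p)" for f :: "_ \<Rightarrow> real"
  proof -
    have "smooth_on S (f \<circ> \<phi> \<circ> p) \<longleftrightarrow> smooth_on S (\<lambda>x. f (q x))"
      by (rule smooth_on_cong) (simp add: \<phi>)
    then show ?thesis using smooth_on_pullback_iff[OF q(1) _ sec] q(2) by simp
  qed
  ultimately show ?thesis
    by (simp add: diffeomorphism_def quotient_diff_def sub_diff_def)
qed

lemma diffeomorphism_quotient_diff_ex:
  assumes q: "smooth_on S q" "q ` S = D" and sec: "has_local_sections S D q"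
    and fib: "\<And>x y. x \<in> S \<Longrightarrow> y \<in> S \<Longrightarrow> p x = p y \<longleftrightarrow> q x = q y"
  obtains \<phi> where "diffeomorphism (quotient_diff S p) (sub_diff D) \<phi>" "\<And>x. x \<in> S \<Longrightarrow> \<phi> (p x) = q x"
proof -
  define \<phi> where "\<phi> c = q (SOME x. x \<in> S \<and> p x = c)" for c
  have "\<phi> (p x) = q x" if "x \<in> S" for x
  proof -
    have "(SOME y. y \<in> S \<and> p y = p x) \<in> S \<and> p (SOME y. y \<in> S \<and> p y = p x) = p x"
      by (rule someI[of _ x]) (use that in auto)
    then show ?thesis using fib that by (auto simp: \<phi>_def)
  qed
  with that show thesis using diffeomorphism_quotient_diff[OF q sec fib] by blast
qed

text \<open>A homogeneous space is compared with the Grassmannian or with projective space through the orbit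
  of which both are presentations as a quotient.\<close>

lemma diffeomorphic_quotients_common_image:
  assumes "diffeomorphism (quotient_diff S p) (sub_diff D) \<phi>"
    and "diffeomorphism (quotient_diff S' p') (sub_diff D) \<psi>"
  shows "diffeomorphic (quotient_diff S p) (quotient_diff S' p')"
proof -
  let ?i = "inv_into (p' ` S') \<psi>"
  have b: "bij_betw \<phi> (p ` S) D" "bij_betw \<psi> (p' ` S') D"
    and s: "\<And>f :: _ \<Rightarrow> real. smooth_on D f \<longleftrightarrow> smooth_on S (f \<circ> \<phi> \<circ> p)"
           "\<And>f :: _ \<Rightarrow> real. smooth_on D f \<longleftrightarrow> smooth_on S' (f \<circ> \<psi> \<circ> p')"
    using assms unfolding diffeomorphism_def quotient_diff_def sub_diff_def by auto
  have i: "bij_betw ?i D (p' ` S')" using b(2) by (rule bij_betw_inv_into)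
  have "smooth_on S' (f \<circ> p') \<longleftrightarrow> smooth_on S (f \<circ> (?i \<circ> \<phi>) \<circ> p)" for f :: "_ \<Rightarrow> real"
  proof -
    have "smooth_on S (f \<circ> (?i \<circ> \<phi>) \<circ> p) \<longleftrightarrow> smooth_on D (f \<circ> ?i)"
      using s(1)[of "f \<circ> ?i"] by (simp add: o_assoc)
    also have "\<dots> \<longleftrightarrow> smooth_on S' (f \<circ> ?i \<circ> \<psi> \<circ> p')"
      by (rule s(2))
    also have "\<dots> \<longleftrightarrow> smooth_on S' (f \<circ> p')"
      by (rule smooth_on_cong) (use b(2) in \<open>auto simp: bij_betw_def\<close>)
    finally show ?thesis by simp
  qed
  then have "diffeomorphism (quotient_diff S p) (quotient_diff S' p') (?i \<circ> \<phi>)"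
    using bij_betw_trans[OF b(1) i] by (simp add: diffeomorphism_def quotient_diff_def)
  then show ?thesis by (auto simp: diffeomorphic_def)
qed


section \<open>Matrices of size five\<close>

lemma exhaust_5:
  fixes x :: 5
  shows "x = 1 \<or> x = 2 \<or> x = 3 \<or> x = 4 \<or> x = 5"
proof (induct x)
  case (of_int z)
  then have "0 \<le> z" and "z < 5" by simp_all
  then have "z = 0 \<or> z = 1 \<or> z = 2 \<or> z = 3 \<or> z = 4" by arith
  then show ?case by auto
qed

lemma UNIV_5: "UNIV = {1, 2, 3, 4, 5 :: 5}"
  using exhaust_5 by auto

lemma forall_5: "(\<forall>i::5. P i) \<longleftrightarrow> P 1 \<and> P 2 \<and> P 3 \<and> P 4 \<and> P 5"
  by (metis exhaust_5)

lemma sum_5: "sum f (UNIV :: 5 set) = f 1 + f 2 + f 3 + f 4 + f 5"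
  unfolding UNIV_5 by (simp add: ac_simps)

lemma vector_5 [simp]:
  "(vector [a, b, c, d, e] :: ('a::zero)^5) $ 1 = a"
  "(vector [a, b, c, d, e] :: ('a::zero)^5) $ 2 = b"
  "(vector [a, b, c, d, e] :: ('a::zero)^5) $ 3 = c"
  "(vector [a, b, c, d, e] :: ('a::zero)^5) $ 4 = d"
  "(vector [a, b, c, d, e] :: ('a::zero)^5) $ 5 = e"
  unfolding vector_def by simp_all

lemma det_5:
  fixes A :: "('a::comm_ring_1)^5^5"
  shows "det A =
     A$1$1 * (A$2$2 * (A$3$3 * (A$4$4 * A$5$5 - A$4$5 * A$5$4) - A$3$4 * (A$4$3 * A$5$5 - A$4$5 *
     A$5$3) + A$3$5 * (A$4$3 * A$5$4 - A$4$4 * A$5$3)) - A$2$3 * (A$3$2 * (A$4$4 * A$5$5 - A$4$5 *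
     A$5$4) - A$3$4 * (A$4$2 * A$5$5 - A$4$5 * A$5$2) + A$3$5 * (A$4$2 * A$5$4 - A$4$4 * A$5$2)) +
     A$2$4 * (A$3$2 * (A$4$3 * A$5$5 - A$4$5 * A$5$3) - A$3$3 * (A$4$2 * A$5$5 - A$4$5 * A$5$2) +
     A$3$5 * (A$4$2 * A$5$3 - A$4$3 * A$5$2)) - A$2$5 * (A$3$2 * (A$4$3 * A$5$4 - A$4$4 * A$5$3) -
     A$3$3 * (A$4$2 * A$5$4 - A$4$4 * A$5$2) + A$3$4 * (A$4$2 * A$5$3 - A$4$3 * A$5$2))) - A$1$2 *
     (A$2$1 * (A$3$3 * (A$4$4 * A$5$5 - A$4$5 * A$5$4) - A$3$4 * (A$4$3 * A$5$5 - A$4$5 * A$5$3) +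
     A$3$5 * (A$4$3 * A$5$4 - A$4$4 * A$5$3)) - A$2$3 * (A$3$1 * (A$4$4 * A$5$5 - A$4$5 * A$5$4) -
     A$3$4 * (A$4$1 * A$5$5 - A$4$5 * A$5$1) + A$3$5 * (A$4$1 * A$5$4 - A$4$4 * A$5$1)) + A$2$4 *
     (A$3$1 * (A$4$3 * A$5$5 - A$4$5 * A$5$3) - A$3$3 * (A$4$1 * A$5$5 - A$4$5 * A$5$1) + A$3$5 *
     (A$4$1 * A$5$3 - A$4$3 * A$5$1)) - A$2$5 * (A$3$1 * (A$4$3 * A$5$4 - A$4$4 * A$5$3) - A$3$3 *
     (A$4$1 * A$5$4 - A$4$4 * A$5$1) + A$3$4 * (A$4$1 * A$5$3 - A$4$3 * A$5$1))) + A$1$3 * (A$2$1 *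
     (A$3$2 * (A$4$4 * A$5$5 - A$4$5 * A$5$4) - A$3$4 * (A$4$2 * A$5$5 - A$4$5 * A$5$2) + A$3$5 *
     (A$4$2 * A$5$4 - A$4$4 * A$5$2)) - A$2$2 * (A$3$1 * (A$4$4 * A$5$5 - A$4$5 * A$5$4) - A$3$4 *
     (A$4$1 * A$5$5 - A$4$5 * A$5$1) + A$3$5 * (A$4$1 * A$5$4 - A$4$4 * A$5$1)) + A$2$4 * (A$3$1 *
     (A$4$2 * A$5$5 - A$4$5 * A$5$2) - A$3$2 * (A$4$1 * A$5$5 - A$4$5 * A$5$1) + A$3$5 * (A$4$1 *
     A$5$2 - A$4$2 * A$5$1)) - A$2$5 * (A$3$1 * (A$4$2 * A$5$4 - A$4$4 * A$5$2) - A$3$2 * (A$4$1 *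
     A$5$4 - A$4$4 * A$5$1) + A$3$4 * (A$4$1 * A$5$2 - A$4$2 * A$5$1))) - A$1$4 * (A$2$1 * (A$3$2 *
     (A$4$3 * A$5$5 - A$4$5 * A$5$3) - A$3$3 * (A$4$2 * A$5$5 - A$4$5 * A$5$2) + A$3$5 * (A$4$2 *
     A$5$3 - A$4$3 * A$5$2)) - A$2$2 * (A$3$1 * (A$4$3 * A$5$5 - A$4$5 * A$5$3) - A$3$3 * (A$4$1 *
     A$5$5 - A$4$5 * A$5$1) + A$3$5 * (A$4$1 * A$5$3 - A$4$3 * A$5$1)) + A$2$3 * (A$3$1 * (A$4$2 *
     A$5$5 - A$4$5 * A$5$2) - A$3$2 * (A$4$1 * A$5$5 - A$4$5 * A$5$1) + A$3$5 * (A$4$1 * A$5$2 -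
     A$4$2 * A$5$1)) - A$2$5 * (A$3$1 * (A$4$2 * A$5$3 - A$4$3 * A$5$2) - A$3$2 * (A$4$1 * A$5$3 -
     A$4$3 * A$5$1) + A$3$3 * (A$4$1 * A$5$2 - A$4$2 * A$5$1))) + A$1$5 * (A$2$1 * (A$3$2 * (A$4$3 *
     A$5$4 - A$4$4 * A$5$3) - A$3$3 * (A$4$2 * A$5$4 - A$4$4 * A$5$2) + A$3$4 * (A$4$2 * A$5$3 -
     A$4$3 * A$5$2)) - A$2$2 * (A$3$1 * (A$4$3 * A$5$4 - A$4$4 * A$5$3) - A$3$3 * (A$4$1 * A$5$4 -
     A$4$4 * A$5$1) + A$3$4 * (A$4$1 * A$5$3 - A$4$3 * A$5$1)) + A$2$3 * (A$3$1 * (A$4$2 * A$5$4 -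
     A$4$4 * A$5$2) - A$3$2 * (A$4$1 * A$5$4 - A$4$4 * A$5$1) + A$3$4 * (A$4$1 * A$5$2 - A$4$2 *
     A$5$1)) - A$2$4 * (A$3$1 * (A$4$2 * A$5$3 - A$4$3 * A$5$2) - A$3$2 * (A$4$1 * A$5$3 - A$4$3 *
     A$5$1) + A$3$3 * (A$4$1 * A$5$2 - A$4$2 * A$5$1)))"
proof -
  have f: "finite {2::5, 3, 4, 5}" "1 \<notin> {2::5, 3, 4, 5}"
    "finite {3::5, 4, 5}" "2 \<notin> {3::5, 4, 5}"
    "finite {4::5, 5}" "3 \<notin> {4::5, 5}" "finite {5::5}" "4 \<notin> {5::5}"
    by auto
  show ?thesis
    unfolding det_def UNIV_5
    unfolding sum_over_permutations_insert[OF f(1,2)]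
    unfolding sum_over_permutations_insert[OF f(3,4)]
    unfolding sum_over_permutations_insert[OF f(5,6)]
    unfolding sum_over_permutations_insert[OF f(7,8)]
    unfolding permutes_sing
    by (simp add: sign_swap_id permutation_swap_id sign_compose sign_id swap_id_eq
        permutation_compose algebra_simps)
qed

lemma matrix_eq_iff_5:
  fixes A B :: "'a^5^5"
  shows "A = B \<longleftrightarrow>
    A$1$1 = B$1$1 \<and> A$1$2 = B$1$2 \<and> A$1$3 = B$1$3 \<and> A$1$4 = B$1$4 \<and> A$1$5 = B$1$5 \<and>
    A$2$1 = B$2$1 \<and> A$2$2 = B$2$2 \<and> A$2$3 = B$2$3 \<and> A$2$4 = B$2$4 \<and> A$2$5 = B$2$5 \<and>
    A$3$1 = B$3$1 \<and> A$3$2 = B$3$2 \<and> A$3$3 = B$3$3 \<and> A$3$4 = B$3$4 \<and> A$3$5 = B$3$5 \<and>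
    A$4$1 = B$4$1 \<and> A$4$2 = B$4$2 \<and> A$4$3 = B$4$3 \<and> A$4$4 = B$4$4 \<and> A$4$5 = B$4$5 \<and>
    A$5$1 = B$5$1 \<and> A$5$2 = B$5$2 \<and> A$5$3 = B$5$3 \<and> A$5$4 = B$5$4 \<and> A$5$5 = B$5$5"
  by (simp add: vec_eq_iff forall_5)

lemma matrix_mult_nth_5:
  fixes A B :: "'a::semiring_1^5^5"
  shows "(A ** B) $ i $ j = A$i$1 * B$1$j + A$i$2 * B$2$j + A$i$3 * B$3$j + A$i$4 * B$4$j + A$i$5 * B$5$j"
  by (simp add: matrix_matrix_mult_def sum_5)

lemma transpose_nth: "transpose A $ i $ j = A $ j $ i"
  by (simp add: transpose_def)

lemma mat_1_nth: "mat 1 $ i $ j = (if i = j then 1 else 0)"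
  by (simp add: mat_def)

lemma inner_matrix_5: "(A :: real^5^5) \<bullet> B =
    A$1$1 * B$1$1 + A$1$2 * B$1$2 + A$1$3 * B$1$3 + A$1$4 * B$1$4 + A$1$5 * B$1$5 +
    A$2$1 * B$2$1 + A$2$2 * B$2$2 + A$2$3 * B$2$3 + A$2$4 * B$2$4 + A$2$5 * B$2$5 +
    A$3$1 * B$3$1 + A$3$2 * B$3$2 + A$3$3 * B$3$3 + A$3$4 * B$3$4 + A$3$5 * B$3$5 +
    A$4$1 * B$4$1 + A$4$2 * B$4$2 + A$4$3 * B$4$3 + A$4$4 * B$4$4 + A$4$5 * B$4$5 +
    A$5$1 * B$5$1 + A$5$2 * B$5$2 + A$5$3 * B$5$3 + A$5$4 * B$5$4 + A$5$5 * B$5$5"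
  by (simp add: inner_vec_def sum_5)

lemma matrix_add_rdistrib: "(A + B) ** C = A ** C + B ** C" for A :: "'a::semiring_1^'n^'m"
  by (simp add: vec_eq_iff matrix_matrix_mult_def sum.distrib algebra_simps)

lemma matrix_neg_left: "(- A) ** B = - (A ** B)" for A :: "real^'n^'m" and B :: "real^'k^'n"
  by (simp add: vec_eq_iff matrix_matrix_mult_def sum_negf)

lemma matrix_neg_right: "A ** (- B) = - (A ** B)" for A :: "real^'n^'m" and B :: "real^'k^'n"
  by (simp add: vec_eq_iff matrix_matrix_mult_def sum_negf)

lemma matrix_scaleR_left: "(c *\<^sub>R A) ** B = c *\<^sub>R (A ** B)" for A :: "real^'n^'m" and B :: "real^'k^'n"
  by (simp add: vec_eq_iff matrix_matrix_mult_def sum_distrib_left mult.assoc)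

lemma matrix_scaleR_right: "A ** (c *\<^sub>R B) = c *\<^sub>R (A ** B)" for A :: "real^'n^'m" and B :: "real^'k^'n"
  by (simp add: vec_eq_iff matrix_matrix_mult_def sum_distrib_left mult.left_commute)

lemma transpose_add: "transpose (A + B) = transpose A + transpose (B :: 'a::plus^'n^'m)"
  by (simp add: vec_eq_iff transpose_def)

lemma transpose_scaleR: "transpose (c *\<^sub>R A) = c *\<^sub>R transpose (A :: real^'n^'m)"
  by (simp add: vec_eq_iff transpose_def)

lemma inner_matrix_mult_left: "(g ** A) \<bullet> B = A \<bullet> (transpose g ** B)"
  for g :: "real^'n^'m" and A :: "real^'k^'n"
proof -
  have "(g ** A) \<bullet> B = (\<Sum>i\<in>UNIV. \<Sum>j\<in>UNIV. \<Sum>k\<in>UNIV. g$i$k * A$k$j * B$i$j)"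
    by (simp add: inner_vec_def matrix_matrix_mult_def sum_distrib_right)
  also have "\<dots> = (\<Sum>i\<in>UNIV. \<Sum>k\<in>UNIV. \<Sum>j\<in>UNIV. g$i$k * A$k$j * B$i$j)"
    by (intro sum.cong refl sum.swap)
  also have "\<dots> = (\<Sum>k\<in>UNIV. \<Sum>i\<in>UNIV. \<Sum>j\<in>UNIV. g$i$k * A$k$j * B$i$j)"
    by (rule sum.swap)
  also have "\<dots> = (\<Sum>k\<in>UNIV. \<Sum>j\<in>UNIV. \<Sum>i\<in>UNIV. g$i$k * A$k$j * B$i$j)"
    by (intro sum.cong refl sum.swap)
  also have "\<dots> = A \<bullet> (transpose g ** B)"
    by (simp add: inner_vec_def matrix_matrix_mult_def transpose_def sum_distrib_left mult_ac)
  finally show ?thesis .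
qed

lemma inner_transpose: "transpose A \<bullet> transpose B = A \<bullet> (B :: real^'n^'m)"
  by (simp add: inner_vec_def transpose_def) (rule sum.swap)

lemma inner_matrix_mult_right: "(A ** g) \<bullet> B = A \<bullet> (B ** transpose g)"
  for A :: "real^'n^'m" and g :: "real^'k^'n"
proof -
  have "(A ** g) \<bullet> B = transpose (A ** g) \<bullet> transpose B" by (simp only: inner_transpose)
  also have "\<dots> = transpose A \<bullet> (g ** transpose B)"
    by (simp only: matrix_transpose_mul inner_matrix_mult_left transpose_transpose)
  also have "g ** transpose B = transpose (B ** transpose g)"
    by (simp only: matrix_transpose_mul transpose_transpose)
  finally show ?thesis by (simp only: inner_transpose)
qed


section \<open>The group \<open>SO(5)\<close> and its action by conjugation\<close>

lemma SO5_simps [simp]: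
  "mult SO5 = (**)" "one SO5 = mat 1" "x \<in> carrier SO5 \<longleftrightarrow> rotation_matrix x"
  by (simp_all add: SO5_def)

lemma SO5_D:
  assumes "rotation_matrix (g :: real^'n^'n)"
  shows "transpose g ** g = mat 1" "g ** transpose g = mat 1" "det g = 1"
  using assms by (auto simp: rotation_matrix_def orthogonal_matrix_def)

lemma rotation_matrix_mult:
  "rotation_matrix g \<Longrightarrow> rotation_matrix h \<Longrightarrow> rotation_matrix (g ** h :: real^'n^'n)"
  by (auto simp: rotation_matrix_def orthogonal_matrix_mul det_mul)

lemma rotation_matrix_transpose: "rotation_matrix g \<Longrightarrow> rotation_matrix (transpose g :: real^'n^'n)"
  by (auto simp: rotation_matrix_def orthogonal_matrix_transpose)

lemma rotation_matrix_1: "rotation_matrix (mat 1 :: real^'n^'n)"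
  by (simp add: rotation_matrix_def orthogonal_matrix_id)

lemma rotation_cancel [simp]:
  assumes "rotation_matrix (g :: real^'n^'n)"
  shows "transpose g ** (g ** A) = A" "g ** (transpose g ** A) = A"
    "B ** g ** transpose g = B" "B ** transpose g ** g = B"
  using SO5_D[OF assms] by (auto simp: matrix_mul_assoc) (simp_all add: matrix_mul_assoc[symmetric])

lemma group_SO5: "group SO5"
proof (rule groupI)
  fix g assume "g \<in> carrier SO5"
  then show "\<exists>h\<in>carrier SO5. h \<otimes>\<^bsub>SO5\<^esub> g = \<one>\<^bsub>SO5\<^esub>"
    by (intro bexI[of _ "transpose g"]) (auto simp: SO5_D rotation_matrix_transpose)
qed (auto simp: rotation_matrix_mult rotation_matrix_1 matrix_mul_assoc)

lemma matrix_inv_rotation: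
  assumes "rotation_matrix (g :: real^'n^'n)"
  shows "matrix_inv g = transpose g"
proof -
  have "\<exists>h. g ** h = mat 1 \<and> h ** g = mat 1" using SO5_D[OF assms] by blast
  then have "matrix_inv g ** g = mat 1" unfolding matrix_inv_def by (rule someI2_ex) simp
  then have "matrix_inv g ** g ** transpose g = mat 1 ** transpose g" by simp
  then show ?thesis by (simp add: assms)
qed

definition cj :: "real^'n^'n \<Rightarrow> real^'n^'n \<Rightarrow> real^'n^'n" where
  "cj g A = g ** A ** transpose g"

lemma cj_1 [simp]: "cj (mat 1) A = A"
  by (simp add: cj_def)

lemma cj_cj: "cj g (cj h A) = cj (g ** h) A"
  by (simp add: cj_def matrix_transpose_mul matrix_mul_assoc)

lemma cj_add: "cj g (A + B) = cj g A + cj g B"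
  by (simp add: cj_def matrix_add_ldistrib matrix_add_rdistrib)

lemma cj_scaleR: "cj g (c *\<^sub>R A) = c *\<^sub>R cj g A"
  by (simp add: cj_def matrix_scaleR_left matrix_scaleR_right)

lemma cj_uminus: "cj g (- A) = - cj g A"
  by (simp add: cj_def matrix_neg_left matrix_neg_right)

lemma linear_cj: "linear (cj g)"
  by (rule linearI) (simp_all add: cj_add cj_scaleR)

lemma cj_mult: "rotation_matrix g \<Longrightarrow> cj g (A ** B) = cj g A ** cj g B"
  by (simp add: cj_def matrix_mul_assoc)

lemma cj_inner: "rotation_matrix g \<Longrightarrow> cj g A \<bullet> cj g B = A \<bullet> B"
proof -
  assume g: "rotation_matrix g"
  have "cj g A \<bullet> cj g B = (g ** A) \<bullet> (g ** B ** transpose g ** g)"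
    by (simp add: cj_def inner_matrix_mult_right)
  also have "\<dots> = A \<bullet> (transpose g ** (g ** B))"
    using g by (simp add: inner_matrix_mult_left)
  finally show ?thesis using g by simp
qed

lemma cj_biv_inner: "rotation_matrix g \<Longrightarrow> biv_inner (cj g A) (cj g B) = biv_inner A B"
  by (simp add: biv_inner_def cj_inner)

lemma cj_inverse [simp]:
  "rotation_matrix g \<Longrightarrow> cj (transpose g) (cj g A) = A"
  "rotation_matrix g \<Longrightarrow> cj g (cj (transpose g) A) = A"
  by (simp_all add: cj_cj SO5_D)

lemma cj_fixes_iff_commutes: "rotation_matrix g \<Longrightarrow> cj g A = A \<longleftrightarrow> g ** A = A ** g"
  by (metis cj_def rotation_cancel(3,4))

lemma cj_bivectors: "A \<in> bivectors \<Longrightarrow> cj g A \<in> bivectors"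
  by (simp add: bivectors_def cj_def matrix_transpose_mul matrix_neg_left matrix_neg_right matrix_mul_assoc)

lemma cj_unit_bivectors:
  "rotation_matrix g \<Longrightarrow> A \<in> unit_bivectors \<Longrightarrow> cj g A \<in> unit_bivectors"
  by (simp add: unit_bivectors_def cj_bivectors cj_biv_inner)

lemma conj_action_eq: "A \<in> unit_bivectors \<Longrightarrow> conj_action g A = cj g A"
  by (simp add: conj_action_def cj_def)

lemma subspace_bivectors: "subspace bivectors"
  by (auto simp: subspace_def bivectors_def transpose_add transpose_scaleR)
    (simp add: vec_eq_iff transpose_def)

text \<open>The laws of an action on elements suffice: that every \<open>a g\<close> is a permutation of \<open>E\<close> follows by means
  of the inverse element.\<close>

lemma group_action_subgroup_SO5I:
  assumes G: "group G" "mult G = (**)" "one G = mat 1" "carrier G \<subseteq> carrier SO5"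
    and cl: "\<And>g x. g \<in> carrier G \<Longrightarrow> x \<in> E \<Longrightarrow> a g x \<in> E"
    and m: "\<And>g h x. g \<in> carrier G \<Longrightarrow> h \<in> carrier G \<Longrightarrow> x \<in> E \<Longrightarrow> a (g ** h) x = a g (a h x)"
    and o: "\<And>x. x \<in> E \<Longrightarrow> a (mat 1) x = x"
  shows "group_action G E (\<lambda>g. \<lambda>x\<in>E. a g x)"
proof -
  interpret G: group G by fact
  have "bij_betw (a g) E E" if g: "g \<in> carrier G" for g
  proof (rule bij_betwI[where g = "a (inv\<^bsub>G\<^esub> g)"])
    show "a g \<in> E \<rightarrow> E" "a (inv\<^bsub>G\<^esub> g) \<in> E \<rightarrow> E" using cl g by auto
    fix x assume x: "x \<in> E"
    have "g ** inv\<^bsub>G\<^esub> g = mat 1" "inv\<^bsub>G\<^esub> g ** g = mat 1"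
      using G.r_inv[OF g] G.l_inv[OF g] G by simp_all
    then show "a (inv\<^bsub>G\<^esub> g) (a g x) = x" "a g (a (inv\<^bsub>G\<^esub> g) x) = x"
      using m[of "inv\<^bsub>G\<^esub> g" g x] m[of g "inv\<^bsub>G\<^esub> g" x] o g x by simp_all
  qed
  then have b: "bij_betw (\<lambda>x\<in>E. a g x) E E" if "g \<in> carrier G" for g
    using that bij_betw_cong[of E "\<lambda>x\<in>E. a g x" "a g" E] by simp
  have "(\<lambda>g. \<lambda>x\<in>E. a g x) \<in> hom G (BijGroup E)"
  proof (rule homI)
    fix g assume "g \<in> carrier G"
    then show "(\<lambda>x\<in>E. a g x) \<in> carrier (BijGroup E)"
      using b by (simp add: BijGroup_def Bij_def)
  next
    fix g h assume gh: "g \<in> carrier G" "h \<in> carrier G"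
    show "(\<lambda>x\<in>E. a (g \<otimes>\<^bsub>G\<^esub> h) x) = (\<lambda>x\<in>E. a g x) \<otimes>\<^bsub>BijGroup E\<^esub> (\<lambda>x\<in>E. a h x)"
    proof -
      have "(\<lambda>x\<in>E. a g x) \<in> Bij E" "(\<lambda>x\<in>E. a h x) \<in> Bij E"
        using b gh by (simp_all add: Bij_def)
      moreover have "(\<lambda>x\<in>E. a (g \<otimes>\<^bsub>G\<^esub> h) x) = compose E (\<lambda>x\<in>E. a g x) (\<lambda>x\<in>E. a h x)"
        using gh m cl by (auto simp: G compose_def restrict_def fun_eq_iff)
      ultimately show ?thesis by (simp add: BijGroup_def)
    qed
  qed
  then show ?thesis
    unfolding group_action_def group_hom_def group_hom_axioms_def
    using G.is_group group_BijGroup by blast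
qed

lemma group_action_SO5: "group_action SO5 unit_bivectors conj_action"
proof -
  have "group_action SO5 unit_bivectors (\<lambda>g. \<lambda>A\<in>unit_bivectors. cj g A)"
    by (rule group_action_subgroup_SO5I)
      (auto simp: group_SO5 cj_unit_bivectors cj_cj)
  moreover have "conj_action = (\<lambda>g. \<lambda>A\<in>unit_bivectors. cj g A)"
    by (auto simp: conj_action_def cj_def)
  ultimately show ?thesis by simp
qed

lemma orbit_eq: "A \<in> unit_bivectors \<Longrightarrow> orbit SO5 conj_action A = {cj g A | g. rotation_matrix g}"
  by (simp add: orbit_def conj_action_eq)

lemma isotropy_eq: "A \<in> unit_bivectors \<Longrightarrow> isotropy A = {g. rotation_matrix g \<and> cj g A = A}"
  by (simp add: stabilizer_def conj_action_eq)

lemma orbit_subset: "A \<in> unit_bivectors \<Longrightarrow> orbit SO5 conj_action A \<subseteq> unit_bivectors"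
  by (auto simp: orbit_eq cj_unit_bivectors)

lemma orbit_cj:
  assumes "A \<in> unit_bivectors" "rotation_matrix g"
  shows "orbit SO5 conj_action (cj g A) = orbit SO5 conj_action A"
proof -
  have "\<exists>k. cj h A = cj k (cj g A) \<and> rotation_matrix k" if "rotation_matrix h" for h
    using that assms
    by (intro exI[of _ "h ** transpose g"])
      (simp add: rotation_matrix_mult rotation_matrix_transpose cj_cj matrix_mul_assoc[symmetric] SO5_D)
  moreover have "\<exists>k. cj h (cj g A) = cj k A \<and> rotation_matrix k" if "rotation_matrix h" for h
    using that assms by (intro exI[of _ "h ** g"]) (simp add: rotation_matrix_mult cj_cj)
  ultimately show ?thesis
    using assms by (auto simp: orbit_eq cj_unit_bivectors)
qed


section \<open>Bivectors in coordinates\<close>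

text \<open>The ten entries above the diagonal are the coordinates with respect to \<open>e\<^sub>i \<and> e\<^sub>j\<close>, \<open>i < j\<close>, in
  lexicographic order.\<close>

definition biv :: "real \<Rightarrow> real \<Rightarrow> real \<Rightarrow> real \<Rightarrow> real \<Rightarrow> real \<Rightarrow> real \<Rightarrow> real \<Rightarrow> real \<Rightarrow> real \<Rightarrow> real^5^5" where
  "biv a12 a13 a14 a15 a23 a24 a25 a34 a35 a45 = vector
     [vector [0, a12, a13, a14, a15],
      vector [- a12, 0, a23, a24, a25],
      vector [- a13, - a23, 0, a34, a35],
      vector [- a14, - a24, - a34, 0, a45],
      vector [- a15, - a25, - a35, - a45, 0]]"

lemma bivectors_iff:
  "A \<in> bivectors \<longleftrightarrow>
     A = biv (A$1$2) (A$1$3) (A$1$4) (A$1$5) (A$2$3) (A$2$4) (A$2$5) (A$3$4) (A$3$5) (A$4$5)"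
  by (auto simp: bivectors_def biv_def matrix_eq_iff_5 transpose_nth)

lemma biv_in_bivectors [simp]: "biv a b c d e f g h i j \<in> bivectors"
  by (simp add: bivectors_iff) (simp add: biv_def)

lemma bivectors_cases:
  assumes "A \<in> bivectors"
  obtains a b c d e f g h i j where "A = biv a b c d e f g h i j"
  using assms bivectors_iff by blast

lemma biv_inner_biv: "biv_inner (biv a b c d e f g h i j) (biv a' b' c' d' e' f' g' h' i' j') =
   a * a' + b * b' + c * c' + d * d' + e * e' + f * f' + g * g' + h * h' + i * i' + j * j'"
  by (simp add: biv_inner_def inner_matrix_5 biv_def)

lemma biv_add: "biv a b c d e f g h i j + biv a' b' c' d' e' f' g' h' i' j' =
   biv (a + a') (b + b') (c + c') (d + d') (e + e') (f + f') (g + g') (h + h') (i + i') (j + j')"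
  by (simp add: biv_def matrix_eq_iff_5)

lemma biv_scaleR: "r *\<^sub>R biv a b c d e f g h i j =
   biv (r * a) (r * b) (r * c) (r * d) (r * e) (r * f) (r * g) (r * h) (r * i) (r * j)"
  by (simp add: biv_def matrix_eq_iff_5)

lemma biv_eq_iff: "biv a b c d e f g h i j = biv a' b' c' d' e' f' g' h' i' j' \<longleftrightarrow>
   a = a' \<and> b = b' \<and> c = c' \<and> d = d' \<and> e = e' \<and> f = f' \<and> g = g' \<and> h = h' \<and> i = i' \<and> j = j'"
  by (auto simp: biv_def matrix_eq_iff_5)

lemma b_vec_biv: "b_vec \<theta> = biv (cos \<theta>) 0 0 0 0 0 0 (sin \<theta>) 0 0"
  by (simp add: b_vec_def biv_def matrix_eq_iff_5 wedge_def e_vec_def axis_def)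

lemma b_vec_in_orbit: "b_vec \<theta> \<in> orbit SO5 conj_action (b_vec \<theta>)"
  using rotation_matrix_1 b_vec_in_unit_bivectors by (auto simp: orbit_eq intro!: exI[of _ "mat 1"])


section \<open>The isotropy groups\<close>

lemma rotation_matrix_iff: "rotation_matrix (g :: real^'n^'n) \<longleftrightarrow> g ** transpose g = mat 1 \<and> det g = 1"
  by (metis SO5_D(2) matrix_left_right_inverse orthogonal_matrix rotation_matrix_def)

lemma torus_rotation_rotation: "rotation_matrix (torus_rotation s t)"
proof -
  have [simp]: "sin s * sin s = 1 - cos s * cos s" "sin t * sin t = 1 - cos t * cos t"
    using sin_cos_squared_add[of s] sin_cos_squared_add[of t] by (simp_all add: power2_eq_square)
  show ?thesis
    by (simp add: rotation_matrix_iff torus_rotation_def matrix_eq_iff_5 matrix_mult_nth_5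
        transpose_nth mat_1_nth det_5 algebra_simps)
qed

lemma block_rotation_mult: "block_rotation A B ** block_rotation C D = block_rotation (A ** C) (B ** D)"
  by (simp add: block_rotation_def matrix_eq_iff_5 matrix_mult_nth_5)
    (simp add: matrix_matrix_mult_def sum_2 sum_3)

lemma block_rotation_transpose: "transpose (block_rotation A B) = block_rotation (transpose A) (transpose B)"
  by (simp add: block_rotation_def matrix_eq_iff_5 transpose_nth)

lemma block_rotation_eq_1_iff: "block_rotation A B = mat 1 \<longleftrightarrow> A = mat 1 \<and> B = mat 1"
  by (auto simp: block_rotation_def matrix_eq_iff_5 mat_1_nth vec_eq_iff forall_2 forall_3)

lemma det_block_rotation: "det (block_rotation A B) = det A * det B"
  by (simp add: block_rotation_def det_5 det_2 det_3) algebra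

lemma block_rotation_rotation:
  assumes "rotation_matrix A" "rotation_matrix B"
  shows "rotation_matrix (block_rotation A B)"
  using assms
  by (simp add: rotation_matrix_iff block_rotation_transpose block_rotation_mult
      block_rotation_eq_1_iff det_block_rotation)

text \<open>Real form of a complex \<open>2 \<times> 2\<close> matrix acting on \<open>\<complex>\<^sup>2 = \<real>\<^sup>4\<close>, with a scalar \<open>e\<close> on the fifth axis.
  Both the torus and \<open>U(2)\<close> consist of such matrices.\<close>

definition complex_form :: "real \<Rightarrow> real \<Rightarrow> real \<Rightarrow> real \<Rightarrow> real \<Rightarrow> real \<Rightarrow> real \<Rightarrow> real \<Rightarrow> real \<Rightarrow> real^5^5" where
  "complex_form a a' b b' c c' d d' e = vector
     [vector [a, - a', b, - b', 0],
      vector [a', a, b', b, 0],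
      vector [c, - c', d, - d', 0],
      vector [c', c, d', d, 0],
      vector [0, 0, 0, 0, e]]"

lemma det_complex_form: "det (complex_form a a' b b' c c' d d' e) =
   ((a\<^sup>2 + a'\<^sup>2 + b\<^sup>2 + b'\<^sup>2) * (c\<^sup>2 + c'\<^sup>2 + d\<^sup>2 + d'\<^sup>2)
     - (a * c + a' * c' + b * d + b' * d')\<^sup>2 - (a' * c - a * c' + b' * d - b * d')\<^sup>2) * e"
  by (simp add: complex_form_def det_5) algebra

lemma complex_form_gram:
  "complex_form a a' b b' c c' d d' e ** transpose (complex_form a a' b b' c c' d d' e) =
   complex_form (a\<^sup>2 + a'\<^sup>2 + b\<^sup>2 + b'\<^sup>2) 0
     (a * c + a' * c' + b * d + b' * d') (a' * c - a * c' + b' * d - b * d')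
     (a * c + a' * c' + b * d + b' * d') (- (a' * c - a * c' + b' * d - b * d'))
     (c\<^sup>2 + c'\<^sup>2 + d\<^sup>2 + d'\<^sup>2) 0 (e\<^sup>2)"
  by (simp add: complex_form_def matrix_eq_iff_5 matrix_mult_nth_5 transpose_nth
        power2_eq_square algebra_simps)

lemma complex_form_eq_1_iff: "complex_form a a' b b' c c' d d' e = mat 1 \<longleftrightarrow>
   a = 1 \<and> a' = 0 \<and> b = 0 \<and> b' = 0 \<and> c = 0 \<and> c' = 0 \<and> d = 1 \<and> d' = 0 \<and> e = 1"
  by (auto simp: complex_form_def matrix_eq_iff_5 mat_1_nth)

text \<open>The determinant of the real form of a complex matrix is \<open>|det|\<^sup>2 \<ge> 0\<close>, so orientation forces \<open>e = 1\<close>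
  and not only \<open>e = \<plusminus>1\<close>.\<close>

lemma complex_form_rotation_iff: "rotation_matrix (complex_form a a' b b' c c' d d' e) \<longleftrightarrow>
   a\<^sup>2 + a'\<^sup>2 + b\<^sup>2 + b'\<^sup>2 = 1 \<and> c\<^sup>2 + c'\<^sup>2 + d\<^sup>2 + d'\<^sup>2 = 1 \<and> a * c + a' * c' + b * d + b' * d' = 0 \<and>
   a' * c - a * c' + b' * d - b * d' = 0 \<and> e = 1"
  unfolding rotation_matrix_iff complex_form_gram complex_form_eq_1_iff det_complex_form
  by auto

lemma realify_complex_form: "realify A = complex_form (Re (A$1$1)) (Im (A$1$1)) (Re (A$1$2)) (Im (A$1$2))
   (Re (A$2$1)) (Im (A$2$1)) (Re (A$2$2)) (Im (A$2$2)) 1"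
  by (simp add: realify_def complex_form_def)

lemma unitary_iff_rotation: "unitary_matrix A \<longleftrightarrow> rotation_matrix (realify A)"
  unfolding realify_complex_form complex_form_rotation_iff unitary_matrix_def
  by (auto simp: vec_eq_iff forall_2 matrix_matrix_mult_def sum_2 map_matrix_def transpose_def mat_def
      complex_eq_iff power2_eq_square algebra_simps)

lemma K_side_subset: "K_side s \<subseteq> carrier SO5"
  by (cases s) (auto simp: block_rotation_rotation unitary_iff_rotation)

lemma homogeneous_2x2:
  fixes c s x y :: real
  assumes "c * x = s * y" "s * x = c * y" "c\<^sup>2 \<noteq> s\<^sup>2"
  shows "x = 0" "y = 0"
proof -
  have "(c\<^sup>2 - s\<^sup>2) * x = 0" "(c\<^sup>2 - s\<^sup>2) * y = 0"
    using assms(1,2) by algebra+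
  then show "x = 0" "y = 0" using assms(3) by auto
qed

text \<open>The centraliser of \<open>b\<^sub>\<theta>\<close> in \<open>SO(5)\<close> is computed entry by entry: the \<open>2 \<times> 2\<close> blocks of a matrix
  commuting with \<open>cos \<theta> J \<oplus> sin \<theta> J \<oplus> 0\<close> intertwine multiples of \<open>J\<close>.\<close>

lemma commutes_b_vec:
  fixes g :: "real^5^5"
  assumes "g ** b_vec \<theta> = b_vec \<theta> ** g"
  shows "cos \<theta> * g$1$2 = - (cos \<theta> * g$2$1)" "cos \<theta> * g$1$1 = cos \<theta> * g$2$2"
    "sin \<theta> * g$3$4 = - (sin \<theta> * g$4$3)" "sin \<theta> * g$3$3 = sin \<theta> * g$4$4"
    "sin \<theta> * g$1$4 = - (cos \<theta> * g$2$3)" "sin \<theta> * g$1$3 = cos \<theta> * g$2$4"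
    "sin \<theta> * g$2$4 = cos \<theta> * g$1$3" "sin \<theta> * g$2$3 = - (cos \<theta> * g$1$4)"
    "cos \<theta> * g$3$2 = - (sin \<theta> * g$4$1)" "cos \<theta> * g$3$1 = sin \<theta> * g$4$2"
    "cos \<theta> * g$4$2 = sin \<theta> * g$3$1" "cos \<theta> * g$4$1 = - (sin \<theta> * g$3$2)"
    "cos \<theta> * g$1$5 = 0" "cos \<theta> * g$2$5 = 0" "cos \<theta> * g$5$1 = 0" "cos \<theta> * g$5$2 = 0"
    "sin \<theta> * g$3$5 = 0" "sin \<theta> * g$4$5 = 0" "sin \<theta> * g$5$3 = 0" "sin \<theta> * g$5$4 = 0"
proof -
  have e: "(g ** b_vec \<theta>) $ i $ j = (b_vec \<theta> ** g) $ i $ j" for i j using assms by simp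
  note e = e[unfolded matrix_mult_nth_5 b_vec_biv biv_def]
  show "cos \<theta> * g$1$2 = - (cos \<theta> * g$2$1)"
    using e[of 1 1] by (simp add: mult.commute)
  show "cos \<theta> * g$1$1 = cos \<theta> * g$2$2"
    using e[of 1 2] by (simp add: mult.commute)
  show "sin \<theta> * g$3$4 = - (sin \<theta> * g$4$3)"
    using e[of 3 3] by (simp add: mult.commute)
  show "sin \<theta> * g$3$3 = sin \<theta> * g$4$4"
    using e[of 3 4] by (simp add: mult.commute)
  show "sin \<theta> * g$1$4 = - (cos \<theta> * g$2$3)"
    using e[of 1 3] by (simp add: mult.commute)
  show "sin \<theta> * g$1$3 = cos \<theta> * g$2$4"
    using e[of 1 4] by (simp add: mult.commute)
  show "sin \<theta> * g$2$4 = cos \<theta> * g$1$3"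
    using e[of 2 3] by (simp add: mult.commute)
  show "sin \<theta> * g$2$3 = - (cos \<theta> * g$1$4)"
    using e[of 2 4] by (simp add: mult.commute)
  show "cos \<theta> * g$3$2 = - (sin \<theta> * g$4$1)"
    using e[of 3 1] by (simp add: mult.commute)
  show "cos \<theta> * g$3$1 = sin \<theta> * g$4$2"
    using e[of 3 2] by (simp add: mult.commute)
  show "cos \<theta> * g$4$2 = sin \<theta> * g$3$1"
    using e[of 4 1] by (simp add: mult.commute)
  show "cos \<theta> * g$4$1 = - (sin \<theta> * g$3$2)"
    using e[of 4 2] by (simp add: mult.commute)
  show "cos \<theta> * g$1$5 = 0"
    using e[of 2 5] by (simp add: mult.commute)
  show "cos \<theta> * g$2$5 = 0"
    using e[of 1 5] by (simp add: mult.commute)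
  show "cos \<theta> * g$5$1 = 0"
    using e[of 5 2] by (simp add: mult.commute)
  show "cos \<theta> * g$5$2 = 0"
    using e[of 5 1] by (simp add: mult.commute)
  show "sin \<theta> * g$3$5 = 0"
    using e[of 4 5] by (simp add: mult.commute)
  show "sin \<theta> * g$4$5 = 0"
    using e[of 3 5] by (simp add: mult.commute)
  show "sin \<theta> * g$5$3 = 0"
    using e[of 5 4] by (simp add: mult.commute)
  show "sin \<theta> * g$5$4 = 0"
    using e[of 5 3] by (simp add: mult.commute)
qed

lemma mult_eq_minus_mult_iff: "c \<noteq> 0 \<Longrightarrow> c * x = - (c * y) \<longleftrightarrow> x = - y" for c :: real
  by (metis mult_left_cancel mult_minus_right)

lemma T2_subset_isotropy: "g \<in> T2 \<Longrightarrow> rotation_matrix g \<and> cj g (b_vec \<theta>) = b_vec \<theta>"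
  by (auto simp: T2_def torus_rotation_rotation cj_fixes_iff_commutes)
    (simp add: torus_rotation_def b_vec_biv biv_def matrix_eq_iff_5 matrix_mult_nth_5)

lemma interior_angle:
  assumes "\<theta> \<in> {0<..<pi/4}"
  shows "0 < sin \<theta>" "sin \<theta> < cos \<theta>" "0 < cos \<theta>" "(sin \<theta>)\<^sup>2 < (cos \<theta>)\<^sup>2"
proof -
  show s: "0 < sin \<theta>" using assms by (intro sin_gt_zero) auto
  have "cos (pi/4) < cos \<theta>" using assms by (intro cos_monotone_0_pi) auto
  moreover have "sin \<theta> < sin (pi/4)" using assms by (intro sin_monotone_2pi) auto
  ultimately show c: "sin \<theta> < cos \<theta>" by (simp add: cos_45 sin_45)
  then show "0 < cos \<theta>" using s by simp
  show "(sin \<theta>)\<^sup>2 < (cos \<theta>)\<^sup>2" using s c by (intro power_strict_mono) auto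
qed

text \<open>For an interior angle the \<open>2 \<times> 2\<close> systems for the entries off the diagonal blocks have determinant
  \<open>cos\<^sup>2 \<theta> - sin\<^sup>2 \<theta> \<noteq> 0\<close>, so that only rotations in the two planes remain.\<close>

lemma isotropy_generic:
  assumes \<theta>: "\<theta> \<in> {0<..<pi/4}"
  shows "isotropy (b_vec \<theta>) = T2"
proof
  show "T2 \<subseteq> isotropy (b_vec \<theta>)"
    using T2_subset_isotropy by (auto simp: isotropy_eq b_vec_in_unit_bivectors)
next
  have s: "0 < sin \<theta>" and c: "sin \<theta> < cos \<theta>" and cs: "(cos \<theta>)\<^sup>2 \<noteq> (sin \<theta>)\<^sup>2"
    and cs': "(sin \<theta>)\<^sup>2 \<noteq> (cos \<theta>)\<^sup>2"
    using interior_angle[OF \<theta>] by auto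
  show "isotropy (b_vec \<theta>) \<subseteq> T2"
  proof
    fix g assume "g \<in> isotropy (b_vec \<theta>)"
    then have g: "rotation_matrix g" and "g ** b_vec \<theta> = b_vec \<theta> ** g"
      by (auto simp: isotropy_eq b_vec_in_unit_bivectors cj_fixes_iff_commutes)
    note e = commutes_b_vec[OF this(2)]
    have z: "g$1$4 = 0" "g$2$3 = 0" "g$1$3 = 0" "g$2$4 = 0" "g$3$2 = 0" "g$4$1 = 0" "g$3$1 = 0" "g$4$2 = 0"
      using homogeneous_2x2[of "sin \<theta>" "g$1$4" "cos \<theta>" "- g$2$3"] e(5,8)
        homogeneous_2x2[of "sin \<theta>" "g$1$3" "cos \<theta>" "g$2$4"] e(6,7)
        homogeneous_2x2[of "cos \<theta>" "g$3$2" "sin \<theta>" "- g$4$1"] e(9,12)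
        homogeneous_2x2[of "cos \<theta>" "g$3$1" "sin \<theta>" "g$4$2"] e(10,11) cs cs' by simp_all
    have "g = complex_form (g$1$1) (g$2$1) 0 0 0 0 (g$3$3) (g$4$3) (g$5$5)"
      using e z s c by (simp add: matrix_eq_iff_5 complex_form_def mult_eq_minus_mult_iff)
    then have f: "(g$1$1)\<^sup>2 + (g$2$1)\<^sup>2 = 1" "(g$3$3)\<^sup>2 + (g$4$3)\<^sup>2 = 1" "g$5$5 = 1"
      and g_eq: "g = complex_form (g$1$1) (g$2$1) 0 0 0 0 (g$3$3) (g$4$3) 1"
      using g complex_form_rotation_iff[of "g$1$1" "g$2$1" 0 0 0 0 "g$3$3" "g$4$3" "g$5$5"] by auto
    obtain x where "g$1$1 = cos x" "g$2$1 = sin x" using sincos_total_2pi[OF f(1)] by metis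
    moreover obtain y where "g$3$3 = cos y" "g$4$3 = sin y" using sincos_total_2pi[OF f(2)] by metis
    ultimately have "g = torus_rotation x y"
      using g_eq by (simp add: complex_form_def torus_rotation_def)
    then show "g \<in> T2" by (auto simp: T2_def)
  qed
qed

text \<open>At \<open>\<theta> = 0\<close> the equations for the last three coordinates disappear; the first block commutes with the
  right-angle rotation \<open>J\<close>, so its determinant is a sum of squares and cannot be \<open>-1\<close>.  At \<open>\<theta> = \<pi>/4\<close> the
  equations say that the first four coordinates are transformed by a complex linear map.\<close>

lemma isotropy_singular: "isotropy (b_vec (singular_angle s)) = K_side s"
proof (cases s)
  case Minus
  show ?thesis
  proof
    show "K_side s \<subseteq> isotropy (b_vec (singular_angle s))"
    proof
      fix k assume "k \<in> K_side s"
      then obtain A B where k: "k = block_rotation A B" and A: "rotation_matrix A" "rotation_matrix B"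
        using Minus by auto
      define J :: "real^2^2" where "J = vector [vector [0, 1], vector [- 1, 0]]"
      have "cj A J = det A *\<^sub>R J"
        by (simp add: cj_def J_def vec_eq_iff forall_2 matrix_matrix_mult_def sum_2 transpose_def det_2 algebra_simps)
      then have "A ** J = J ** A" using A cj_fixes_iff_commutes SO5_D(3)[OF A(1)]
        by (metis cj_def rotation_cancel(4) scaleR_one)
      moreover have "b_vec 0 = block_rotation J 0"
        by (simp add: J_def block_rotation_def b_vec_biv biv_def matrix_eq_iff_5)
      ultimately have "k ** b_vec 0 = b_vec 0 ** k"
        by (simp add: k block_rotation_mult)
      then show "k \<in> isotropy (b_vec (singular_angle s))"
        using k A Minus block_rotation_rotation
        by (simp add: isotropy_eq b_vec_in_unit_bivectors cj_fixes_iff_commutes)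
    qed
  next
    show "isotropy (b_vec (singular_angle s)) \<subseteq> K_side s"
    proof
      fix g assume "g \<in> isotropy (b_vec (singular_angle s))"
      then have g: "rotation_matrix g" and "g ** b_vec 0 = b_vec 0 ** g"
        using Minus by (auto simp: isotropy_eq b_vec_in_unit_bivectors cj_fixes_iff_commutes)
      note e = commutes_b_vec[OF this(2)]
      define A :: "real^2^2" where "A = vector [vector [g$1$1, g$1$2], vector [g$2$1, g$2$2]]"
      define B :: "real^3^3" where "B = vector [vector [g$3$3, g$3$4, g$3$5],
        vector [g$4$3, g$4$4, g$4$5], vector [g$5$3, g$5$4, g$5$5]]"
      have gb: "g = block_rotation A B"
        using e by (simp add: matrix_eq_iff_5 block_rotation_def A_def B_def)
      have o: "A ** transpose A = mat 1" "B ** transpose B = mat 1" and d: "det A * det B = 1"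
        using g unfolding gb rotation_matrix_iff block_rotation_transpose block_rotation_mult
          block_rotation_eq_1_iff det_block_rotation by auto
      have "det A = (A ** transpose A) $ 1 $ 1"
        using e(1,2) by (simp add: A_def det_2 matrix_matrix_mult_def sum_2 transpose_def)
      then have dA: "det A = 1" using o by (simp add: mat_def)
      with d have "det B = 1" by simp
      with dA have "rotation_matrix A" "rotation_matrix B" using o by (simp_all add: rotation_matrix_iff)
      then show "g \<in> K_side s" using gb Minus by auto
    qed
  qed
next
  case Plus
  have cs: "cos (pi/4) = sin (pi/4)" "cos (pi/4) \<noteq> 0" "sin (pi/4) \<noteq> 0" by (simp_all add: cos_45 sin_45)
  show ?thesis
  proof
    show "K_side s \<subseteq> isotropy (b_vec (singular_angle s))"
    proof
      fix k assume "k \<in> K_side s"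
      then obtain A where k: "k = realify A" and A: "unitary_matrix A"
        using Plus by auto
      have "k ** b_vec (pi/4) = b_vec (pi/4) ** k"
        by (simp add: k realify_def b_vec_biv biv_def matrix_eq_iff_5 matrix_mult_nth_5 cs)
      then show "k \<in> isotropy (b_vec (singular_angle s))"
        using k A Plus by (simp add: isotropy_eq b_vec_in_unit_bivectors cj_fixes_iff_commutes unitary_iff_rotation)
    qed
  next
    show "isotropy (b_vec (singular_angle s)) \<subseteq> K_side s"
    proof
      fix g assume "g \<in> isotropy (b_vec (singular_angle s))"
      then have g: "rotation_matrix g" and "g ** b_vec (pi/4) = b_vec (pi/4) ** g"
        using Plus by (auto simp: isotropy_eq b_vec_in_unit_bivectors cj_fixes_iff_commutes)
      note e = commutes_b_vec[OF this(2), unfolded cs(1)]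
      define A :: "complex^2^2" where "A = vector [vector [Complex (g$1$1) (g$2$1), Complex (g$1$3) (g$2$3)],
        vector [Complex (g$3$1) (g$4$1), Complex (g$3$3) (g$4$3)]]"
      have "g = complex_form (g$1$1) (g$2$1) (g$1$3) (g$2$3) (g$3$1) (g$4$1) (g$3$3) (g$4$3) (g$5$5)"
        using e cs by (simp add: matrix_eq_iff_5 complex_form_def mult_eq_minus_mult_iff)
      moreover from this have "g$5$5 = 1" using g complex_form_rotation_iff by metis
      ultimately have "g = realify A"
        by (simp add: realify_def complex_form_def A_def)
      then show "g \<in> K_side s" using g Plus unitary_iff_rotation by auto
    qed
  qed
qed


section \<open>The normal form of a bivector\<close>

text \<open>The rotations of coordinate planes, along which the derivative of the height is tested.\<close>

definition givens :: "5 \<Rightarrow> 5 \<Rightarrow> real \<Rightarrow> real^5^5" where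
  "givens i j t = (\<chi> a b. if a = b then (if a = i \<or> a = j then cos t else 1)
     else if a = i \<and> b = j then - sin t else if a = j \<and> b = i then sin t else 0)"

lemma givens_rotation:
  "rotation_matrix (givens 1 3 t)"
  "rotation_matrix (givens 2 4 t)"
  "rotation_matrix (givens 1 4 t)"
  "rotation_matrix (givens 2 3 t)"
  "rotation_matrix (givens 1 5 t)"
  "rotation_matrix (givens 2 5 t)"
  "rotation_matrix (givens 3 5 t)"
  "rotation_matrix (givens 4 5 t)"
proof -
  have [simp]: "sin t * sin t = 1 - cos t * cos t"
    using sin_cos_squared_add[of t] by (simp add: power2_eq_square)
  note simps = rotation_matrix_iff givens_def matrix_eq_iff_5 matrix_mult_nth_5 transpose_nth mat_1_nth det_5
  show "rotation_matrix (givens 1 3 t)" by (simp add: simps)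
  show "rotation_matrix (givens 2 4 t)" by (simp add: simps)
  show "rotation_matrix (givens 1 4 t)" by (simp add: simps)
  show "rotation_matrix (givens 2 3 t)" by (simp add: simps)
  show "rotation_matrix (givens 1 5 t)" by (simp add: simps)
  show "rotation_matrix (givens 2 5 t)" by (simp add: simps)
  show "rotation_matrix (givens 3 5 t)" by (simp add: simps)
  show "rotation_matrix (givens 4 5 t)" by (simp add: simps)
qed

text \<open>\<open>swap_planes\<close> and \<open>flip_plane\<close> represent generators of the Weyl group.  A reflection in the fifth axis
  restores the orientation that the reflection in the fourth axis reverses.\<close>

definition swap_planes :: "real^5^5" where
  "swap_planes = vector
     [vector [0, 0, 1, 0, 0],
      vector [0, 0, 0, 1, 0],
      vector [1, 0, 0, 0, 0],
      vector [0, 1, 0, 0, 0],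
      vector [0, 0, 0, 0, 1]]"

definition flip_plane :: "real^5^5" where
  "flip_plane = vector
     [vector [1, 0, 0, 0, 0],
      vector [0, 1, 0, 0, 0],
      vector [0, 0, 1, 0, 0],
      vector [0, 0, 0, - 1, 0],
      vector [0, 0, 0, 0, - 1]]"

lemma swap_planes_rotation: "rotation_matrix swap_planes"
  by (simp add: rotation_matrix_iff swap_planes_def matrix_eq_iff_5 matrix_mult_nth_5
        transpose_nth mat_1_nth det_5)

lemma flip_plane_rotation: "rotation_matrix flip_plane"
  by (simp add: rotation_matrix_iff flip_plane_def matrix_eq_iff_5 matrix_mult_nth_5
        transpose_nth mat_1_nth det_5)

lemma compact_SO5: "compact {g. rotation_matrix (g :: real^'n^'n)}"
proof -
  have "{g. rotation_matrix (g :: real^'n^'n)} = {g. g ** transpose g = mat 1} \<inter> {g. det g = 1}"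
    by (auto simp: rotation_matrix_iff)
  moreover have "closed {g :: real^'n^'n. g ** transpose g = mat 1}"
    by (intro closed_Collect_eq continuous_intros smooth_on_imp_continuous_on)
      (auto simp: smooth_on_iff_smooth_at intro!: smooth_intros)
  moreover have "closed {g :: real^'n^'n. det g = 1}"
    unfolding det_def by (intro closed_Collect_eq continuous_intros)
  moreover have "bounded {g. rotation_matrix (g :: real^'n^'n)}"
  proof -
    have "norm g = sqrt ((mat 1 :: real^'n^'n) \<bullet> mat 1)" if "rotation_matrix g" for g :: "real^'n^'n"
      using inner_matrix_mult_left[of g "mat 1" g] SO5_D[OF that] by (simp add: norm_eq_sqrt_inner)
    then show ?thesis unfolding bounded_iff by (metis (mono_tags, lifting) mem_Collect_eq order_refl)
  qed
  ultimately show ?thesis by (simp add: compact_eq_bounded_closed closed_Int)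
qed

text \<open>The first-order condition for a maximum at \<open>t = 0\<close>.\<close>

lemma sin_coefficient_zero:
  fixes a b :: real
  assumes "\<And>t. a * cos t + b * sin t \<le> a"
  shows "b = 0"
proof (rule ccontr)
  assume b: "b \<noteq> 0"
  let ?r = "sqrt (a\<^sup>2 + b\<^sup>2)"
  have r: "0 < ?r" using b by (simp add: sum_power2_gt_zero_iff)
  have "(a / ?r)\<^sup>2 + (b / ?r)\<^sup>2 = 1"
    using r b by (simp add: power_divide add_divide_distrib[symmetric])
  then obtain t where "a / ?r = cos t" "b / ?r = sin t" by (metis sincos_total_2pi)
  then have "a * (a / ?r) + b * (b / ?r) \<le> a" using assms[of t] by simp
  moreover have "a * (a / ?r) + b * (b / ?r) = ?r"
    using r by (simp add: add_divide_distrib[symmetric] power2_eq_square[symmetric] real_div_sqrt)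
  moreover have "\<bar>a\<bar> < ?r" using b by (simp add: real_less_rsqrt)
  ultimately show False by linarith
qed

text \<open>The normal form maximises the height \<open>\<langle>M, b\<^sub>\<alpha>\<rangle>\<close>, with \<open>0 < \<alpha> < \<pi>/4\<close>, over the conjugacy class.
  At a maximum \<open>M\<close> the derivative of the height along every rotation in a coordinate plane
  vanishes, which says that \<open>M\<close> commutes with the regular element \<open>b\<^sub>\<alpha>\<close> and so lies in the span of
  \<open>e\<^sub>1\<^sub>2\<close> and \<open>e\<^sub>3\<^sub>4\<close>; comparison with the conjugates of \<open>M\<close> under the Weyl group orders the two
  coefficients.\<close>

lemma bivector_normal_form_aux:
  assumes A: "A \<in> bivectors"
  obtains g x y where "rotation_matrix g" "cj g A = biv x 0 0 0 0 0 0 y 0 0" "0 \<le> y" "y \<le> x"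
proof -
  \<comment> \<open>Any coefficients \<open>c\<^sub>1 > c\<^sub>2 > 0\<close> define a regular element in the interior of the chamber.\<close>
  define h where "h M = 2 * M$1$2 + M$3$4" for M :: "real^5^5"
  have "continuous_on {g. rotation_matrix g} (\<lambda>g. h (cj g A))"
    unfolding h_def cj_def
    by (intro smooth_on_imp_continuous_on)
      (auto simp: smooth_on_iff_smooth_at intro!: smooth_intros)
  moreover have "{g :: real^5^5. rotation_matrix g} \<noteq> {}" using rotation_matrix_1 by auto
  ultimately obtain g where g: "rotation_matrix g" and max: "\<And>k. rotation_matrix k \<Longrightarrow> h (cj k A) \<le> h (cj g A)"
    using continuous_attains_sup[OF compact_SO5, of "\<lambda>g. h (cj g A)"] by auto
  have "cj g A \<in> bivectors" using A by (rule cj_bivectors)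
  then obtain m12 m13 m14 m15 m23 m24 m25 m34 m35 m45 where M: "cj g A = biv m12 m13 m14 m15 m23 m24 m25 m34 m35 m45"
    by (rule bivectors_cases)
  have max': "h (cj k (biv m12 m13 m14 m15 m23 m24 m25 m34 m35 m45)) \<le> 2 * m12 + m34" if "rotation_matrix k" for k
    using max[OF rotation_matrix_mult[OF that g]] by (simp add: cj_cj[symmetric] M) (simp add: h_def biv_def)
  note h = h_def cj_def matrix_mult_nth_5 transpose_nth givens_def biv_def algebra_simps
  have "m23 * 2 + m14 = 0"
    by (rule sin_coefficient_zero[of "2 * m12 + m34"]) (use max'[OF givens_rotation(1)] in \<open>simp add: h\<close>)
  moreover have "- (m14 * 2 + m23) = 0"
    by (rule sin_coefficient_zero[of "2 * m12 + m34"]) (use max'[OF givens_rotation(2)] in \<open>simp add: h\<close>)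
  moreover have "m24 * 2 - m13 = 0"
    by (rule sin_coefficient_zero[of "2 * m12 + m34"]) (use max'[OF givens_rotation(3)] in \<open>simp add: h\<close>)
  moreover have "m24 - m13 * 2 = 0"
    by (rule sin_coefficient_zero[of "2 * m12 + m34"]) (use max'[OF givens_rotation(4)] in \<open>simp add: h\<close>)
  moreover have "2 * m25 = 0"
    by (rule sin_coefficient_zero[of "2 * m12"]) (use max'[OF givens_rotation(5)] in \<open>simp add: h\<close>)
  moreover have "- (2 * m15) = 0"
    by (rule sin_coefficient_zero[of "2 * m12"]) (use max'[OF givens_rotation(6)] in \<open>simp add: h\<close>)
  moreover have "m45 = 0"
    by (rule sin_coefficient_zero[of "m34"]) (use max'[OF givens_rotation(7)] in \<open>simp add: h\<close>)
  moreover have "- m35 = 0"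
    by (rule sin_coefficient_zero[of "m34"]) (use max'[OF givens_rotation(8)] in \<open>simp add: h\<close>)
  ultimately have M': "cj g A = biv m12 0 0 0 0 0 0 m34 0 0"
    by (simp add: M biv_eq_iff)
  have "m34 \<le> m12"
    using max'[OF swap_planes_rotation] by (simp add: h swap_planes_def)
  moreover have "0 \<le> m34"
    using max'[OF flip_plane_rotation] by (simp add: h flip_plane_def)
  ultimately show thesis using that g M' by blast
qed

lemma bivector_normal_form:
  assumes "A \<in> unit_bivectors"
  obtains \<theta> g where "\<theta> \<in> {0..pi/4}" "rotation_matrix g" "A = cj g (b_vec \<theta>)"
proof -
  obtain g x y where g: "rotation_matrix g" "cj g A = biv x 0 0 0 0 0 0 y 0 0" "0 \<le> y" "y \<le> x"
    using bivector_normal_form_aux[of A] assms by (auto simp: unit_bivectors_def)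
  have "biv_inner (cj g A) (cj g A) = 1"
    using assms cj_biv_inner[OF g(1), of A A] by (simp add: unit_bivectors_def)
  then have 1: "x\<^sup>2 + y\<^sup>2 = 1" by (simp add: g biv_inner_biv power2_eq_square)
  obtain \<theta> where \<theta>: "0 \<le> \<theta>" "\<theta> \<le> pi/2" "x = cos \<theta>" "y = sin \<theta>"
    using sincos_total_pi_half[of x y] 1 g by auto
  have "\<theta> \<le> pi/4"
  proof (rule ccontr)
    assume "\<not> ?thesis"
    then have "cos \<theta> < cos (pi/4)" "sin (pi/4) < sin \<theta>"
      using \<theta> by (auto intro!: cos_monotone_0_pi sin_monotone_2pi)
    then show False using g \<theta> by (simp add: cos_45 sin_45)
  qed
  moreover have "A = cj (transpose g) (b_vec \<theta>)"
    using g \<theta> by (metis b_vec_biv cj_inverse(1))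
  ultimately show thesis using that[of \<theta> "transpose g"] \<theta> g rotation_matrix_transpose by auto
qed


section \<open>The orbit space\<close>

text \<open>The squared norm of \<open>A\<^sup>2\<close>: the first invariant polynomial beyond the norm, and the
  sum of the fourth powers of the eigenvalues of a skew-symmetric matrix.\<close>

definition quartic :: "real^'n^'n \<Rightarrow> real" where
  "quartic A = (A ** A) \<bullet> (A ** A)"

lemma quartic_cj: "rotation_matrix g \<Longrightarrow> quartic (cj g A) = quartic A"
  by (simp add: quartic_def cj_mult[symmetric] cj_inner)

lemma quartic_b_vec: "quartic (b_vec \<theta>) = 2 - (sin (2 * \<theta>))\<^sup>2"
proof -
  have "quartic (b_vec \<theta>) = 2 * cos \<theta> ^ 4 + 2 * sin \<theta> ^ 4"
    by (simp add: quartic_def inner_matrix_5 matrix_mult_nth_5 b_vec_biv biv_def power4_eq_xxxx)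
  also have "\<dots> = 2 - 4 * (cos \<theta> * sin \<theta>)\<^sup>2"
    using sin_cos_squared_add[of \<theta>] by algebra
  finally have "quartic (b_vec \<theta>) = 2 - 4 * (cos \<theta> * sin \<theta>)\<^sup>2" .
  moreover have "sin (2 * \<theta>) = 2 * (cos \<theta> * sin \<theta>)" by (simp add: sin_double)
  ultimately show ?thesis by (simp add: power_mult_distrib)
qed

text \<open>The formula for \<open>quartic (b_vec \<theta>)\<close> solved for \<open>\<theta>\<close>.\<close>

definition orbit_angle :: "real^5^5 \<Rightarrow> real" where
  "orbit_angle A = arcsin (sqrt (2 - quartic A)) / 2"

lemma orbit_angle_cj: "rotation_matrix g \<Longrightarrow> orbit_angle (cj g A) = orbit_angle A"
  by (simp add: orbit_angle_def quartic_cj)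

lemma orbit_angle_b_vec:
  assumes "\<theta> \<in> {0..pi/4}"
  shows "orbit_angle (b_vec \<theta>) = \<theta>"
proof -
  have "0 \<le> sin (2 * \<theta>)" using assms by (intro sin_ge_zero) auto
  then show ?thesis using assms by (simp add: orbit_angle_def quartic_b_vec arcsin_sin)
qed

lemma quartic_smooth [intro]: "smooth_at S x quartic"
  unfolding quartic_def[abs_def] by (intro smooth_intros)

text \<open>On the sphere the invariant determines the angle of the normal form, and hence the orbit.\<close>

lemma in_orbit_b_vec_iff:
  assumes "\<theta> \<in> {0..pi/4}"
  shows "A \<in> orbit SO5 conj_action (b_vec \<theta>) \<longleftrightarrow> A \<in> unit_bivectors \<and> quartic A = quartic (b_vec \<theta>)"
proof
  assume "A \<in> orbit SO5 conj_action (b_vec \<theta>)"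
  then show "A \<in> unit_bivectors \<and> quartic A = quartic (b_vec \<theta>)"
    using b_vec_in_unit_bivectors by (auto simp: orbit_eq cj_unit_bivectors quartic_cj)
next
  assume A: "A \<in> unit_bivectors \<and> quartic A = quartic (b_vec \<theta>)"
  then obtain \<phi> g where \<phi>: "\<phi> \<in> {0..pi/4}" "rotation_matrix g" "A = cj g (b_vec \<phi>)"
    using bivector_normal_form by blast
  have "orbit_angle (b_vec \<phi>) = orbit_angle (b_vec \<theta>)"
    using A \<phi> by (simp add: orbit_angle_def quartic_cj)
  then have "\<phi> = \<theta>" using \<phi> assms orbit_angle_b_vec by simp
  then show "A \<in> orbit SO5 conj_action (b_vec \<theta>)"
    using \<phi> b_vec_in_unit_bivectors by (auto simp: orbit_eq)
qed

lemma quotient_map_quotient_topology: "quotient_map X (quotient_topology X p) p"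
  by (auto simp: quotient_map_def openin_quotient_topology)

lemma orbit_angle_range:
  assumes "A \<in> unit_bivectors"
  shows "orbit_angle A \<in> {0..pi/4}" "orbit SO5 conj_action (b_vec (orbit_angle A)) = orbit SO5 conj_action A"
proof -
  obtain \<phi> g where \<phi>: "\<phi> \<in> {0..pi/4}" "rotation_matrix g" "A = cj g (b_vec \<phi>)"
    using bivector_normal_form[OF assms] by blast
  then have "orbit_angle A = \<phi>" using orbit_angle_b_vec by (simp add: orbit_angle_cj)
  then show "orbit_angle A \<in> {0..pi/4}" "orbit SO5 conj_action (b_vec (orbit_angle A)) = orbit SO5 conj_action A"
    using \<phi> orbit_cj[OF b_vec_in_unit_bivectors] by auto
qed

lemma quartic_unit_bivector:
  assumes "A \<in> unit_bivectors"
  shows "1 \<le> quartic A" "quartic A \<le> 2"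
proof -
  obtain \<phi> g where "\<phi> \<in> {0..pi/4}" "rotation_matrix g" "A = cj g (b_vec \<phi>)"
    using bivector_normal_form[OF assms] by blast
  then have "quartic A = 2 - (sin (2 * \<phi>))\<^sup>2" by (simp add: quartic_cj quartic_b_vec)
  moreover have "(sin (2 * \<phi>))\<^sup>2 \<le> 1" by (simp add: abs_square_le_1)
  ultimately show "1 \<le> quartic A" "quartic A \<le> 2" by auto
qed

lemma continuous_on_orbit_angle: "continuous_on unit_bivectors orbit_angle"
proof -
  have "continuous_on unit_bivectors quartic"
    by (intro smooth_on_imp_continuous_on) (auto simp: smooth_on_iff_smooth_at)
  moreover have "-1 \<le> sqrt (2 - quartic A)" "sqrt (2 - quartic A) \<le> 1" if "A \<in> unit_bivectors" for A
  proof -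
    have "0 \<le> sqrt (2 - quartic A)" using quartic_unit_bivector[OF that] by simp
    then show "-1 \<le> sqrt (2 - quartic A)" by linarith
    show "sqrt (2 - quartic A) \<le> 1" using quartic_unit_bivector[OF that] by simp
  qed
  ultimately show ?thesis
    unfolding orbit_angle_def by (intro continuous_intros) auto
qed

lemma biv_orbit_space_homeomorphic:
  "homeomorphic_map (top_of_set {0..pi/4}) biv_orbit_space (\<lambda>\<theta>. orbit SO5 conj_action (b_vec \<theta>))"
proof -
  let ?o = "orbit SO5 conj_action"
  have q: "quotient_map (top_of_set unit_bivectors) biv_orbit_space ?o"
    unfolding biv_orbit_space_def by (rule quotient_map_quotient_topology)
  have "orbit_angle A = orbit_angle B" if "A \<in> unit_bivectors" "B \<in> unit_bivectors" "?o A = ?o B" for A B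
  proof -
    have "A \<in> ?o A" using that(1) rotation_matrix_1 by (auto simp: orbit_eq intro!: exI[of _ "mat 1"])
    then have "A \<in> ?o B" using that(3) by simp
    then show ?thesis using that(2) by (auto simp: orbit_eq orbit_angle_cj)
  qed
  moreover have "continuous_map (top_of_set unit_bivectors) (top_of_set {0..pi/4}) orbit_angle"
    using continuous_on_orbit_angle orbit_angle_range(1) by auto
  ultimately obtain f where f: "continuous_map biv_orbit_space (top_of_set {0..pi/4}) f"
    "\<And>A. A \<in> unit_bivectors \<Longrightarrow> f (?o A) = orbit_angle A"
    using quotient_map_lift_exists[OF q, of _ orbit_angle] by (metis topspace_euclidean_subtopology)
  have "homeomorphic_maps (top_of_set {0..pi/4}) biv_orbit_space (\<lambda>\<theta>. ?o (b_vec \<theta>)) f"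
    unfolding homeomorphic_maps_def
  proof (intro conjI ballI)
    have "continuous_map (top_of_set {0..pi/4}) (top_of_set unit_bivectors) b_vec"
      unfolding b_vec_def using b_vec_in_unit_bivectors[unfolded b_vec_def]
      by (auto simp: image_subset_iff intro!: continuous_intros)
    from continuous_map_compose[OF this quotient_imp_continuous_map[OF q]]
    show "continuous_map (top_of_set {0..pi/4}) biv_orbit_space (\<lambda>\<theta>. ?o (b_vec \<theta>))"
      by (simp only: o_def)
    show "f (?o (b_vec \<theta>)) = \<theta>" if "\<theta> \<in> topspace (top_of_set {0..pi/4})" for \<theta>
      using that f(2)[OF b_vec_in_unit_bivectors] orbit_angle_b_vec by simp
    show "?o (b_vec (f y)) = y" if "y \<in> topspace biv_orbit_space" for y
      using that f(2) orbit_angle_range(2) by (auto simp: biv_orbit_space_def)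
  qed (use f in auto)
  then show ?thesis using homeomorphic_map_maps by blast
qed


section \<open>Local sections of the orbit maps\<close>

lemma eventually_near_compose:
  assumes "eventually P (near T (f x))" "smooth_at S x f" "x \<in> S" "eventually (\<lambda>y. f y \<in> T) (near S x)"
  shows "eventually (\<lambda>y. P (f y)) (near S x)"
proof -
  have "filterlim f (near T (f x)) (near S x)"
    using smooth_at_tendsto[OF assms(2,3)] assms(4)
    by (simp add: filterlim_inf filterlim_principal)
  then show ?thesis using assms(1) by (simp add: filterlim_iff)
qed

lemma near_everyI: "(\<And>y. y \<in> S \<Longrightarrow> P y) \<Longrightarrow> eventually P (near S x)"
  by (simp add: eventually_inf_principal)

lemma eventually_near_neq_0:
  "smooth_at S x f \<Longrightarrow> x \<in> S \<Longrightarrow> f x \<noteq> 0 \<Longrightarrow> eventually (\<lambda>y. f y \<noteq> 0) (near S x)"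
  using smooth_at_tendsto tendsto_imp_eventually_ne by blast

text \<open>Normalisation and \<open>residual\<close> are the two steps of the Gram-Schmidt process.  They are written by
  explicit formulas so that the rules for smoothness apply.\<close>

definition nz :: "'a::real_inner \<Rightarrow> 'a" where
  "nz v = inverse (sqrt (v \<bullet> v)) *\<^sub>R v"

lemma nz_unit: "v \<noteq> 0 \<Longrightarrow> nz v \<bullet> nz v = 1"
  by (simp add: nz_def field_simps)

lemma nz_pos_scaleR: "u \<bullet> u = 1 \<Longrightarrow> 0 < k \<Longrightarrow> nz (k *\<^sub>R u) = u"
  by (simp add: nz_def real_sqrt_mult)

lemma smooth_at_nz: "smooth_at S x f \<Longrightarrow> x \<in> S \<Longrightarrow> f x \<noteq> 0 \<Longrightarrow> smooth_at S x (\<lambda>y. nz (f y))"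
  unfolding nz_def by (intro smooth_intros) auto

definition orthonormal_list :: "'a::real_inner list \<Rightarrow> bool" where
  "orthonormal_list qs \<longleftrightarrow> sorted_wrt (\<lambda>u v. u \<bullet> v = 0) qs \<and> (\<forall>u\<in>set qs. u \<bullet> u = 1)"

definition residual :: "'a::real_inner list \<Rightarrow> 'a \<Rightarrow> 'a" where
  "residual qs w = w - (\<Sum>q\<leftarrow>qs. (w \<bullet> q) *\<^sub>R q)"

lemma residual_orthogonal:
  assumes "orthonormal_list qs" "u \<in> set qs"
  shows "residual qs w \<bullet> u = 0"
proof -
  have "(\<Sum>q\<leftarrow>qs. (w \<bullet> q) *\<^sub>R q) \<bullet> u = w \<bullet> u"
    using assms
  proof (induction qs)
    case (Cons a qs)
    have z: "(\<Sum>q\<leftarrow>rs. (w \<bullet> q) *\<^sub>R q) \<bullet> a = 0" if "\<forall>v\<in>set rs. a \<bullet> v = 0" for rs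
      using that by (induction rs) (simp_all add: inner_add_right inner_commute[of _ a])
    show ?case
    proof (cases "u = a")
      case True
      then show ?thesis using Cons.prems z[of qs] by (auto simp: orthonormal_list_def inner_add_left)
    next
      case False
      then show ?thesis using Cons by (auto simp: orthonormal_list_def inner_add_left)
    qed
  qed simp
  then show ?thesis by (simp add: residual_def inner_diff_left)
qed

lemma orthonormal_list_snoc:
  assumes "orthonormal_list qs" "residual qs w \<noteq> 0"
  shows "orthonormal_list (qs @ [nz (residual qs w)])"
  using assms residual_orthogonal[OF assms(1), of _ w] nz_unit[OF assms(2)]
  by (auto simp: orthonormal_list_def sorted_wrt_append nz_def inner_commute)

definition frame :: "real^5 \<Rightarrow> real^5 \<Rightarrow> real^5 \<Rightarrow> real^5 \<Rightarrow> real^5 \<Rightarrow> real^5^5" where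
  "frame a b c d e = transpose (vector [a, b, c, d, e])"

lemma frame_gram: "(transpose (frame a b c d e) ** frame a b c d e) $ i $ j =
   (vector [a, b, c, d, e] :: real^5^5) $ i \<bullet> (vector [a, b, c, d, e] :: real^5^5) $ j"
  by (simp add: frame_def matrix_matrix_mult_def transpose_def inner_vec_def)

lemma orthogonal_frame:
  "orthonormal_list [a, b, c, d, e] \<Longrightarrow> orthogonal_matrix (frame a b c d e)"
  unfolding orthogonal_matrix vec_eq_iff[where 'b=5] forall_5 frame_gram
  by (simp add: orthonormal_list_def mat_1_nth inner_commute)

lemma frame_conj: "cj (transpose (frame a b c d e)) y $ i $ j =
   (vector [a, b, c, d, e] :: real^5^5) $ i \<bullet> (y *v (vector [a, b, c, d, e] :: real^5^5) $ j)"
  by (simp add: cj_def frame_def matrix_matrix_mult_def matrix_vector_mult_def transpose_def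
      inner_vec_def sum_5 algebra_simps)

lemma frame_e_vec: "frame (e_vec 1) (e_vec 2) (e_vec 3) (e_vec 4) (e_vec 5) = mat 1"
  by (simp add: frame_def e_vec_def matrix_eq_iff_5 transpose_nth mat_1_nth axis_def)

lemma smooth_at_frame:
  assumes "smooth_at S x a" "smooth_at S x b" "smooth_at S x c" "smooth_at S x d" "smooth_at S x e"
  shows "smooth_at S x (\<lambda>y. frame (a y) (b y) (c y) (d y) (e y))"
proof -
  have "\<forall>i. smooth_at S x (\<lambda>y. (vector [a y, b y, c y, d y, e y] :: real^5^5) $ i)"
    using assms by (simp add: forall_5)
  then show ?thesis unfolding frame_def by - (rule smooth_at_transpose, rule smooth_at_vec, simp)
qed

text \<open>A unit bivector has total weight one, so it is determined by the two entries of its normal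
  form as soon as these have total weight one.\<close>

lemma eq_cj_b_vecI:
  assumes y: "y \<in> unit_bivectors" and g: "rotation_matrix g"
    and e: "cj (transpose g) y $ 1 $ 2 = cos \<theta>" "sin \<theta> \<noteq> 0 \<Longrightarrow> cj (transpose g) y $ 3 $ 4 = sin \<theta>"
  shows "cj g (b_vec \<theta>) = y"
proof -
  have "cj (transpose g) y \<in> bivectors" using y by (simp add: cj_bivectors unit_bivectors_def)
  then obtain a b c d e f h i j k where A: "cj (transpose g) y = biv a b c d e f h i j k"
    by (rule bivectors_cases)
  have a: "a = cos \<theta>" and i: "sin \<theta> \<noteq> 0 \<Longrightarrow> i = sin \<theta>" using assms(3,4) by (simp_all add: A biv_def)
  have "biv_inner (cj (transpose g) y) (cj (transpose g) y) = 1"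
    using y rotation_matrix_transpose[OF g] cj_biv_inner[of "transpose g" y y] by (simp add: unit_bivectors_def)
  then have *: "b\<^sup>2 + c\<^sup>2 + d\<^sup>2 + e\<^sup>2 + f\<^sup>2 + h\<^sup>2 + i\<^sup>2 + j\<^sup>2 + k\<^sup>2 = (sin \<theta>)\<^sup>2"
    using sin_cos_squared_add[of \<theta>] by (simp add: A biv_inner_biv a power2_eq_square)
  have 1: "a = cos \<theta>" "i = sin \<theta>"
  proof -
    have "i\<^sup>2 \<le> (sin \<theta>)\<^sup>2" unfolding *[symmetric] by simp
    then show "i = sin \<theta>" using i by (cases "sin \<theta> = 0") auto
  qed (rule a)
  from * have "b\<^sup>2 + c\<^sup>2 + d\<^sup>2 + e\<^sup>2 + f\<^sup>2 + h\<^sup>2 + j\<^sup>2 + k\<^sup>2 = 0" by (simp add: 1)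
  then have "b = 0 \<and> c = 0 \<and> d = 0 \<and> e = 0 \<and> f = 0 \<and> h = 0 \<and> j = 0 \<and> k = 0"
    by (simp add: add_nonneg_eq_0_iff)
  then have "cj (transpose g) y = b_vec \<theta>" by (simp add: A 1 b_vec_biv)
  then show ?thesis using g cj_inverse(2) by metis
qed

lemma matrix_vector_minus: "A *v (- v) = - (A *v v)" "(- A) *v v = - (A *v v)" for A :: "real^'n^'m"
  by (simp_all add: vec_eq_iff matrix_vector_mult_def sum_negf)

lemma bivectors_inner_mult: "y \<in> bivectors \<Longrightarrow> u \<bullet> (y *v v) = - ((y *v u) \<bullet> v)"
proof -
  assume y: "y \<in> bivectors"
  have "u \<bullet> (y *v v) = (transpose y *v u) \<bullet> v"
    by (simp add: dot_lmul_matrix)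
  then show ?thesis using y by (simp add: bivectors_def matrix_vector_minus del: transpose_matrix_vector)
qed

definition orbit_section :: "(real^5^5) set \<Rightarrow> real^5^5 \<Rightarrow> (real^5^5 \<Rightarrow> real^5^5) \<Rightarrow> bool" where
  "orbit_section D b \<sigma> \<longleftrightarrow> smooth_at D b \<sigma> \<and>
     eventually (\<lambda>y. rotation_matrix (\<sigma> y) \<and> cj (\<sigma> y) b = y) (near D b)"

text \<open>A section at the base point is carried to all points of the orbit by the group.\<close>

lemma has_local_sections_orbit:
  assumes D: "D = orbit SO5 conj_action b" "b \<in> unit_bivectors" and \<sigma>: "orbit_section D b \<sigma>"
  shows "has_local_sections (carrier SO5) D (\<lambda>g. cj g b)"
  unfolding has_local_sections_def
proof
  fix y assume y: "y \<in> D"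
  then obtain g where g: "rotation_matrix g" "y = cj g b" using D by (auto simp: orbit_eq)
  let ?h = "cj (transpose g)"
  have h: "smooth_at D y ?h" by (intro smooth_at_linear linear_cj)
  have hy: "?h y = b" using g by simp
  have hD: "eventually (\<lambda>z. ?h z \<in> D) (near D y)"
  proof -
    have "?h z \<in> D" if "z \<in> D" for z
    proof -
      obtain k where "rotation_matrix k" "z = cj k b" using \<open>z \<in> D\<close> D by (auto simp: orbit_eq)
      then have "rotation_matrix (transpose g ** k)" "?h z = cj (transpose g ** k) b"
        using g by (simp_all add: cj_cj rotation_matrix_mult rotation_matrix_transpose)
      then show ?thesis using D by (auto simp: orbit_eq)
    qed
    then show ?thesis by (auto simp: eventually_inf_principal)
  qed
  have "smooth_at D y (\<lambda>z. g ** \<sigma> (?h z))"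
    using \<sigma> hy by (intro smooth_intros smooth_at_compose[OF _ h y hD]) (simp add: orbit_section_def)
  moreover have "eventually (\<lambda>z. rotation_matrix (\<sigma> (?h z)) \<and> cj (\<sigma> (?h z)) b = ?h z) (near D y)"
    using \<sigma> hy by (intro eventually_near_compose[OF _ h y hD]) (simp add: orbit_section_def)
  then have "eventually (\<lambda>z. g ** \<sigma> (?h z) \<in> carrier SO5 \<and> cj (g ** \<sigma> (?h z)) b = z) (near D y)"
    by eventually_elim (use g in \<open>simp add: rotation_matrix_mult cj_cj[symmetric]\<close>)
  ultimately show "\<exists>\<sigma>. smooth_at D y \<sigma> \<and> eventually (\<lambda>z. \<sigma> z \<in> carrier SO5 \<and> cj (\<sigma> z) b = z) (near D y)"
    by blast
qed

text \<open>The determinant of an orthogonal matrix is \<open>\<plusminus>1\<close> and depends continuously on the matrix, so an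
  orthonormal frame that is positively oriented at the base point remains so nearby.\<close>

lemma eventually_rotation_near:
  assumes "smooth_at D b \<sigma>" "b \<in> D" "\<sigma> b = mat 1" "eventually (\<lambda>y. orthogonal_matrix (\<sigma> y)) (near D b)"
  shows "eventually (\<lambda>y. rotation_matrix (\<sigma> y :: real^'n^'n)) (near D b)"
proof -
  have "continuous_on UNIV (det :: real^'n^'n \<Rightarrow> real)"
    unfolding det_def by (intro continuous_intros)
  then have "isCont (det :: real^'n^'n \<Rightarrow> real) (\<sigma> b)" by (simp add: continuous_on_eq_continuous_at)
  then have "((\<lambda>y. det (\<sigma> y)) \<longlongrightarrow> det (\<sigma> b)) (near D b)"
    using smooth_at_tendsto[OF assms(1,2)] by (rule isCont_tendsto_compose)
  then have "eventually (\<lambda>y. 0 < det (\<sigma> y)) (near D b)"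
    by (rule order_tendstoD) (simp add: assms(3))
  with assms(4) show ?thesis
  proof eventually_elim
    case (elim y)
    then show ?case using det_orthogonal_matrix[of "\<sigma> y"] by (auto simp: rotation_matrix_def)
  qed
qed

text \<open>If \<open>q\<close> is a unit vector with \<open>y\<^sup>2 q = - c\<^sup>2 q\<close>, then \<open>q\<close> and \<open>- y q / c\<close> form an
  orthonormal basis of a plane on which \<open>y\<close> acts as \<open>c\<close> times a rotation by a right angle.\<close>

lemma invariant_plane:
  assumes y: "y \<in> bivectors" and q: "q \<bullet> q = 1" "y *v (y *v q) = - (c\<^sup>2) *\<^sub>R q" and c: "c \<noteq> 0"
  defines "p \<equiv> - (1 / c) *\<^sub>R (y *v q)"
  shows "p \<bullet> p = 1" "q \<bullet> p = 0" "y *v p = c *\<^sub>R q" "y *v q = - c *\<^sub>R p" "q \<bullet> (y *v p) = c"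
proof -
  have "(y *v q) \<bullet> (y *v q) = c\<^sup>2"
    using bivectors_inner_mult[OF y, of q "y *v q"] q by simp
  then show "p \<bullet> p = 1" using c by (simp add: p_def power2_eq_square)
  have "q \<bullet> (y *v q) = 0" using bivectors_inner_mult[OF y, of q q] by (simp add: inner_commute)
  then show "q \<bullet> p = 0" by (simp add: p_def)
  show *: "y *v p = c *\<^sub>R q" using c q by (simp add: p_def matrix_vector_minus matrix_vector_mult_scaleR power2_eq_square)
  show "y *v q = - c *\<^sub>R p" using c by (simp add: p_def)
  show "q \<bullet> (y *v p) = c" using q by (simp add: *)
qed

text \<open>If the columns of \<open>Q y\<close> lie in an eigenspace of \<open>y\<^sup>2\<close>, a normalised column is a unit eigenvector that
  varies smoothly with \<open>y\<close>; the factor \<open>k\<close> at the base point has to be positive for the section to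
  start at \<open>e\<close> itself.\<close>

lemma eigen_column:
  fixes D :: "(real^5^5) set"
  assumes b: "b \<in> D" and Q: "smooth_at D b Q" "Q b *v e = k *\<^sub>R e" "e \<bullet> e = 1" "0 < k"
    and ev: "eventually (\<lambda>y. y ** y ** Q y = - (c\<^sup>2) *\<^sub>R Q y) (near D b)"
  shows "smooth_at D b (\<lambda>y. nz (Q y *v e))" "nz (Q b *v e) = e"
    "eventually (\<lambda>y. nz (Q y *v e) \<bullet> nz (Q y *v e) = 1 \<and>
       y *v (y *v nz (Q y *v e)) = - (c\<^sup>2) *\<^sub>R nz (Q y *v e)) (near D b)"
proof -
  have s: "smooth_at D b (\<lambda>y. Q y *v e)" by (intro smooth_intros Q)
  have e: "e \<noteq> 0" using Q by auto
  have n: "Q b *v e \<noteq> 0" using Q e by simp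
  show "smooth_at D b (\<lambda>y. nz (Q y *v e))" using s b n by (rule smooth_at_nz)
  show "nz (Q b *v e) = e" using Q nz_pos_scaleR by simp
  show "eventually (\<lambda>y. nz (Q y *v e) \<bullet> nz (Q y *v e) = 1 \<and>
       y *v (y *v nz (Q y *v e)) = - (c\<^sup>2) *\<^sub>R nz (Q y *v e)) (near D b)"
    using eventually_near_neq_0[OF s b n] ev
  proof eventually_elim
    case (elim y)
    have "y *v (y *v (Q y *v e)) = - (c\<^sup>2) *\<^sub>R (Q y *v e)"
      using arg_cong[OF elim(2), of "\<lambda>M. M *v e"]
      by (simp add: matrix_vector_mul_assoc[symmetric] scaleR_matrix_vector_assoc matrix_vector_minus)
    then show ?case using nz_unit[OF elim(1)]
      by (simp add: nz_def matrix_vector_mult_scaleR)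
  qed
qed

text \<open>One step of the Gram-Schmidt process, applied to the constant vector \<open>w\<close> that completes the frame at
  the base point.\<close>

lemma frame_completion:
  fixes D :: "(real^5^5) set"
  assumes b: "b \<in> D" and s: "\<And>q. q \<in> set fs \<Longrightarrow> smooth_at D b q"
    and ev: "eventually (\<lambda>y. orthonormal_list (map (\<lambda>q. q y) fs)) (near D b)"
    and w: "residual (map (\<lambda>q. q b) fs) w = w" "w \<bullet> w = 1"
  defines "r \<equiv> \<lambda>y. nz (residual (map (\<lambda>q. q y) fs) w)"
  shows "smooth_at D b r" "r b = w"
    "eventually (\<lambda>y. orthonormal_list (map (\<lambda>q. q y) fs @ [r y])) (near D b)"
proof -
  have "smooth_at D b (\<lambda>y. \<Sum>q\<leftarrow>gs. (w \<bullet> q y) *\<^sub>R q y)" if "set gs \<subseteq> set fs" for gs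
    using that by (induction gs)
    (auto intro!: smooth_at_add smooth_at_scaleR smooth_at_inner smooth_at_const simp: s)
  from this[of fs] have s': "smooth_at D b (\<lambda>y. residual (map (\<lambda>q. q y) fs) w)"
    unfolding residual_def by (intro smooth_intros) (simp add: comp_def)
  have n: "residual (map (\<lambda>q. q b) fs) w \<noteq> 0" using w by auto
  show "smooth_at D b r" unfolding r_def using s' b n by (rule smooth_at_nz)
  show "r b = w" using w nz_pos_scaleR[of w 1] by (simp add: r_def)
  show "eventually (\<lambda>y. orthonormal_list (map (\<lambda>q. q y) fs @ [r y])) (near D b)"
    using eventually_near_neq_0[OF s' b n] ev
    by eventually_elim (simp add: r_def orthonormal_list_snoc)
qed

lemma e_vec_inner: "e_vec i \<bullet> e_vec j = (if i = j then 1 else 0)"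
  by (simp add: e_vec_def inner_axis_axis)

lemma orbit_section_from_frame:
  assumes D: "D = orbit SO5 conj_action (b_vec \<theta>)"
    and s: "smooth_at D (b_vec \<theta>) q1" "smooth_at D (b_vec \<theta>) q2" "smooth_at D (b_vec \<theta>) q3"
      "smooth_at D (b_vec \<theta>) q4" "smooth_at D (b_vec \<theta>) q5"
    and b: "q1 (b_vec \<theta>) = e_vec 1" "q2 (b_vec \<theta>) = e_vec 2" "q3 (b_vec \<theta>) = e_vec 3"
      "q4 (b_vec \<theta>) = e_vec 4" "q5 (b_vec \<theta>) = e_vec 5"
    and on: "eventually (\<lambda>y. orthonormal_list [q1 y, q2 y, q3 y, q4 y, q5 y]) (near D (b_vec \<theta>))"
    and e: "eventually (\<lambda>y. q1 y \<bullet> (y *v q2 y) = cos \<theta> \<and> (sin \<theta> \<noteq> 0 \<longrightarrow> q3 y \<bullet> (y *v q4 y) = sin \<theta>)) (near D (b_vec \<theta>))"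
  shows "\<exists>\<sigma>. orbit_section D (b_vec \<theta>) \<sigma>"
proof -
  let ?s = "\<lambda>y. frame (q1 y) (q2 y) (q3 y) (q4 y) (q5 y)"
  have bD: "b_vec \<theta> \<in> D"
    using D b_vec_in_orbit by simp
  have sm: "smooth_at D (b_vec \<theta>) ?s" using s by (rule smooth_at_frame)
  have "eventually (\<lambda>y. orthogonal_matrix (?s y)) (near D (b_vec \<theta>))"
    using on by eventually_elim (rule orthogonal_frame)
  then have "eventually (\<lambda>y. rotation_matrix (?s y)) (near D (b_vec \<theta>))"
    by (intro eventually_rotation_near[OF sm bD]) (simp_all add: b frame_e_vec)
  moreover have "eventually (\<lambda>y. y \<in> unit_bivectors) (near D (b_vec \<theta>))"
    using D orbit_subset[OF b_vec_in_unit_bivectors, of \<theta>] by (intro near_everyI) auto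
  ultimately have "eventually (\<lambda>y. rotation_matrix (?s y) \<and> cj (?s y) (b_vec \<theta>) = y) (near D (b_vec \<theta>))"
    using e by eventually_elim (auto intro!: eq_cj_b_vecI simp: frame_conj)
  with sm show ?thesis unfolding orbit_section_def by blast
qed

lemma b_vec_mult_e_vec:
  "b_vec \<theta> *v e_vec 1 = - cos \<theta> *\<^sub>R e_vec 2" "b_vec \<theta> *v e_vec 2 = cos \<theta> *\<^sub>R e_vec 1"
  "b_vec \<theta> *v e_vec 3 = - sin \<theta> *\<^sub>R e_vec 4" "b_vec \<theta> *v e_vec 4 = sin \<theta> *\<^sub>R e_vec 3"
  "b_vec \<theta> *v e_vec 5 = 0"
  by (simp_all add: vec_eq_iff forall_5 b_vec_biv biv_def e_vec_def matrix_vector_mult_def sum_5 axis_def)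

text \<open>Unit vectors in two orthogonal invariant planes determine the frame: \<open>y\<close> rotates each of them by a
  right angle, and the fifth vector is the remaining normal.\<close>

lemma orbit_section_two_planes:
  assumes D: "D = orbit SO5 conj_action (b_vec \<theta>)"
    and cs: "cos \<theta> \<noteq> 0" "sin \<theta> \<noteq> 0"
    and s: "smooth_at D (b_vec \<theta>) q1" "smooth_at D (b_vec \<theta>) q3"
    and b: "q1 (b_vec \<theta>) = e_vec 1" "q3 (b_vec \<theta>) = e_vec 3"
    and e1: "eventually (\<lambda>y. q1 y \<bullet> q1 y = 1 \<and> y *v (y *v q1 y) = - ((cos \<theta>)\<^sup>2) *\<^sub>R q1 y) (near D (b_vec \<theta>))"
    and e3: "eventually (\<lambda>y. q3 y \<bullet> q3 y = 1 \<and> y *v (y *v q3 y) = - ((sin \<theta>)\<^sup>2) *\<^sub>R q3 y) (near D (b_vec \<theta>))"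
    and o: "eventually (\<lambda>y. q1 y \<bullet> q3 y = 0 \<and> (y *v q1 y) \<bullet> q3 y = 0) (near D (b_vec \<theta>))"
  shows "\<exists>\<sigma>. orbit_section D (b_vec \<theta>) \<sigma>"
proof -
  let ?b = "b_vec \<theta>"
  have bD: "?b \<in> D"
    using D b_vec_in_orbit by simp
  define q2 where "q2 y = - (1 / cos \<theta>) *\<^sub>R (y *v q1 y)" for y
  define q4 where "q4 y = - (1 / sin \<theta>) *\<^sub>R (y *v q3 y)" for y
  have s2: "smooth_at D ?b q2" "smooth_at D ?b q4"
    unfolding q2_def q4_def by (intro smooth_intros s)+
  have b2: "q2 ?b = e_vec 2" "q4 ?b = e_vec 4"
    using cs by (simp_all add: q2_def q4_def b b_vec_mult_e_vec matrix_vector_minus)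
  have biv: "eventually (\<lambda>y. y \<in> bivectors) (near D ?b)"
    using D orbit_subset[OF b_vec_in_unit_bivectors, of \<theta>] by (intro near_everyI) (auto simp: unit_bivectors_def)
  have on: "eventually (\<lambda>y. orthonormal_list [q1 y, q2 y, q3 y, q4 y] \<and>
      q1 y \<bullet> (y *v q2 y) = cos \<theta> \<and> q3 y \<bullet> (y *v q4 y) = sin \<theta>) (near D ?b)"
    using biv e1 e3 o
  proof eventually_elim
    case (elim y)
    note p = invariant_plane[OF elim(1) conjunct1[OF elim(2)] conjunct2[OF elim(2)] cs(1), folded q2_def]
    note r = invariant_plane[OF elim(1) conjunct1[OF elim(3)] conjunct2[OF elim(3)] cs(2), folded q4_def]
    have 23: "q2 y \<bullet> q3 y = 0" using elim(4) by (simp add: q2_def)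
    have "q1 y \<bullet> q4 y = (1 / sin \<theta>) * ((y *v q1 y) \<bullet> q3 y)"
      using bivectors_inner_mult[OF elim(1), of "q1 y" "q3 y"] by (simp add: q4_def)
    moreover have "q2 y \<bullet> q4 y = (1 / sin \<theta>) * ((y *v q2 y) \<bullet> q3 y)"
      using bivectors_inner_mult[OF elim(1), of "q2 y" "q3 y"] by (simp add: q4_def)
    ultimately have "q1 y \<bullet> q4 y = 0" "q2 y \<bullet> q4 y = 0"
      using elim(4) 23 p(3) by simp_all
    then show ?case using p r elim 23 by (simp add: orthonormal_list_def)
  qed
  define q5 where "q5 y = nz (residual (map (\<lambda>q. q y) [q1, q2, q3, q4]) (e_vec 5))" for y
  have ev: "eventually (\<lambda>y. orthonormal_list (map (\<lambda>q. q y) [q1, q2, q3, q4])) (near D ?b)"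
    using on by eventually_elim simp
  have "smooth_at D ?b q5" "q5 ?b = e_vec 5"
    "eventually (\<lambda>y. orthonormal_list (map (\<lambda>q. q y) [q1, q2, q3, q4] @ [q5 y])) (near D ?b)"
    unfolding q5_def
    by (rule frame_completion[OF bD _ ev]; use s s2 in \<open>auto simp: residual_def b b2 e_vec_inner\<close>)+
  then show ?thesis
    using s s2 b b2 on
    by (intro orbit_section_from_frame[OF D, of q1 q2 q3 q4 q5]) (auto elim: eventually_mono)
qed

lemma cj_mat_1: "rotation_matrix g \<Longrightarrow> cj g (mat 1) = mat 1"
  by (simp add: cj_def SO5_D)

text \<open>At an interior angle the two planes of the normal form are eigenspaces of \<open>y\<^sup>2\<close> for different
  eigenvalues, and a polynomial in \<open>y\<close> projects to each of them.\<close>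

lemma orbit_section_generic:
  assumes \<theta>: "\<theta> \<in> {0<..<pi/4}" and D: "D = orbit SO5 conj_action (b_vec \<theta>)"
  shows "\<exists>\<sigma>. orbit_section D (b_vec \<theta>) \<sigma>"
proof -
  let ?b = "b_vec \<theta>"
  note ia = interior_angle[OF \<theta>]
  have bD: "?b \<in> D" using D b_vec_in_orbit by simp
  define P where "P c y = y ** y ** (y ** y + c\<^sup>2 *\<^sub>R mat 1)" for c and y :: "real^5^5"
  have P: "y ** y ** P (sin \<theta>) y = - ((cos \<theta>)\<^sup>2) *\<^sub>R P (sin \<theta>) y \<and>
      y ** y ** P (cos \<theta>) y = - ((sin \<theta>)\<^sup>2) *\<^sub>R P (cos \<theta>) y" if y: "y \<in> D" for y
  proof -
    obtain g where g: "rotation_matrix g" "y = cj g ?b" using y D b_vec_in_unit_bivectors by (auto simp: orbit_eq)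
    have 1: "?b ** ?b ** P (sin \<theta>) ?b = - ((cos \<theta>)\<^sup>2) *\<^sub>R P (sin \<theta>) ?b"
      "?b ** ?b ** P (cos \<theta>) ?b = - ((sin \<theta>)\<^sup>2) *\<^sub>R P (cos \<theta>) ?b"
      by (simp_all add: P_def b_vec_biv biv_def matrix_eq_iff_5 matrix_mult_nth_5 mat_1_nth power2_eq_square)
    have 2: "P c y = cj g (P c ?b)" for c
      using g by (simp add: P_def cj_mult cj_add cj_scaleR cj_mat_1)
    have "y ** y ** P c y = cj g (?b ** ?b ** P c ?b)" for c
      unfolding 2 using g by (simp add: cj_mult)
    then show ?thesis unfolding 2 by (simp add: 1 cj_scaleR cj_uminus)
  qed
  have e: "P (sin \<theta>) ?b *v e_vec 1 = ((cos \<theta>)\<^sup>2 * ((cos \<theta>)\<^sup>2 - (sin \<theta>)\<^sup>2)) *\<^sub>R e_vec 1"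
    "(- P (cos \<theta>) ?b) *v e_vec 3 = ((sin \<theta>)\<^sup>2 * ((cos \<theta>)\<^sup>2 - (sin \<theta>)\<^sup>2)) *\<^sub>R e_vec 3"
    by (simp_all add: P_def vec_eq_iff forall_5 b_vec_biv biv_def e_vec_def matrix_vector_mult_def sum_5 axis_def
        matrix_mult_nth_5 mat_1_nth power2_eq_square algebra_simps)
  have sP: "smooth_at D ?b (P c)" for c unfolding P_def by (intro smooth_intros)
  have "eventually (\<lambda>y. y ** y ** P (sin \<theta>) y = - ((cos \<theta>)\<^sup>2) *\<^sub>R P (sin \<theta>) y) (near D ?b)"
    using P by (intro near_everyI) simp
  note q1 = eigen_column[OF bD sP e(1) _ _ this]
  have "eventually (\<lambda>y. y ** y ** (- P (cos \<theta>) y) = - ((sin \<theta>)\<^sup>2) *\<^sub>R (- P (cos \<theta>) y)) (near D ?b)"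
    using P by (intro near_everyI) (simp add: matrix_neg_right)
  note q3 = eigen_column[OF bD smooth_at_minus[OF sP] e(2) _ _ this]
  define q1 where "q1 y = nz (P (sin \<theta>) y *v e_vec 1)" for y
  define q3 where "q3 y = nz ((- P (cos \<theta>) y) *v e_vec 3)" for y
  have k: "e_vec i \<bullet> e_vec i = 1" "0 < (cos \<theta>)\<^sup>2 * ((cos \<theta>)\<^sup>2 - (sin \<theta>)\<^sup>2)" "0 < (sin \<theta>)\<^sup>2 * ((cos \<theta>)\<^sup>2 - (sin \<theta>)\<^sup>2)" for i
    using ia by (simp_all add: e_vec_inner)
  note q1 = q1[OF k(1,2), folded q1_def] and q3 = q3[OF k(1,3), folded q3_def]
  have biv: "eventually (\<lambda>y. y \<in> bivectors) (near D ?b)"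
    using D orbit_subset[OF b_vec_in_unit_bivectors, of \<theta>] by (intro near_everyI) (auto simp: unit_bivectors_def)
  have "eventually (\<lambda>y. q1 y \<bullet> q3 y = 0 \<and> (y *v q1 y) \<bullet> q3 y = 0) (near D ?b)"
    using biv q1(3) q3(3)
  proof eventually_elim
    case (elim y)
    note sym = bivectors_inner_mult[OF elim(1)]
    have "u \<bullet> q3 y = 0" if "y *v (y *v u) = - ((cos \<theta>)\<^sup>2) *\<^sub>R u" for u
    proof -
      have "(y *v (y *v u)) \<bullet> q3 y = u \<bullet> (y *v (y *v q3 y))" using sym[of u "y *v q3 y"] sym[of "y *v u" "q3 y"] by simp
      then have "((cos \<theta>)\<^sup>2 - (sin \<theta>)\<^sup>2) * (u \<bullet> q3 y) = 0"
        using that elim(3) by (simp add: algebra_simps)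
      then show ?thesis using ia(4) by simp
    qed
    moreover have "y *v (y *v (y *v q1 y)) = - ((cos \<theta>)\<^sup>2) *\<^sub>R (y *v q1 y)"
      using elim(2) by (simp add: matrix_vector_mult_scaleR matrix_vector_minus)
    ultimately show ?case using elim(2) by blast
  qed
  then show ?thesis
    using q1 q3 ia by (intro orbit_section_two_planes[OF D]) auto
qed

text \<open>At \<open>\<theta> = \<pi>/4\<close> the two planes belong to the same eigenvalue of \<open>y\<^sup>2\<close>, and only their sum is
  determined by \<open>y\<close>.  The first plane is spanned by a vector \<open>q\<^sub>1\<close> of this sum and its image; the second
  one starts with a vector of the sum that is made orthogonal to the first plane.\<close>

lemma orbit_section_plus:
  assumes D: "D = orbit SO5 conj_action (b_vec (pi/4))"
  shows "\<exists>\<sigma>. orbit_section D (b_vec (pi/4)) \<sigma>"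
proof -
  let ?b = "b_vec (pi/4)"
  have cs [simp]: "cos (pi/4) = sqrt 2 / 2" "sin (pi/4) = sqrt 2 / 2" by (simp_all add: cos_45 sin_45)
  have half: "(sqrt 2 / 2)\<^sup>2 = (1/2 :: real)" "sqrt 2 / 2 * (sqrt 2 / 2) = (1/2 :: real)" by (simp_all add: power_divide)
  have bD: "?b \<in> D" using D b_vec_in_orbit by simp
  define P where "P y = - (y ** y)" for y :: "real^5^5"
  have P: "y ** y ** P y = - ((sqrt 2 / 2)\<^sup>2) *\<^sub>R P y" if y: "y \<in> D" for y
  proof -
    obtain g where g: "rotation_matrix g" "y = cj g ?b" using y D b_vec_in_unit_bivectors by (auto simp: orbit_eq)
    have 1: "?b ** ?b ** P ?b = - ((sqrt 2 / 2)\<^sup>2) *\<^sub>R P ?b"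
      by (simp add: P_def b_vec_biv biv_def matrix_eq_iff_5 matrix_mult_nth_5 power2_eq_square)
    have "P y = cj g (P ?b)" using g by (simp add: P_def cj_uminus cj_mult)
    then show ?thesis using g 1 by (simp add: cj_mult[symmetric] cj_scaleR cj_uminus)
  qed
  have e: "P ?b *v e_vec 1 = (1/2) *\<^sub>R e_vec 1" "P ?b *v e_vec 3 = (1/2) *\<^sub>R e_vec 3"
    by (simp_all add: P_def vec_eq_iff forall_5 b_vec_biv biv_def e_vec_def matrix_vector_mult_def sum_5 axis_def
        matrix_mult_nth_5)
  have sP: "smooth_at D ?b P" unfolding P_def by (intro smooth_intros)
  have evP: "eventually (\<lambda>y. y ** y ** P y = - ((sqrt 2 / 2)\<^sup>2) *\<^sub>R P y) (near D ?b)"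
    using P by (intro near_everyI) simp
  define q1 where "q1 y = nz (P y *v e_vec 1)" for y
  have k: "e_vec i \<bullet> e_vec i = 1" for i by (simp add: e_vec_inner)
  note q1 = eigen_column[OF bD sP e(1) k _ evP, folded q1_def]
  define q2 where "q2 y = - (1 / (sqrt 2 / 2)) *\<^sub>R (y *v q1 y)" for y
  have s2: "smooth_at D ?b q2" unfolding q2_def by (intro smooth_intros q1) simp
  have b2: "q2 ?b = e_vec 2" using q1(2) by (simp add: q2_def b_vec_mult_e_vec matrix_vector_minus)
  define r where "r y = residual [q1 y, q2 y] (P y *v e_vec 3)" for y
  have sr: "smooth_at D ?b r"
    unfolding r_def residual_def using q1(1) s2 sP by (auto intro!: smooth_intros)
  have rb: "r ?b = (1/2) *\<^sub>R e_vec 3" using q1(2) b2 e by (simp add: r_def residual_def e_vec_inner)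
  then have rn: "r ?b \<noteq> 0" using k[of 3] by auto
  define q3 where "q3 y = nz (r y)" for y
  have s3: "smooth_at D ?b q3" unfolding q3_def using sr bD rn by (rule smooth_at_nz)
  have b3: "q3 ?b = e_vec 3" by (simp add: q3_def rb nz_pos_scaleR[OF k])
  have biv: "eventually (\<lambda>y. y \<in> bivectors) (near D ?b)"
    using D orbit_subset[OF b_vec_in_unit_bivectors, of "pi/4"] by (intro near_everyI) (auto simp: unit_bivectors_def)
  have *: "eventually (\<lambda>y. (q3 y \<bullet> q3 y = 1 \<and> y *v (y *v q3 y) = - ((sqrt 2 / 2)\<^sup>2) *\<^sub>R q3 y) \<and>
     (q1 y \<bullet> q3 y = 0 \<and> (y *v q1 y) \<bullet> q3 y = 0)) (near D ?b)"
    using biv q1(3)[simplified] evP eventually_near_neq_0[OF sr bD rn]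
  proof eventually_elim
    case (elim y)
    have q1': "q1 y \<bullet> q1 y = 1" "y *v (y *v q1 y) = - ((sqrt 2 / 2)\<^sup>2) *\<^sub>R q1 y" using elim(2) by auto
    note p = invariant_plane[OF elim(1) q1', folded q2_def, simplified]
    have "orthonormal_list [q1 y, q2 y]" using p q1' by (simp add: orthonormal_list_def)
    note o = residual_orthogonal[OF this, of _ "P y *v e_vec 3", folded r_def]
    have "y *v (y *v (P y *v e_vec 3)) = - ((sqrt 2 / 2)\<^sup>2) *\<^sub>R (P y *v e_vec 3)"
      using arg_cong[OF elim(3), of "\<lambda>M. M *v e_vec 3"]
      by (simp add: matrix_vector_mul_assoc[symmetric] scaleR_matrix_vector_assoc matrix_vector_minus)
    moreover have "y *v (y *v q2 y) = - ((sqrt 2 / 2)\<^sup>2) *\<^sub>R q2 y"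
      using q1' by (simp add: q2_def matrix_vector_mult_scaleR matrix_vector_minus)
    ultimately have "y *v (y *v r y) = - ((sqrt 2 / 2)\<^sup>2) *\<^sub>R r y"
      using q1'(2) unfolding r_def residual_def
      by (simp add: matrix_vector_mult_scaleR matrix_vector_minus matrix_vector_right_distrib
          matrix_vector_mult_diff_distrib algebra_simps)
    then have "y *v (y *v q3 y) = - ((sqrt 2 / 2)\<^sup>2) *\<^sub>R q3 y"
      by (simp add: q3_def nz_def matrix_vector_mult_scaleR)
    moreover have "q3 y \<bullet> q3 y = 1" unfolding q3_def using elim(4) by (rule nz_unit)
    moreover have "q1 y \<bullet> q3 y = 0" "q2 y \<bullet> q3 y = 0"
      using o[of "q1 y"] o[of "q2 y"] by (simp_all add: q3_def nz_def inner_commute)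
    moreover from this have "(y *v q1 y) \<bullet> q3 y = 0" using p(4) by simp
    ultimately show ?case by simp
  qed
  show ?thesis
    by (rule orbit_section_two_planes[OF D, of q1 q3])
      (use q1 s3 b3 * in \<open>auto elim: eventually_mono\<close>)
qed

text \<open>At \<open>\<theta> = 0\<close> there is only one plane, and the other three vectors complete the frame arbitrarily.\<close>

lemma orbit_section_minus:
  assumes D: "D = orbit SO5 conj_action (b_vec 0)"
  shows "\<exists>\<sigma>. orbit_section D (b_vec 0) \<sigma>"
proof -
  let ?b = "b_vec 0"
  have bD: "?b \<in> D" using D b_vec_in_orbit by simp
  define P where "P y = - (y ** y)" for y :: "real^5^5"
  have P: "y ** y ** P y = - (1\<^sup>2) *\<^sub>R P y" if y: "y \<in> D" for y
  proof -
    obtain g where g: "rotation_matrix g" "y = cj g ?b" using y D b_vec_in_unit_bivectors by (auto simp: orbit_eq)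
    have 1: "?b ** ?b ** P ?b = - (1\<^sup>2) *\<^sub>R P ?b"
      by (simp add: P_def b_vec_biv biv_def matrix_eq_iff_5 matrix_mult_nth_5)
    have "P y = cj g (P ?b)" using g by (simp add: P_def cj_uminus cj_mult)
    then show ?thesis using g 1 by (simp add: cj_mult[symmetric] cj_scaleR cj_uminus)
  qed
  have e: "P ?b *v e_vec 1 = 1 *\<^sub>R e_vec 1"
    by (simp_all add: P_def vec_eq_iff forall_5 b_vec_biv biv_def e_vec_def matrix_vector_mult_def sum_5 axis_def
        matrix_mult_nth_5)
  have sP: "smooth_at D ?b P" unfolding P_def by (intro smooth_intros)
  have evP: "eventually (\<lambda>y. y ** y ** P y = - (1\<^sup>2) *\<^sub>R P y) (near D ?b)"
    using P by (intro near_everyI) simp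
  define q1 where "q1 y = nz (P y *v e_vec 1)" for y
  have k: "e_vec i \<bullet> e_vec i = 1" for i by (simp add: e_vec_inner)
  note q1 = eigen_column[OF bD sP e(1) k _ evP, folded q1_def]
  define q2 where "q2 y = - (1 / 1) *\<^sub>R (y *v q1 y)" for y
  have s2: "smooth_at D ?b q2" unfolding q2_def by (intro smooth_intros q1) simp
  have b2: "q2 ?b = e_vec 2" using q1(2) by (simp add: q2_def b_vec_mult_e_vec matrix_vector_minus)
  have biv: "eventually (\<lambda>y. y \<in> bivectors) (near D ?b)"
    using D orbit_subset[OF b_vec_in_unit_bivectors, of 0] by (intro near_everyI) (auto simp: unit_bivectors_def)
  have on: "eventually (\<lambda>y. orthonormal_list [q1 y, q2 y] \<and> q1 y \<bullet> (y *v q2 y) = 1) (near D ?b)"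
    using biv q1(3)[simplified]
  proof eventually_elim
    case (elim y)
    have q1': "q1 y \<bullet> q1 y = 1" "y *v (y *v q1 y) = - (1\<^sup>2) *\<^sub>R q1 y" using elim(2) by auto
    show ?case using invariant_plane[OF elim(1) q1', folded q2_def] q1' by (simp add: orthonormal_list_def)
  qed
  have ev2: "eventually (\<lambda>y. orthonormal_list (map (\<lambda>q. q y) [q1, q2])) (near D ?b)"
    using on by eventually_elim simp
  define q3 where "q3 y = nz (residual (map (\<lambda>q. q y) [q1, q2]) (e_vec 3))" for y
  have q3: "smooth_at D ?b q3" "q3 ?b = e_vec 3"
    "eventually (\<lambda>y. orthonormal_list (map (\<lambda>q. q y) [q1, q2] @ [q3 y])) (near D ?b)"
    unfolding q3_def
    by (rule frame_completion[OF bD _ ev2]; use q1 s2 in \<open>auto simp: residual_def b2 e_vec_inner\<close>)+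
  have ev3: "eventually (\<lambda>y. orthonormal_list (map (\<lambda>q. q y) [q1, q2, q3])) (near D ?b)"
    using q3(3) by simp
  define q4 where "q4 y = nz (residual (map (\<lambda>q. q y) [q1, q2, q3]) (e_vec 4))" for y
  have q4: "smooth_at D ?b q4" "q4 ?b = e_vec 4"
    "eventually (\<lambda>y. orthonormal_list (map (\<lambda>q. q y) [q1, q2, q3] @ [q4 y])) (near D ?b)"
    unfolding q4_def
    by (rule frame_completion[OF bD _ ev3]; use q1 s2 q3 in \<open>auto simp: residual_def b2 e_vec_inner\<close>)+
  have ev4: "eventually (\<lambda>y. orthonormal_list (map (\<lambda>q. q y) [q1, q2, q3, q4])) (near D ?b)"
    using q4(3) by simp
  define q5 where "q5 y = nz (residual (map (\<lambda>q. q y) [q1, q2, q3, q4]) (e_vec 5))" for y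
  have q5: "smooth_at D ?b q5" "q5 ?b = e_vec 5"
    "eventually (\<lambda>y. orthonormal_list (map (\<lambda>q. q y) [q1, q2, q3, q4] @ [q5 y])) (near D ?b)"
    unfolding q5_def
    by (rule frame_completion[OF bD _ ev4]; use q1 s2 q3 q4 in \<open>auto simp: residual_def b2 e_vec_inner\<close>)+
  have "eventually (\<lambda>y. q1 y \<bullet> (y *v q2 y) = cos 0 \<and> (sin 0 \<noteq> (0::real) \<longrightarrow> q3 y \<bullet> (y *v q4 y) = sin 0)) (near D ?b)"
    using on by eventually_elim simp
  then show ?thesis
    using q1 s2 q3 q4 q5 b2
    by (intro orbit_section_from_frame[OF D, of q1 q2 q3 q4 q5]) auto
qed

lemma has_local_sections_b_vec:
  assumes "\<theta> \<in> {0..pi/4}"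
  shows "has_local_sections (carrier SO5) (orbit SO5 conj_action (b_vec \<theta>)) (\<lambda>g. cj g (b_vec \<theta>))"
proof -
  have "\<theta> = 0 \<or> \<theta> = pi/4 \<or> \<theta> \<in> {0<..<pi/4}" using assms by auto
  then obtain \<sigma> where "orbit_section (orbit SO5 conj_action (b_vec \<theta>)) (b_vec \<theta>) \<sigma>"
    using orbit_section_generic[of \<theta>] orbit_section_plus orbit_section_minus by metis
  then show ?thesis by (intro has_local_sections_orbit[OF refl b_vec_in_unit_bivectors])
qed

lemma smooth_on_cj: "smooth_on S (\<lambda>g. cj g A)"
  unfolding smooth_on_iff_smooth_at cj_def by (auto intro!: smooth_intros)

text \<open>The cosets of an isotropy group are the fibres of the orbit map.\<close>

lemma l_coset_eq_iff:
  assumes "A \<in> unit_bivectors" "rotation_matrix g" "rotation_matrix h"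
  shows "g <#\<^bsub>SO5\<^esub> isotropy A = h <#\<^bsub>SO5\<^esub> isotropy A \<longleftrightarrow> cj g A = cj h A"
proof -
  have "k <#\<^bsub>SO5\<^esub> isotropy A = {x. rotation_matrix x \<and> cj x A = cj k A}" if k: "rotation_matrix k" for k
  proof -
    have "x \<in> k <#\<^bsub>SO5\<^esub> isotropy A" if x: "rotation_matrix x" "cj x A = cj k A" for x
    proof -
      have "cj (transpose k ** x) A = A" using x k by (simp add: cj_cj[symmetric])
      then have "transpose k ** x \<in> isotropy A"
        using x k assms by (simp add: isotropy_eq rotation_matrix_mult rotation_matrix_transpose)
      moreover have "x = k ** (transpose k ** x)" using k by simp
      ultimately show ?thesis unfolding l_coset_def by auto
    qed
    moreover have "rotation_matrix x \<and> cj x A = cj k A" if "x \<in> k <#\<^bsub>SO5\<^esub> isotropy A" for x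
      using that k assms by (auto simp: l_coset_def isotropy_eq rotation_matrix_mult cj_cj[symmetric])
    ultimately show ?thesis by auto
  qed
  then show ?thesis using assms by auto
qed

lemma orbit_is_homogeneous_b_vec:
  assumes \<theta>: "\<theta> \<in> {0..pi/4}"
  shows "orbit_is_homogeneous (b_vec \<theta>) (isotropy (b_vec \<theta>))"
proof -
  let ?b = "b_vec \<theta>"
  note b = b_vec_in_unit_bivectors[of \<theta>]
  have im: "(\<lambda>g. cj g ?b) ` carrier SO5 = orbit SO5 conj_action ?b"
    using b by (auto simp: orbit_eq)
  have fib: "g <#\<^bsub>SO5\<^esub> isotropy ?b = h <#\<^bsub>SO5\<^esub> isotropy ?b \<longleftrightarrow> cj g ?b = cj h ?b"
    if "g \<in> carrier SO5" "h \<in> carrier SO5" for g h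
    using that l_coset_eq_iff[OF b] by simp
  show ?thesis
  proof (rule diffeomorphism_quotient_diff_ex[OF smooth_on_cj im has_local_sections_b_vec[OF \<theta>] fib])
    fix \<phi>
    assume "diffeomorphism (quotient_diff (carrier SO5) (\<lambda>g. g <#\<^bsub>SO5\<^esub> isotropy ?b))
        (sub_diff (orbit SO5 conj_action ?b)) \<phi>"
      and "\<And>g. g \<in> carrier SO5 \<Longrightarrow> \<phi> (g <#\<^bsub>SO5\<^esub> isotropy ?b) = cj g ?b"
    then show ?thesis
      unfolding orbit_is_homogeneous_def homogeneous_space_def conj_action_eq[OF b] by blast
  qed
qed


section \<open>Normal slices of the singular orbits\<close>

text \<open>\<open>slice_dir s\<close> is an isometry from \<open>\<real>\<^sup>3\<close> onto the normal space of the singular orbit at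
  \<open>b\<^sub>s\<close>, the orthogonal complement of \<open>b\<^sub>s\<close> in its centraliser: \<open>\<ss>\<oo>(3)\<close> on the last three
  coordinates, and the anti-self-dual bivectors of \<open>\<real>\<^sup>4\<close>, respectively.\<close>

primrec slice_dir :: "side \<Rightarrow> real^3 \<Rightarrow> real^5^5" where
  "slice_dir Minus x = biv 0 0 0 0 0 0 0 (x$3) (- x$2) (x$1)"
| "slice_dir Plus x = (1 / sqrt 2) *\<^sub>R biv (x$1) (x$2) (x$3) 0 (- x$3) (x$2) 0 (- x$1) 0 0"

text \<open>The orthogonal projection to the normal space; it inverts \<open>slice_dir s\<close>.\<close>

definition slice_coord :: "side \<Rightarrow> real^5^5 \<Rightarrow> real^3" where
  "slice_coord s A = (\<chi> i. biv_inner A (slice_dir s (axis i 1)))"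

text \<open>The direction from \<open>b\<^sub>s\<close> along which the slice runs through the bivectors \<open>b\<^sub>\<theta>\<close>.\<close>

primrec slice_apex :: "side \<Rightarrow> real^3" where
  "slice_apex Minus = axis 3 1"
| "slice_apex Plus = axis 1 1"

abbreviation singular_vec :: "side \<Rightarrow> real^5^5" where
  "singular_vec s \<equiv> b_vec (singular_angle s)"

lemma singular_vec_biv: "singular_vec Minus = biv 1 0 0 0 0 0 0 0 0 0"
  "singular_vec Plus = (1 / sqrt 2) *\<^sub>R biv 1 0 0 0 0 0 0 1 0 0"
  by (simp_all add: b_vec_biv biv_scaleR cos_45 sin_45 biv_eq_iff real_sqrt_divide field_simps)

lemma singular_angle_range: "singular_angle s \<in> {0..pi/4}"
  by (cases s) auto

lemma biv_inner_scaleR: "biv_inner (r *\<^sub>R A) B = r * biv_inner A B" "biv_inner A (r *\<^sub>R B) = r * biv_inner A B"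
  by (simp_all add: biv_inner_def)

lemma biv_inner_add: "biv_inner (A + B) C = biv_inner A C + biv_inner B C" "biv_inner A (B + C) = biv_inner A B + biv_inner A C"
  by (simp_all add: biv_inner_def inner_add_left inner_add_right add_divide_distrib)

lemma biv_inner_commute: "biv_inner A B = biv_inner B A"
  by (simp add: biv_inner_def inner_commute)

lemma linear_slice_dir: "linear (slice_dir s)"
  by (rule linearI; cases s) (simp_all add: biv_add biv_scaleR biv_eq_iff algebra_simps)

lemma linear_slice_coord: "linear (slice_coord s)"
  by (rule linearI) (simp_all add: slice_coord_def vec_eq_iff biv_inner_add biv_inner_scaleR)

lemma inner_3: "x \<bullet> (y :: real^3) = x$1 * y$1 + x$2 * y$2 + x$3 * y$3"
  by (simp add: inner_vec_def sum_3)

lemma half_sqrt: "1 / sqrt 2 * (1 / sqrt 2 * x) = x / (2::real)"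
  by (simp add: field_simps)

lemma slice_dir_inner: "biv_inner (slice_dir s x) (slice_dir s y) = x \<bullet> y"
  by (cases s) (simp_all add: biv_inner_scaleR biv_inner_biv inner_3 half_sqrt del: times_divide_eq_left times_divide_eq_right)

lemma slice_coord_dir [simp]: "slice_coord s (slice_dir s x) = x"
  by (simp add: slice_coord_def slice_dir_inner vec_eq_iff inner_axis)

lemma slice_dir_bivectors [simp]: "slice_dir s x \<in> bivectors"
  by (cases s) (simp_all add: subspace_scale[OF subspace_bivectors])

lemma slice_dir_orthogonal: "biv_inner (slice_dir s x) (singular_vec s) = 0"
  by (cases s) (simp_all only: slice_dir.simps singular_vec_biv biv_inner_scaleR biv_inner_biv, simp_all)

lemma slice_dir_commutes: "slice_dir s x ** singular_vec s = singular_vec s ** slice_dir s x"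
  by (cases s) (simp_all only: slice_dir.simps singular_vec_biv matrix_scaleR_left matrix_scaleR_right,
    simp_all add: biv_def matrix_eq_iff_5 matrix_mult_nth_5)

text \<open>The normal space is all of the orthogonal complement of \<open>b\<^sub>s\<close> in its centraliser.  This is what
  makes it invariant under the isotropy group, which preserves that complement.\<close>

lemma slice_dir_slice_coord:
  assumes X: "X \<in> bivectors" "X ** singular_vec s = singular_vec s ** X" "biv_inner X (singular_vec s) = 0"
  shows "slice_dir s (slice_coord s X) = X"
proof -
  obtain a b c d e f g h i j where X_eq: "X = biv a b c d e f g h i j" using X(1) by (rule bivectors_cases)
  show ?thesis
  proof (cases s)
    case Minus
    have "(X ** singular_vec s) $ k $ l = (singular_vec s ** X) $ k $ l" for k l using X(2) by simp
    note e = this[unfolded Minus singular_vec_biv X_eq matrix_mult_nth_5]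
    have "b = 0" "c = 0" "d = 0" "e = 0" "f = 0" "g = 0"
      using e[of 2 3] e[of 2 4] e[of 2 5] e[of 1 3] e[of 1 4] e[of 1 5] by (simp_all add: biv_def)
    moreover have "a = 0" using X(3) unfolding Minus singular_vec_biv X_eq biv_inner_biv by simp
    ultimately show ?thesis
      by (simp add: Minus X_eq slice_coord_def biv_inner_biv biv_eq_iff axis_def)
  next
    case Plus
    have "(X ** singular_vec s) $ k $ l = (singular_vec s ** X) $ k $ l" for k l using X(2) by simp
    note e = this[unfolded Plus singular_vec_biv X_eq matrix_scaleR_left matrix_scaleR_right vector_scaleR_component matrix_mult_nth_5]
    have "d = 0" "g = 0" "i = 0" "j = 0" "b = f"
      using e[of 2 5] e[of 1 5] e[of 4 5] e[of 3 5] e[of 1 4] by (simp_all add: biv_def)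
    moreover have "(c + e) / sqrt 2 = 0" using e[of 1 3] by (simp add: biv_def add_divide_distrib)
    then have "e = - c" by simp
    moreover have "a = - h" using X(3) unfolding Plus singular_vec_biv X_eq biv_inner_scaleR biv_inner_biv by simp
    ultimately show ?thesis
      by (simp add: Plus X_eq slice_coord_def biv_inner_scaleR biv_inner_biv biv_scaleR biv_eq_iff axis_def field_simps)
  qed
qed

lemma quartic_scaleR: "quartic (r *\<^sub>R A) = r ^ 4 * quartic A"
  by (simp add: quartic_def matrix_scaleR_left matrix_scaleR_right power4_eq_xxxx)

text \<open>Values of \<open>quartic\<close> on the affine slice as a function of \<open>u = |y|\<^sup>2\<close>.\<close>

primrec slice_quartic :: "side \<Rightarrow> real \<Rightarrow> real" where
  "slice_quartic Minus u = 2 * (1 + u\<^sup>2)"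
| "slice_quartic Plus u = 1 + 6 * u + u\<^sup>2"

lemma quartic_slice: "quartic (singular_vec s + slice_dir s y) = slice_quartic s (y \<bullet> y)"
proof (cases s)
  case Minus
  show ?thesis
    by (simp only: Minus slice_dir.simps singular_vec_biv biv_add)
      (simp add: quartic_def inner_matrix_5 matrix_mult_nth_5 biv_def inner_3 power2_eq_square algebra_simps)
next
  case Plus
  have e: "singular_vec s + slice_dir s y =
      (1 / sqrt 2) *\<^sub>R biv (1 + y$1) (y$2) (y$3) 0 (- y$3) (y$2) 0 (1 - y$1) 0 0"
    by (simp only: Plus slice_dir.simps singular_vec_biv scaleR_add_right[symmetric] biv_add) simp
  have "quartic (biv (1 + y$1) (y$2) (y$3) 0 (- y$3) (y$2) 0 (1 - y$1) 0 0) = 4 * slice_quartic s (y \<bullet> y)"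
    by (simp add: Plus quartic_def inner_matrix_5 matrix_mult_nth_5 biv_def inner_3 power2_eq_square algebra_simps)
  then show ?thesis unfolding e quartic_scaleR by (simp add: power_divide power4_eq_xxxx)
qed

text \<open>The coefficients of \<open>b\<^sub>s\<close> and of the normal vector in \<open>(b\<^sub>s + y)\<^sup>3\<close> as functions of \<open>u = |y|\<^sup>2\<close>.  The
  cube is again a combination of \<open>b\<^sub>s\<close> and \<open>y\<close>: at \<open>\<theta> = 0\<close> the two annihilate each other, with \<open>b\<^sub>s\<^sup>3 = - b\<^sub>s\<close> and
  \<open>y\<^sup>3 = - u y\<close>, and at \<open>\<theta> = \<pi>/4\<close> they commute and act on \<open>\<real>\<^sup>4\<close> with squares \<open>- 1/2\<close> and \<open>- u/2\<close>.\<close>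

primrec slice_cubic :: "side \<Rightarrow> real \<Rightarrow> real \<times> real" where
  "slice_cubic Minus u = (- 1, - u)"
| "slice_cubic Plus u = (- (1 + 3 * u) / 2, - (3 + u) / 2)"

lemma cube_slice:
  fixes s y
  defines "A \<equiv> singular_vec s + slice_dir s y"
  shows "A ** A ** A = fst (slice_cubic s (y \<bullet> y)) *\<^sub>R singular_vec s + snd (slice_cubic s (y \<bullet> y)) *\<^sub>R slice_dir s y"
proof (cases s)
  case Minus
  show ?thesis unfolding A_def
    by (simp only: Minus slice_dir.simps singular_vec_biv biv_add biv_scaleR slice_cubic.simps fst_conv snd_conv)
      (simp add: matrix_eq_iff_5 matrix_mult_nth_5 biv_def inner_3 algebra_simps)
next
  case Plus
  have e: "A = (1 / sqrt 2) *\<^sub>R biv (1 + y$1) (y$2) (y$3) 0 (- y$3) (y$2) 0 (1 - y$1) 0 0" (is "_ = _ *\<^sub>R ?B")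
    unfolding A_def
    by (simp only: Plus slice_dir.simps singular_vec_biv scaleR_add_right[symmetric] biv_add) simp
  have "?B ** ?B ** ?B = (- (1 + 3 * (y \<bullet> y))) *\<^sub>R biv 1 0 0 0 0 0 0 1 0 0
      + (- (3 + (y \<bullet> y))) *\<^sub>R biv (y$1) (y$2) (y$3) 0 (- y$3) (y$2) 0 (- y$1) 0 0"
    unfolding biv_scaleR biv_add
    by (simp add: matrix_eq_iff_5 matrix_mult_nth_5 biv_def inner_3 algebra_simps)
  then show ?thesis
    unfolding e matrix_scaleR_left matrix_scaleR_right
    by (simp only: Plus slice_dir.simps singular_vec_biv slice_cubic.simps fst_conv snd_conv)
      (simp add: scaleR_add_right scaleR_diff_right scaleR_left_commute mult.commute[of "sqrt 2" 2])
qed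

text \<open>The radii have to satisfy \<open>arctan r\<^sub>- + arctan r\<^sub>+ = \<pi>/4\<close> for the two tubes to meet; a rational
  solution avoids nested square roots.\<close>

primrec slice_radius :: "side \<Rightarrow> real" where
  "slice_radius Minus = 1 / 3"
| "slice_radius Plus = 1 / 2"

text \<open>Central projection of the disk in the affine slice \<open>b\<^sub>s + r\<^sub>s \<real>\<^sup>3\<close> to the unit sphere.\<close>

definition slice_pt :: "side \<Rightarrow> real^3 \<Rightarrow> real^5^5" where
  "slice_pt s x = (1 / sqrt (1 + (slice_radius s)\<^sup>2 * (x \<bullet> x))) *\<^sub>R (singular_vec s + slice_radius s *\<^sub>R slice_dir s x)"

lemma slice_denominator_pos: "0 < 1 + (slice_radius s)\<^sup>2 * (x \<bullet> (x :: real^3))"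
  by (intro add_pos_nonneg) auto

lemma slice_radius_pos: "0 < slice_radius s" "slice_radius s < 1"
  by (cases s, simp, simp)+

lemma singular_vec_unit: "biv_inner (singular_vec s) (singular_vec s) = 1"
  using b_vec_in_unit_bivectors[of "singular_angle s"] by (simp add: unit_bivectors_def)

lemma slice_pt_unit: "slice_pt s x \<in> unit_bivectors"
proof -
  have "biv_inner (singular_vec s + slice_radius s *\<^sub>R slice_dir s x) (singular_vec s + slice_radius s *\<^sub>R slice_dir s x)
      = 1 + (slice_radius s)\<^sup>2 * (x \<bullet> x)"
    by (simp add: biv_inner_add biv_inner_scaleR slice_dir_inner slice_dir_orthogonal singular_vec_unit
        biv_inner_commute[of "singular_vec s" "slice_dir s x"] power2_eq_square)
  moreover have "slice_pt s x \<in> bivectors"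
    unfolding slice_pt_def using b_vec_in_unit_bivectors
    by (intro subspace_scale subspace_add subspace_bivectors) (auto simp: unit_bivectors_def)
  ultimately show ?thesis
    using slice_denominator_pos[of s x]
    by (simp add: unit_bivectors_def slice_pt_def biv_inner_scaleR)
qed

lemma smooth_at_slice_pt: "smooth_at S x f \<Longrightarrow> x \<in> S \<Longrightarrow> smooth_at S x (\<lambda>y. slice_pt s (f y))"
proof -
  assume f: "smooth_at S x f" "x \<in> S"
  have *: "sqrt (1 + (slice_radius s)\<^sup>2 * (f x \<bullet> f x)) \<noteq> 0" using slice_denominator_pos[of s "f x"] by simp
  show ?thesis unfolding slice_pt_def
    by (intro smooth_intros smooth_at_compose_linear[OF linear_slice_dir] f * slice_denominator_pos)
qed

text \<open>The inverse of the central projection: the normal component divided by the component along \<open>b\<^sub>s\<close>.\<close>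

definition slice_inv :: "side \<Rightarrow> real^5^5 \<Rightarrow> real^3" where
  "slice_inv s A = (1 / (slice_radius s * biv_inner A (singular_vec s))) *\<^sub>R slice_coord s A"

lemma slice_coord_singular_vec: "slice_coord s (singular_vec s) = 0"
  by (simp add: slice_coord_def vec_eq_iff biv_inner_commute[of "singular_vec s"] slice_dir_orthogonal)

lemma biv_inner_slice_pt: "biv_inner (slice_pt s x) (singular_vec s) = 1 / sqrt (1 + (slice_radius s)\<^sup>2 * (x \<bullet> x))"
  by (simp add: slice_pt_def biv_inner_add biv_inner_scaleR slice_dir_orthogonal singular_vec_unit)

lemma slice_inv_slice_pt [simp]: "slice_inv s (slice_pt s x) = x"
proof -
  have "slice_coord s (slice_pt s x) = (slice_radius s / sqrt (1 + (slice_radius s)\<^sup>2 * (x \<bullet> x))) *\<^sub>R x"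
    by (simp add: slice_pt_def linear_cmul[OF linear_slice_coord] linear_add[OF linear_slice_coord] slice_coord_singular_vec)
  then show ?thesis
    using slice_denominator_pos[of s x] slice_radius_pos[of s] by (simp add: slice_inv_def biv_inner_slice_pt)
qed

lemma smooth_at_slice_inv:
  "smooth_at S x f \<Longrightarrow> x \<in> S \<Longrightarrow> biv_inner (f x) (singular_vec s) \<noteq> 0 \<Longrightarrow> smooth_at S x (\<lambda>y. slice_inv s (f y))"
  unfolding slice_inv_def biv_inner_def using slice_radius_pos[of s]
  by (intro smooth_intros smooth_at_compose_linear[OF linear_slice_coord]) auto

text \<open>The angle of the orbit through \<open>slice_pt s x\<close>, for \<open>t = |x|\<close>.\<close>

primrec tube_angle :: "side \<Rightarrow> real \<Rightarrow> real" where
  "tube_angle Minus t = arctan (t / 3)"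
| "tube_angle Plus t = pi / 4 - arctan (t / 2)"

lemma slice_pt_apex: "slice_pt s (t *\<^sub>R slice_apex s) = b_vec (tube_angle s t)"
proof -
  have i: "(t *\<^sub>R slice_apex s) \<bullet> (t *\<^sub>R slice_apex s) = t\<^sup>2"
    by (cases s) (simp_all add: inner_axis_axis power2_eq_square)
  show ?thesis
  proof (cases s)
    case Minus
    have "slice_dir s (t *\<^sub>R slice_apex s) = biv 0 0 0 0 0 0 0 t 0 0"
      by (simp add: Minus axis_def)
    moreover have "1 + (slice_radius s)\<^sup>2 * t\<^sup>2 = 1 + (t / 3)\<^sup>2"
      by (simp add: Minus power_divide)
    ultimately show ?thesis
      unfolding slice_pt_def i
      by (simp only: Minus singular_vec_biv slice_radius.simps)
        (simp add: b_vec_biv cos_arctan sin_arctan biv_add biv_scaleR biv_eq_iff)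
  next
    case Plus
    have N: "slice_dir Plus (t *\<^sub>R slice_apex Plus) = (1 / sqrt 2) *\<^sub>R biv t 0 0 0 0 0 0 (- t) 0 0"
      by (simp add: axis_def)
    have d: "1 + (1 / 2)\<^sup>2 * t\<^sup>2 = 1 + (t / 2)\<^sup>2"
      by (simp add: power_divide)
    define r where "r = sqrt (1 + (t / 2)\<^sup>2)"
    have h: "sqrt 2 / 2 = 1 / sqrt 2" by (simp add: field_simps)
    have "cos (tube_angle Plus t) = 1 / r * (1 / sqrt 2 + 1 / 2 * (1 / sqrt 2 * t))"
      "sin (tube_angle Plus t) = 1 / r * (1 / sqrt 2 - 1 / 2 * (1 / sqrt 2 * t))"
      unfolding tube_angle.simps cos_diff sin_diff cos_45 sin_45 cos_arctan sin_arctan h r_def[symmetric]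
      by (simp_all add: algebra_simps)
    then have "b_vec (tube_angle Plus t) = biv (1 / r * (1 / sqrt 2 + 1 / 2 * (1 / sqrt 2 * t))) 0 0 0 0 0 0
        (1 / r * (1 / sqrt 2 - 1 / 2 * (1 / sqrt 2 * t))) 0 0"
      by (simp only: b_vec_biv)
    moreover have "slice_pt Plus (t *\<^sub>R slice_apex Plus) = \<dots>"
      unfolding slice_pt_def i[unfolded Plus] slice_radius.simps
      unfolding d r_def[symmetric] N singular_vec_biv biv_scaleR biv_add biv_eq_iff by simp
    ultimately show ?thesis unfolding Plus by simp
  qed
qed

definition meeting_angle :: real where "meeting_angle = arctan (1 / 3)"

text \<open>The boundary spheres of both tubes lie in the same principal orbit: this is the identity
  \<open>arctan (1/2) + arctan (1/3) = \<pi>/4\<close>.\<close>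

lemma tube_angle_1: "tube_angle s 1 = meeting_angle"
proof -
  have "arctan (1/2) + arctan (1/3) = arctan ((1/2 + 1/3) / (1 - 1/2 * (1/3 :: real)))"
    by (rule arctan_add) auto
  then have "arctan (1/2) + arctan (1/3 :: real) = pi / 4" by (simp add: arctan_one)
  then show ?thesis by (cases s) (simp_all add: meeting_angle_def)
qed

lemma meeting_angle_range: "meeting_angle \<in> {0<..<pi/4}"
proof -
  have "arctan (1/3) < arctan 1" by (simp only: arctan_less_iff)
  then show ?thesis by (simp add: meeting_angle_def arctan_one)
qed

lemma tube_angle_range: "t \<in> {0..1} \<Longrightarrow> tube_angle s t \<in> (case s of Minus \<Rightarrow> {0..meeting_angle} | Plus \<Rightarrow> {meeting_angle..pi/4})"
  using tube_angle_1[of Plus] arctan_monotone'[of "t / 2" "1 / 2"] arctan_monotone'[of "t / 3" "1 / 3"]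
  by (cases s) (auto simp: meeting_angle_def)

lemma tube_angle_range': "t \<in> {0..1} \<Longrightarrow> tube_angle s t \<in> {0..pi/4}"
  using tube_angle_range[of t s] meeting_angle_range by (cases s) auto

lemma tube_angle_surj:
  assumes "\<theta> \<in> (case s of Minus \<Rightarrow> {0..meeting_angle} | Plus \<Rightarrow> {meeting_angle..pi/4})"
  shows "\<exists>t\<in>{0..1}. tube_angle s t = \<theta>"
proof (cases s)
  case Minus
  then have \<theta>: "0 \<le> \<theta>" "\<theta> \<le> arctan (1 / 3)" "\<theta> < pi/2" using assms meeting_angle_range by (auto simp: meeting_angle_def)
  then have a: "arctan (tan \<theta>) = \<theta>" by (intro arctan_tan) auto
  then have "0 \<le> tan \<theta>" "tan \<theta> \<le> 1/3" using \<theta> by (metis zero_le_arctan_iff) (metis \<theta>(2) a arctan_le_iff)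
  then show ?thesis using a Minus by (intro bexI[of _ "3 * tan \<theta>"]) auto
next
  case Plus
  define \<phi> where "\<phi> = pi/4 - \<theta>"
  have \<phi>: "0 \<le> \<phi>" "\<phi> \<le> arctan (1 / 2)" "\<phi> < pi/2"
    using assms meeting_angle_range tube_angle_1[of Plus] Plus by (auto simp: \<phi>_def)
  then have a: "arctan (tan \<phi>) = \<phi>" by (intro arctan_tan) auto
  then have "0 \<le> tan \<phi>" "tan \<phi> \<le> 1/2" using \<phi> by (metis zero_le_arctan_iff) (metis \<phi>(2) a arctan_le_iff)
  then show ?thesis using a Plus by (intro bexI[of _ "2 * tan \<phi>"]) (auto simp: \<phi>_def)
qed

lemma tube_angle_inj: "tube_angle s t = tube_angle s t' \<longleftrightarrow> t = t'"
  by (cases s) (simp_all add: arctan_eq_iff)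

text \<open>The retraction of the tube onto its core: an odd polynomial in \<open>A\<close>, with coefficients
  depending on the invariant \<open>quartic A\<close>, that annihilates the normal component, followed by a
  normalisation.  With \<open>u = r\<^sub>s\<^sup>2 |x|\<^sup>2\<close> the coefficient that kills the normal component of \<open>A\<^sup>3 + c A\<close> is \<open>u / (1 + u)\<close> or
  \<open>(3 + u) / (2 (1 + u))\<close>.  It is expressed by the invariant through \<open>w = (1 - u) / (1 + u)\<close>, whose square
  is \<open>quartic A - 1\<close> or \<open>2 - quartic A\<close>, respectively.\<close>

primrec core_coeff :: "side \<Rightarrow> real \<Rightarrow> real" where
  "core_coeff Minus q = (1 - sqrt (q - 1)) / 2"
| "core_coeff Plus q = 1 + sqrt (2 - q) / 2"

primrec core_sign :: "side \<Rightarrow> real" where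
  "core_sign Minus = - 1"
| "core_sign Plus = 1"

text \<open>Where the square root in \<open>core_coeff\<close> is smooth: away from the other singular orbit.\<close>

primrec core_domain :: "side \<Rightarrow> real set" where
  "core_domain Minus = {1<..}"
| "core_domain Plus = {..<2}"

definition core_poly :: "side \<Rightarrow> real^5^5 \<Rightarrow> real^5^5" where
  "core_poly s A = core_sign s *\<^sub>R (A ** A ** A + core_coeff s (quartic A) *\<^sub>R A)"

definition core :: "side \<Rightarrow> real^5^5 \<Rightarrow> real^5^5" where
  "core s A = inverse (sqrt (biv_inner (core_poly s A) (core_poly s A))) *\<^sub>R core_poly s A"

lemma core_poly_cj: "rotation_matrix g \<Longrightarrow> core_poly s (cj g A) = cj g (core_poly s A)"
  by (simp add: core_poly_def cj_scaleR cj_add cj_mult quartic_cj)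

lemma core_cj: "rotation_matrix g \<Longrightarrow> core s (cj g A) = cj g (core s A)"
  by (simp add: core_def core_poly_cj cj_scaleR cj_biv_inner)

lemma slice_norm_lt_1: "x \<in> cball 0 1 \<Longrightarrow> (slice_radius s)\<^sup>2 * (x \<bullet> x) < 1" for x :: "real^3"
proof -
  assume "x \<in> cball 0 1"
  then have "x \<bullet> x \<le> 1" by (simp add: dot_square_norm power_le_one)
  then have "(slice_radius s)\<^sup>2 * (x \<bullet> x) \<le> (slice_radius s)\<^sup>2" by (simp add: mult_left_le)
  also have "\<dots> < 1" by (cases s) (simp_all add: power2_eq_square)
  finally show ?thesis .
qed

lemma core_poly_slice_pt:
  assumes "x \<in> cball 0 1"
  shows "quartic (slice_pt s x) \<in> core_domain s"
    "\<exists>k>0. core_poly s (slice_pt s x) = k *\<^sub>R singular_vec s"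
proof -
  define u where "u = (slice_radius s)\<^sup>2 * (x \<bullet> x)"
  define m where "m = sqrt (1 + u)"
  define y where "y = slice_radius s *\<^sub>R x"
  have u: "0 \<le> u" "u < 1" using slice_norm_lt_1[OF assms] by (simp_all add: u_def)
  have m: "0 < m" "m\<^sup>2 = 1 + u" using u by (simp_all add: m_def)
  then have m4: "m ^ 4 = (1 + u)\<^sup>2" by (metis power2_eq_square power4_eq_xxxx mult.assoc)
  have yy: "y \<bullet> y = u" by (simp add: y_def u_def power2_eq_square)
  let ?N = "slice_dir s y" and ?b = "singular_vec s"
  have A: "slice_pt s x = (1 / m) *\<^sub>R (?b + ?N)"
    by (simp add: slice_pt_def m_def u_def y_def linear_cmul[OF linear_slice_dir])
  have q: "quartic (slice_pt s x) = slice_quartic s u / (1 + u)\<^sup>2"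
    unfolding A quartic_scaleR quartic_slice yy by (simp add: power_divide m4)
  \<comment> \<open>\<open>w\<close> is the positive square root that occurs in \<open>core_coeff\<close>; this is where \<open>r\<^sub>s < 1\<close> enters.\<close>
  define w where "w = (1 - u) / (1 + u)"
  have w: "0 < w" "0 < w\<^sup>2" using u by (simp_all add: w_def)
  have dom: "quartic (slice_pt s x) \<in> core_domain s \<and> core_coeff s (quartic (slice_pt s x)) =
      (case s of Minus \<Rightarrow> u / (1 + u) | Plus \<Rightarrow> (3 + u) / (2 * (1 + u)))"
  proof (cases s)
    case Minus
    have "slice_quartic s u = (1 - u)\<^sup>2 + (1 + u)\<^sup>2" by (simp add: Minus power2_eq_square algebra_simps)
    then have d: "quartic (slice_pt s x) - 1 = w\<^sup>2"
      unfolding q using u by (simp add: add_divide_distrib power_divide w_def)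
    then have "core_coeff s (quartic (slice_pt s x)) = (1 - w) / 2" using w by (simp add: Minus)
    also have "\<dots> = u / (1 + u)" using u by (simp add: w_def field_simps)
    finally have c: "core_coeff s (quartic (slice_pt s x)) = u / (1 + u)" .
    have "1 < quartic (slice_pt s x)" using w d by linarith
    then show ?thesis unfolding c by (simp add: Minus)
  next
    case Plus
    have "slice_quartic s u = 2 * (1 + u)\<^sup>2 - (1 - u)\<^sup>2" by (simp add: Plus power2_eq_square algebra_simps)
    then have d: "2 - quartic (slice_pt s x) = w\<^sup>2"
      unfolding q w_def power_divide using u by (simp add: diff_divide_distrib)
    then have "core_coeff s (quartic (slice_pt s x)) = 1 + w / 2" using w by (simp add: Plus)
    also have "\<dots> = (3 + u) / (2 * (1 + u))" using u by (simp add: w_def field_simps)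
    finally have c: "core_coeff s (quartic (slice_pt s x)) = (3 + u) / (2 * (1 + u))" .
    have "quartic (slice_pt s x) < 2" using w d by linarith
    then show ?thesis unfolding c by (simp add: Plus)
  qed
  then show "quartic (slice_pt s x) \<in> core_domain s" by simp
  define c0 where "c0 = core_coeff s (quartic (slice_pt s x))"
  have c0: "c0 = (case s of Minus \<Rightarrow> u / (1 + u) | Plus \<Rightarrow> (3 + u) / (2 * (1 + u)))"
    unfolding c0_def by (rule conjunct2[OF dom])
  have E: "core_poly s (slice_pt s x) = (core_sign s * (1 / m)) *\<^sub>R
     ((fst (slice_cubic s u) / m\<^sup>2 + c0) *\<^sub>R ?b + (snd (slice_cubic s u) / m\<^sup>2 + c0) *\<^sub>R ?N)"
  proof -
    have c: "slice_pt s x ** slice_pt s x ** slice_pt s x =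
        (1 / m) *\<^sub>R (1 / m) *\<^sub>R (1 / m) *\<^sub>R (fst (slice_cubic s u) *\<^sub>R ?b + snd (slice_cubic s u) *\<^sub>R ?N)"
      unfolding A matrix_scaleR_left matrix_scaleR_right cube_slice[of s y, unfolded yy] ..
    show ?thesis unfolding core_poly_def unfolding c c0_def[symmetric] unfolding A
      by (simp add: scaleR_add_right scaleR_add_left power2_eq_square algebra_simps)
  qed
  \<comment> \<open>The normal component vanishes, and the sign makes the other one positive.\<close>
  have B: "snd (slice_cubic s u) / m\<^sup>2 + c0 = 0"
    using c0 u by (cases s) (simp_all add: m field_simps)
  have C: "core_sign s * (fst (slice_cubic s u) / m\<^sup>2 + c0) = (1 - u) / (1 + u)"
    using c0 u by (cases s) (simp_all add: m field_simps)
  have "core_poly s (slice_pt s x) = (1 / m * (core_sign s * (fst (slice_cubic s u) / m\<^sup>2 + c0))) *\<^sub>R ?b"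
    unfolding E B by (simp add: ac_simps)
  then have "core_poly s (slice_pt s x) = ((1 - u) / ((1 + u) * m)) *\<^sub>R ?b" unfolding C by (simp add: ac_simps)
  moreover have "0 < (1 - u) / ((1 + u) * m)" using u m by simp
  ultimately show "\<exists>k>0. core_poly s (slice_pt s x) = k *\<^sub>R ?b" by blast
qed

lemma core_slice_pt: "x \<in> cball 0 1 \<Longrightarrow> core s (slice_pt s x) = singular_vec s"
  using core_poly_slice_pt(2)[of x s]
  by (auto simp: core_def biv_inner_scaleR singular_vec_unit real_sqrt_mult)

lemma smooth_at_core:
  assumes "smooth_at S x f" "x \<in> S" "quartic (f x) \<in> core_domain s" "core_poly s (f x) \<noteq> 0"
  shows "smooth_at S x (\<lambda>y. core s (f y))"
proof -
  have q: "smooth_at S x (\<lambda>y. quartic (f y))" unfolding quartic_def by (intro smooth_intros assms)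
  then have "smooth_at S x (\<lambda>y. core_coeff s (quartic (f y)))"
    using assms(2,3) by (cases s) (auto intro!: smooth_intros)
  then have p: "smooth_at S x (\<lambda>y. core_poly s (f y))"
    unfolding core_poly_def by (intro smooth_intros assms)
  have "0 < biv_inner (core_poly s (f x)) (core_poly s (f x))"
    using assms(4) by (simp add: biv_inner_def)
  moreover from this have "sqrt (biv_inner (core_poly s (f x)) (core_poly s (f x))) \<noteq> 0" by simp
  ultimately show ?thesis
    unfolding core_def biv_inner_def by (intro smooth_intros p assms) (simp_all add: biv_inner_def)
qed


section \<open>The slice representations\<close>

lemma K_side_iff: "k \<in> K_side s \<longleftrightarrow> rotation_matrix k \<and> cj k (singular_vec s) = singular_vec s"
  by (simp add: isotropy_singular[symmetric] isotropy_eq b_vec_in_unit_bivectors)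

lemma T2_iff: "k \<in> T2 \<longleftrightarrow> rotation_matrix k \<and> cj k (b_vec meeting_angle) = b_vec meeting_angle"
  by (simp add: isotropy_generic[OF meeting_angle_range, symmetric] isotropy_eq b_vec_in_unit_bivectors)

lemma K_side_rotation: "k \<in> K_side s \<Longrightarrow> rotation_matrix k"
  by (simp add: K_side_iff)

lemma T2_subset_K_side: "T2 \<subseteq> K_side s"
  using T2_subset_isotropy by (auto simp: K_side_iff)

lemma K_side_mult: "k \<in> K_side s \<Longrightarrow> l \<in> K_side s \<Longrightarrow> k ** l \<in> K_side s"
  by (simp add: K_side_iff rotation_matrix_mult cj_cj[symmetric])

lemma K_side_1: "mat 1 \<in> K_side s"
  by (simp add: K_side_iff rotation_matrix_1)

definition slice_rep :: "side \<Rightarrow> real^5^5 \<Rightarrow> real^3^3" where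
  "slice_rep s k = matrix (\<lambda>x. slice_coord s (cj k (slice_dir s x)))"

lemma slice_rep_apply: "slice_rep s k *v x = slice_coord s (cj k (slice_dir s x))"
proof -
  have "linear (\<lambda>x. slice_coord s (cj k (slice_dir s x)))"
    using linear_compose[OF linear_compose[OF linear_slice_dir linear_cj] linear_slice_coord]
    by (simp add: o_def)
  then have "Vector_Spaces.linear (*s) (*s) (\<lambda>x. slice_coord s (cj k (slice_dir s x)))"
    by (simp add: linear_matrix_vector_mul_eq)
  then show ?thesis unfolding slice_rep_def by (rule matrix_works)
qed

lemma slice_dir_slice_rep:
  assumes k: "k \<in> K_side s"
  shows "slice_dir s (slice_rep s k *v x) = cj k (slice_dir s x)"
proof -
  have kr: "rotation_matrix k" "cj k (singular_vec s) = singular_vec s" using k by (simp_all add: K_side_iff)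
  show ?thesis unfolding slice_rep_apply
  proof (rule slice_dir_slice_coord)
    show "cj k (slice_dir s x) \<in> bivectors" by (simp add: cj_bivectors)
    show "cj k (slice_dir s x) ** singular_vec s = singular_vec s ** cj k (slice_dir s x)"
      using cj_mult[OF kr(1), of "slice_dir s x" "singular_vec s"] cj_mult[OF kr(1), of "singular_vec s" "slice_dir s x"]
        slice_dir_commutes[of s x] kr(2) by simp
    show "biv_inner (cj k (slice_dir s x)) (singular_vec s) = 0"
      using cj_biv_inner[OF kr(1), of "slice_dir s x" "singular_vec s"] kr(2) slice_dir_orthogonal by simp
  qed
qed

lemma slice_dir_inj: "slice_dir s x = slice_dir s y \<longleftrightarrow> x = y"
  by (metis slice_coord_dir)

lemma slice_rep_inner: "k \<in> K_side s \<Longrightarrow> (slice_rep s k *v x) \<bullet> (slice_rep s k *v y) = x \<bullet> y"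
  by (metis K_side_rotation cj_biv_inner slice_dir_inner slice_dir_slice_rep)

lemma slice_rep_norm: "k \<in> K_side s \<Longrightarrow> norm (slice_rep s k *v x) = norm x"
  by (simp add: norm_eq_sqrt_inner slice_rep_inner)

lemma slice_rep_mult: "k \<in> K_side s \<Longrightarrow> l \<in> K_side s \<Longrightarrow>
   slice_rep s (k ** l) *v x = slice_rep s k *v (slice_rep s l *v x)"
  using slice_dir_slice_rep[of k s "slice_rep s l *v x"]
  by (simp add: slice_dir_inj[of s, symmetric] slice_dir_slice_rep K_side_mult cj_cj)

lemma slice_rep_1: "slice_rep s (mat 1) *v x = x"
  by (simp add: slice_rep_apply)

lemma slice_pt_slice_rep: "k \<in> K_side s \<Longrightarrow> slice_pt s (slice_rep s k *v x) = cj k (slice_pt s x)"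
  by (simp add: slice_pt_def slice_rep_inner slice_dir_slice_rep cj_scaleR cj_add) (simp add: K_side_iff)

lemma smooth_on_slice_rep: "smooth_on S (slice_rep s)"
  unfolding smooth_on_iff_smooth_at
proof
  fix x assume "x \<in> S"
  have "smooth_at S x (\<lambda>k. slice_rep s k $ i $ j)" for i j
  proof -
    have "slice_rep s k $ i $ j = slice_coord s (cj k (slice_dir s (axis j 1))) $ i" for k
      by (simp add: slice_rep_def matrix_def)
    then show ?thesis
      by (auto simp: cj_def intro!: smooth_intros smooth_at_compose_linear[OF linear_slice_coord])
  qed
  then show "smooth_at S x (slice_rep s)" by (intro smooth_at_vec)
qed

text \<open>The retraction is equivariant and sends the whole slice to \<open>b\<^sub>s\<close>, so an element that connects two
  points of the slice fixes \<open>b\<^sub>s\<close>.\<close>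

lemma core_fixes_K_side:
  assumes "rotation_matrix g" "x \<in> cball 0 1" "y \<in> cball 0 1" "cj g (slice_pt s x) = slice_pt s y"
  shows "g \<in> K_side s" "y = slice_rep s g *v x"
proof -
  show g: "g \<in> K_side s"
    using core_cj[OF assms(1), of s "slice_pt s x"] assms by (simp add: core_slice_pt K_side_iff)
  show "y = slice_rep s g *v x"
    using slice_pt_slice_rep[OF g, of x] assms(4) by (metis slice_inv_slice_pt)
qed

lemma slice_apex_inner: "slice_apex s \<bullet> slice_apex s = 1"
  by (cases s) (simp_all add: inner_axis_axis)

lemma slice_apex_sphere: "slice_apex s \<in> sphere 0 1"
  using slice_apex_inner[of s] by (simp add: norm_eq_sqrt_inner)

text \<open>Points of the slice at the same distance from its centre have the same invariant and are therefore
  conjugate under \<open>SO(5)\<close>; by the previous lemma they are conjugate under \<open>K\<close>.\<close>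

lemma slice_transitive:
  assumes x: "x \<in> cball 0 1"
  obtains k where "k \<in> K_side s" "x = slice_rep s k *v (norm x *\<^sub>R slice_apex s)"
proof -
  let ?y = "norm x *\<^sub>R slice_apex s"
  have y: "?y \<in> cball 0 1" "?y \<bullet> ?y = x \<bullet> x"
    using x slice_apex_inner[of s] slice_apex_sphere[of s] by (simp_all add: dot_square_norm power2_eq_square)
  have q: "quartic (slice_pt s z) = slice_quartic s ((slice_radius s)\<^sup>2 * (z \<bullet> z)) / (sqrt (1 + (slice_radius s)\<^sup>2 * (z \<bullet> z))) ^ 4" for z
  proof -
    have "(slice_radius s *\<^sub>R z) \<bullet> (slice_radius s *\<^sub>R z) = (slice_radius s)\<^sup>2 * (z \<bullet> z)"
      by (simp add: power2_eq_square)
    note quartic_slice[of s "slice_radius s *\<^sub>R z", unfolded this]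
    then show ?thesis
      by (simp add: slice_pt_def quartic_scaleR linear_cmul[OF linear_slice_dir] power_divide)
  qed
  have "quartic (slice_pt s x) = quartic (slice_pt s ?y)" unfolding q y(2) ..
  then have "quartic (slice_pt s x) = quartic (b_vec (tube_angle s (norm x)))"
    by (simp only: slice_pt_apex)
  moreover have "tube_angle s (norm x) \<in> {0..pi/4}" using x by (intro tube_angle_range') auto
  ultimately have "slice_pt s x \<in> orbit SO5 conj_action (b_vec (tube_angle s (norm x)))"
    using in_orbit_b_vec_iff slice_pt_unit by blast
  then obtain g where "rotation_matrix g" "slice_pt s x = cj g (slice_pt s ?y)"
    unfolding slice_pt_apex by (auto simp: orbit_eq b_vec_in_unit_bivectors)
  then show thesis using core_fixes_K_side[of g ?y x s] x y(1) that by simp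
qed

lemma slice_pt_apex_1: "slice_pt s (slice_apex s) = b_vec meeting_angle"
  using slice_pt_apex[of s 1] tube_angle_1 by simp

lemma slice_rep_apex_eq_iff:
  assumes "k \<in> K_side s" "l \<in> K_side s"
  shows "slice_rep s k *v slice_apex s = slice_rep s l *v slice_apex s \<longleftrightarrow>
    cj k (b_vec meeting_angle) = cj l (b_vec meeting_angle)"
  using slice_pt_slice_rep[OF assms(1), of "slice_apex s"] slice_pt_slice_rep[OF assms(2), of "slice_apex s"]
  by (metis slice_inv_slice_pt slice_pt_apex_1)

lemma group_K_side: "group (SO5\<lparr>carrier := K_side s\<rparr>)"
proof -
  interpret group_action SO5 unit_bivectors conj_action by (rule group_action_SO5)
  have "subgroup (K_side s) SO5"
    unfolding isotropy_singular[symmetric] by (rule stabilizer_subgroup) (rule b_vec_in_unit_bivectors)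
  then show ?thesis by (rule subgroup.subgroup_is_group) (rule group_SO5)
qed

lemma disk_representation_slice_rep: "disk_representation (K_side s) T2 (slice_rep s) (slice_apex s)"
  unfolding disk_representation_def
proof (intro conjI)
  let ?G = "SO5\<lparr>carrier := K_side s\<rparr>"
  show "group_action ?G (cball 0 1) (linear_disk_action (slice_rep s))"
    unfolding linear_disk_action_def[abs_def]
    by (rule group_action_subgroup_SO5I[OF group_K_side])
      (use K_side_rotation in \<open>auto simp: slice_rep_norm slice_rep_mult slice_rep_1\<close>)
  show "smooth_on (K_side s) (slice_rep s)" by (rule smooth_on_slice_rep)
  show v: "slice_apex s \<in> sphere 0 1" by (rule slice_apex_sphere)
  have a: "linear_disk_action (slice_rep s) k (slice_apex s) = slice_rep s k *v slice_apex s" for k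
    using v by (simp add: linear_disk_action_def)
  show "orbit ?G (linear_disk_action (slice_rep s)) (slice_apex s) = sphere 0 1"
  proof
    show "orbit ?G (linear_disk_action (slice_rep s)) (slice_apex s) \<subseteq> sphere 0 1"
      using v by (auto simp: orbit_def a slice_rep_norm)
    show "sphere 0 1 \<subseteq> orbit ?G (linear_disk_action (slice_rep s)) (slice_apex s)"
    proof
      fix x :: "real^3" assume "x \<in> sphere 0 1"
      then show "x \<in> orbit ?G (linear_disk_action (slice_rep s)) (slice_apex s)"
        using slice_transitive[of x s] by (auto simp: orbit_def a)
    qed
  qed
  show "stabilizer ?G (linear_disk_action (slice_rep s)) (slice_apex s) = T2"
    using slice_rep_apex_eq_iff[OF _ K_side_1, of _ s] T2_subset_K_side[of s]
    by (auto simp: stabilizer_def a slice_rep_1 T2_iff K_side_rotation)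
qed

text \<open>The boundary sphere of the slice lies in the orbit at \<open>meeting_angle\<close>, and a local section of the orbit
  map of \<open>SO(5)\<close> there takes values in \<open>K\<close> when restricted to the sphere, because it connects two points
  of the slice.\<close>

lemma K_side_mod_T2_sphere:
  "diffeomorphic (homogeneous_space (K_side s) T2) (sub_diff (sphere (0 :: real^3) 1))"
proof -
  let ?q = "\<lambda>k. slice_rep s k *v slice_apex s"
  let ?O = "orbit SO5 conj_action (b_vec meeting_angle)"
  have sq: "smooth_on (K_side s) ?q"
    using smooth_on_slice_rep unfolding smooth_on_iff_smooth_at by (auto intro!: smooth_intros)
  have im: "?q ` K_side s = sphere 0 1"
  proof
    show "?q ` K_side s \<subseteq> sphere 0 1" using slice_apex_sphere[of s] by (auto simp: slice_rep_norm)
    show "sphere 0 1 \<subseteq> ?q ` K_side s"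
    proof
      fix x :: "real^3" assume "x \<in> sphere 0 1"
      then show "x \<in> ?q ` K_side s" using slice_transitive[of x s] by auto
    qed
  qed
  have ma: "meeting_angle \<in> {0..pi/4}" using meeting_angle_range by auto
  have fib: "k <#\<^bsub>SO5\<^esub> T2 = l <#\<^bsub>SO5\<^esub> T2 \<longleftrightarrow> ?q k = ?q l" if "k \<in> K_side s" "l \<in> K_side s" for k l
    using l_coset_eq_iff[OF b_vec_in_unit_bivectors, of k l meeting_angle] that
    unfolding slice_rep_apex_eq_iff[OF that] isotropy_generic[OF meeting_angle_range]
    by (simp add: K_side_rotation)
  have sec: "has_local_sections (K_side s) (sphere 0 1) ?q"
    unfolding has_local_sections_def
  proof
    fix w :: "real^3" assume w: "w \<in> sphere 0 1"
    have inO: "slice_pt s z \<in> ?O" if z: "z \<in> sphere 0 1" for z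
    proof -
      have "z \<in> ?q ` K_side s" unfolding im by (rule z)
      then obtain k where k: "k \<in> K_side s" "z = slice_rep s k *v slice_apex s" by blast
      then have "slice_pt s z = cj k (b_vec meeting_angle)"
        using slice_pt_slice_rep[of k s "slice_apex s"] slice_pt_apex_1 by simp
      then show ?thesis using k by (auto simp: orbit_eq b_vec_in_unit_bivectors K_side_rotation)
    qed
    obtain \<sigma> where \<sigma>: "smooth_at ?O (slice_pt s w) \<sigma>"
      "eventually (\<lambda>y. \<sigma> y \<in> carrier SO5 \<and> cj (\<sigma> y) (b_vec meeting_angle) = y) (near ?O (slice_pt s w))"
      using has_local_sections_b_vec[OF ma] inO[OF w] unfolding has_local_sections_def by blast
    have ev: "eventually (\<lambda>z. slice_pt s z \<in> ?O) (near (sphere 0 1) w)"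
      using inO by (intro near_everyI)
    have sp: "smooth_at (sphere 0 1) w (slice_pt s)"
      using w by (intro smooth_at_slice_pt smooth_intros)
    have "smooth_at (sphere 0 1) w (\<lambda>z. \<sigma> (slice_pt s z))"
      using \<sigma>(1) sp w ev by (rule smooth_at_compose)
    moreover have "eventually (\<lambda>z. \<sigma> (slice_pt s z) \<in> carrier SO5 \<and>
        cj (\<sigma> (slice_pt s z)) (b_vec meeting_angle) = slice_pt s z) (near (sphere 0 1) w)"
      by (rule eventually_near_compose[OF \<sigma>(2) sp w ev])
    then have "eventually (\<lambda>z. \<sigma> (slice_pt s z) \<in> K_side s \<and> ?q (\<sigma> (slice_pt s z)) = z) (near (sphere 0 1) w)"
      using eventually_near_mem[of "sphere 0 1" w]
    proof eventually_elim
      case (elim z)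
      then show ?case
        using core_fixes_K_side[of "\<sigma> (slice_pt s z)" "slice_apex s" z s] slice_apex_sphere[of s]
        by (simp add: slice_pt_apex_1)
    qed
    ultimately show "\<exists>\<tau>. smooth_at (sphere 0 1) w \<tau> \<and> eventually (\<lambda>z. \<tau> z \<in> K_side s \<and> ?q (\<tau> z) = z) (near (sphere 0 1) w)"
      by blast
  qed
  show ?thesis
    by (rule diffeomorphism_quotient_diff_ex[OF sq im sec fib])
      (auto simp: diffeomorphic_def homogeneous_space_def)
qed


section \<open>The disk bundles and their union\<close>

definition tube_map :: "side \<Rightarrow> (real^5^5) \<times> (real^3) \<Rightarrow> real^5^5" where
  "tube_map s = (\<lambda>(g, x). cj g (slice_pt s x))"

abbreviation tube_source :: "((real^5^5) \<times> (real^3)) set" where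
  "tube_source \<equiv> carrier SO5 \<times> cball 0 1"

abbreviation slice_assoc :: "side \<Rightarrow> (real^5^5) \<times> (real^3) \<Rightarrow> ((real^5^5) \<times> (real^3)) set" where
  "slice_assoc s \<equiv> assoc_point (K_side s) (slice_rep s)"

lemma tube_map_unit: "p \<in> tube_source \<Longrightarrow> tube_map s p \<in> unit_bivectors"
  by (auto simp: tube_map_def cj_unit_bivectors slice_pt_unit)

lemma smooth_on_tube_map: "smooth_on S (tube_map s)"
  unfolding smooth_on_iff_smooth_at tube_map_def case_prod_unfold cj_def
  by (auto intro!: smooth_intros smooth_at_slice_pt)

lemma slice_pt_normal_form:
  assumes "x \<in> cball 0 1"
  obtains k where "k \<in> K_side s" "slice_pt s x = cj k (b_vec (tube_angle s (norm x)))"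
    "x = slice_rep s k *v (norm x *\<^sub>R slice_apex s)"
  using slice_transitive[OF assms, of s] slice_pt_slice_rep slice_pt_apex by metis

lemma orbit_angle_tube_map:
  assumes "(g, x) \<in> tube_source"
  shows "orbit_angle (tube_map s (g, x)) = tube_angle s (norm x)"
proof -
  obtain k where "k \<in> K_side s" "slice_pt s x = cj k (b_vec (tube_angle s (norm x)))"
    using slice_pt_normal_form[of x s] assms by blast
  moreover have "tube_angle s (norm x) \<in> {0..pi/4}" using assms by (intro tube_angle_range') auto
  ultimately show ?thesis
    using assms by (simp add: tube_map_def orbit_angle_cj K_side_rotation orbit_angle_b_vec)
qed

text \<open>The disk bundle embeds: if \<open>g \<cdot> p = h \<cdot> q\<close> for points \<open>p\<close>, \<open>q\<close> of the slice, then \<open>g\<^sup>-\<^sup>1 h\<close> connects two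
  points of the slice and lies in \<open>K\<close>.\<close>

lemma slice_assoc_eq_iff:
  assumes "p \<in> tube_source" "p' \<in> tube_source"
  shows "slice_assoc s p = slice_assoc s p' \<longleftrightarrow> tube_map s p = tube_map s p'"
proof -
  obtain g x g' x' where p: "p = (g, x)" "p' = (g', x')" by (metis prod.exhaust)
  have r: "rotation_matrix g" "rotation_matrix g'" "x \<in> cball 0 1" "x' \<in> cball 0 1"
    using assms p by auto
  have inv: "matrix_inv k = transpose k" if "k \<in> K_side s" for k
    using that by (simp add: K_side_rotation matrix_inv_rotation)
  have sub: "slice_assoc s (g, x) \<subseteq> slice_assoc s (h, y)"
    if gh: "rotation_matrix g" "rotation_matrix h" "x \<in> cball 0 1" "y \<in> cball 0 1"
      and eq: "cj g (slice_pt s x) = cj h (slice_pt s y)" for g h x y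
  proof
    let ?k = "transpose g ** h"
    have "cj ?k (slice_pt s y) = slice_pt s x"
      using gh eq cj_inverse(1)[of g "slice_pt s x"] by (simp add: cj_cj[symmetric])
    then have k: "?k \<in> K_side s" "x = slice_rep s ?k *v y"
      using core_fixes_K_side[of ?k y x s] gh by (simp_all add: rotation_matrix_mult rotation_matrix_transpose)
    fix q assume "q \<in> slice_assoc s (g, x)"
    then obtain l where l: "l \<in> K_side s" "q = (g ** transpose l, slice_rep s l *v x)"
      by (auto simp: assoc_point_def inv)
    have "q = (h ** transpose (l ** ?k), slice_rep s (l ** ?k) *v y)"
    proof -
      have "h ** transpose (l ** ?k) = g ** transpose l"
        using gh by (simp add: matrix_transpose_mul matrix_mul_assoc SO5_D)
      then show ?thesis using slice_rep_mult[OF l(1) k(1), of y] k(2) l(2) by simp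
    qed
    then have "q = (h ** matrix_inv (l ** ?k), slice_rep s (l ** ?k) *v y)"
      by (simp only: inv[OF K_side_mult[OF l(1) k(1)]])
    then show "q \<in> slice_assoc s (h, y)"
      unfolding assoc_point_def case_prod_conv using K_side_mult[OF l(1) k(1)] by blast
  qed
  show ?thesis unfolding p
  proof
    assume eq: "slice_assoc s (g, x) = slice_assoc s (g', x')"
    have "(g, x) \<in> slice_assoc s (g, x)"
      using K_side_1[of s] by (auto simp: assoc_point_def inv slice_rep_1 intro!: exI[of _ "mat 1"])
    then obtain k where k: "k \<in> K_side s" "g = g' ** transpose k" "x = slice_rep s k *v x'"
      unfolding eq by (auto simp: assoc_point_def inv)
    then have "cj g (slice_pt s x) = cj (g' ** transpose k ** k) (slice_pt s x')"
      by (simp add: slice_pt_slice_rep cj_cj)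
    then show "tube_map s (g, x) = tube_map s (g', x')"
      using k(1) by (simp add: tube_map_def K_side_rotation)
  next
    assume "tube_map s (g, x) = tube_map s (g', x')"
    then show "slice_assoc s (g, x) = slice_assoc s (g', x')"
      using sub[of g g' x x'] sub[of g' g x' x] r by (auto simp: tube_map_def)
  qed
qed

text \<open>The retraction to the singular orbit, followed by a local section \<open>\<sigma>\<close> of its orbit map, gives the
  group component \<open>g z\<close>; the point \<open>g z\<^sup>-\<^sup>1 \<cdot> z\<close> then lies in the slice and gives the other component.\<close>

lemma tube_map_local_sections: "has_local_sections tube_source (tube_map s ` tube_source) (tube_map s)"
  unfolding has_local_sections_def
proof
  let ?D = "tube_map s ` tube_source" and ?O = "orbit SO5 conj_action (singular_vec s)"
  fix y assume y: "y \<in> ?D"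
  have c: "core s z \<in> ?O \<and> quartic z \<in> core_domain s \<and> core_poly s z \<noteq> 0" if z: "z \<in> ?D" for z
  proof -
    obtain g x where z: "rotation_matrix g" "x \<in> cball 0 1" "z = cj g (slice_pt s x)"
      using z by (auto simp: tube_map_def)
    have "singular_vec s \<noteq> 0" using singular_vec_unit[of s] by (auto simp: biv_inner_def)
    then have "core_poly s (slice_pt s x) \<noteq> 0" using core_poly_slice_pt(2)[OF z(2), of s] by auto
    then have "core_poly s z \<noteq> 0" unfolding z(3) core_poly_cj[OF z(1)]
      using cj_inverse(1)[OF z(1), of "core_poly s (slice_pt s x)"] by (auto simp: cj_def)
    then show ?thesis using z core_poly_slice_pt(1)[OF z(2), of s]
      by (auto simp: core_cj core_slice_pt orbit_eq b_vec_in_unit_bivectors quartic_cj)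
  qed
  have sc: "smooth_at ?D y (core s)"
    using c[OF y] y by (intro smooth_at_core smooth_at_ident) auto
  have ec: "eventually (\<lambda>z. core s z \<in> ?O) (near ?D y)" using c by (intro near_everyI) auto
  obtain \<sigma> where \<sigma>: "smooth_at ?O (core s y) \<sigma>"
    "eventually (\<lambda>z. \<sigma> z \<in> carrier SO5 \<and> cj (\<sigma> z) (singular_vec s) = z) (near ?O (core s y))"
    using has_local_sections_b_vec[OF singular_angle_range, of s] c[OF y] unfolding has_local_sections_def by blast
  define g where "g z = \<sigma> (core s z)" for z
  define w where "w z = cj (transpose (g z)) z" for z
  have sg: "smooth_at ?D y g"
    unfolding g_def using \<sigma>(1) sc y ec by (rule smooth_at_compose)
  have "eventually (\<lambda>z. g z \<in> carrier SO5 \<and> cj (g z) (singular_vec s) = core s z) (near ?D y)"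
    unfolding g_def by (rule eventually_near_compose[OF \<sigma>(2) sc y ec])
  then have ev: "eventually (\<lambda>z. rotation_matrix (g z) \<and> (\<exists>x\<in>cball 0 1. w z = slice_pt s x)) (near ?D y)"
    using eventually_near_mem[of ?D y]
  proof eventually_elim
    case (elim z)
    obtain h x where z: "rotation_matrix h" "x \<in> cball 0 1" "z = cj h (slice_pt s x)"
      using elim(2) by (auto simp: tube_map_def)
    let ?k = "transpose (g z) ** h"
    have "cj (g z) (singular_vec s) = cj h (singular_vec s)"
      using elim(1) z by (simp add: core_cj core_slice_pt)
    then have "cj ?k (singular_vec s) = singular_vec s"
      using elim(1) cj_inverse(1)[of "g z" "singular_vec s"] by (simp add: cj_cj[symmetric])
    then have k: "?k \<in> K_side s"
      using elim(1) z by (simp add: K_side_iff rotation_matrix_mult rotation_matrix_transpose)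
    have "w z = slice_pt s (slice_rep s ?k *v x)"
      unfolding slice_pt_slice_rep[OF k] by (simp add: w_def cj_cj[symmetric]) (simp add: z)
    moreover have "slice_rep s ?k *v x \<in> cball 0 1" using z k by (simp add: slice_rep_norm)
    ultimately show ?case using elim(1) by auto
  qed
  from eventually_near_self[OF this y] obtain x where "w y = slice_pt s x" by blast
  then have n: "biv_inner (w y) (singular_vec s) \<noteq> 0"
    using slice_denominator_pos[of s x] by (simp add: biv_inner_slice_pt)
  have "smooth_at ?D y (\<lambda>z. slice_inv s (w z))"
    using y n unfolding w_def cj_def by (intro smooth_at_slice_inv smooth_intros sg)
  with sg have "smooth_at ?D y (\<lambda>z. (g z, slice_inv s (w z)))" by (rule smooth_at_Pair)
  moreover have "eventually (\<lambda>z. (g z, slice_inv s (w z)) \<in> tube_source \<and> tube_map s (g z, slice_inv s (w z)) = z) (near ?D y)"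
    using ev
  proof eventually_elim
    case (elim z)
    then obtain x where x: "x \<in> cball 0 1" "w z = slice_pt s x" by blast
    then have "cj (g z) (slice_pt s x) = z" using elim by (simp add: w_def flip: x(2))
    then show ?case using x elim by (simp add: tube_map_def)
  qed
  ultimately show "\<exists>\<sigma>. smooth_at ?D y \<sigma> \<and> eventually (\<lambda>z. \<sigma> z \<in> tube_source \<and> tube_map s (\<sigma> z) = z) (near ?D y)"
    by blast
qed

lemma continuous_map_sum_topology:
  assumes "\<And>i. i \<in> I \<Longrightarrow> continuous_map (X i) Y (\<lambda>x. f (i, x))"
  shows "continuous_map (sum_topology X I) Y f"
  using assms unfolding continuous_map_def openin_sum_topology
  by (auto simp: Pi_iff)

lemma compact_space_sum_topology:
  assumes "finite I" "\<And>i. i \<in> I \<Longrightarrow> compact_space (X i)"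
  shows "compact_space (sum_topology X I)"
proof -
  have "compactin (sum_topology X I) (\<Union>i\<in>I. Pair i ` topspace (X i))"
    using assms by (intro compactin_Union)
      (auto simp: compact_space_def intro!: image_compactin continuous_map_component_injection)
  moreover have "(\<Union>i\<in>I. Pair i ` topspace (X i)) = topspace (sum_topology X I)" by auto
  ultimately show ?thesis by (simp add: compact_space_def)
qed

lemma compact_space_quotient_topology: "compact_space X \<Longrightarrow> compact_space (quotient_topology X p)"
  using image_compactin[OF _ quotient_imp_continuous_map[OF quotient_map_quotient_topology], of X "topspace X" p]
  by (simp add: compact_space_def)

text \<open>\<open>F\<close> is the union of the two tubes on the disjoint sum of the disk bundles.  Its fibres are the classes
  of the gluing relation, since points of different tubes have the same image only on the orbit at
  \<open>meeting_angle\<close>; hence it descends to an injective map \<open>\<Phi>\<close> on the glued space, which is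
  a homeomorphism by compactness.\<close>

lemma double_disk_decomposition_slices: "double_disk_decomposition slice_rep slice_apex unit_bivectors"
proof -
  let ?G = "glue slice_rep slice_apex"
  let ?X = "sum_topology (\<lambda>s. disk_bundle_topology (K_side s) (slice_rep s)) UNIV"
  define R where "R = (\<lambda>x y. \<exists>g\<in>carrier SO5. x = (Minus, slice_assoc Minus (g, slice_apex Minus)) \<and>
       y = (Plus, slice_assoc Plus (g, slice_apex Plus)))"
  have G: "?G e = {q. equivclp R e q}" for e by (simp add: glue_def R_def)
  have Gi: "?G e = ?G e' \<longleftrightarrow> equivclp R e e'" for e e'
  proof
    assume "?G e = ?G e'"
    moreover have "e' \<in> ?G e'" by (simp add: G)
    ultimately show "equivclp R e e'" by (metis G mem_Collect_eq)
  next
    assume "equivclp R e e'"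
    then have "equivclp R e q \<longleftrightarrow> equivclp R e' q" for q
      by (meson equivclp_sym equivclp_trans)
    then show "?G e = ?G e'" by (simp add: G)
  qed
  have "\<exists>\<phi>. \<forall>p\<in>tube_source. \<phi> (slice_assoc s p) = tube_map s p" for s
  proof (rule diffeomorphism_quotient_diff_ex[OF smooth_on_tube_map[of tube_source s] refl tube_map_local_sections slice_assoc_eq_iff])
    fix \<phi> :: "((real^5^5) \<times> (real^3)) set \<Rightarrow> real^5^5"
    assume "\<And>p. p \<in> tube_source \<Longrightarrow> \<phi> (slice_assoc s p) = tube_map s p"
    then show "\<exists>\<phi>. \<forall>p\<in>tube_source. \<phi> (slice_assoc s p) = tube_map s p" by blast
  qed
  then obtain \<phi> where \<phi>: "\<And>s p. p \<in> tube_source \<Longrightarrow> \<phi> s (slice_assoc s p) = tube_map s p" by metis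
  define F where "F = (\<lambda>(s, c). \<phi> s c)"
  have F: "F (s, slice_assoc s p) = tube_map s p" if "p \<in> tube_source" for s p
    using that by (simp add: F_def \<phi>)
  have apex: "(g, slice_apex s) \<in> tube_source" if "rotation_matrix g" for g s
    using slice_apex_sphere[of s] that by simp
  have apex': "tube_map s (g, slice_apex s) = cj g (b_vec meeting_angle)" for s g
    by (simp add: tube_map_def slice_pt_apex_1)
  have RF: "F e = F e'" if "R e e'" for e e'
  proof -
    obtain g where g: "rotation_matrix g" "e = (Minus, slice_assoc Minus (g, slice_apex Minus))"
      "e' = (Plus, slice_assoc Plus (g, slice_apex Plus))"
      using \<open>R e e'\<close> by (auto simp: R_def simp del: K_side.simps slice_apex.simps)
    show ?thesis unfolding g(2,3) F[OF apex[OF g(1)]] apex' ..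
  qed
  have Fe: "F e = F e'" if "equivclp R e e'" for e e'
    using that by (induction rule: equivclp_induct) (auto dest: RF)
  have tX: "topspace ?X = (SIGMA s:UNIV. slice_assoc s ` tube_source)"
    by (auto simp: disk_bundle_topology_def)
  have Xc: "\<exists>s p. d = (s, slice_assoc s p) \<and> p \<in> tube_source" if "d \<in> topspace ?X" for d
    using that unfolding tX by blast
  \<comment> \<open>Comparison of the angles forces both points onto the boundary spheres.\<close>
  have meet: "equivclp R (Minus, slice_assoc Minus p) (Plus, slice_assoc Plus p')"
    if p: "p \<in> tube_source" "p' \<in> tube_source" and eq: "tube_map Minus p = tube_map Plus p'" for p p'
  proof -
    obtain g x g' x' where pp: "p = (g, x)" "p' = (g', x')" by (metis prod.exhaust)
    have r: "rotation_matrix g" "rotation_matrix g'" "x \<in> cball 0 1" "x' \<in> cball 0 1"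
      using p pp by auto
    have a: "tube_angle Minus (norm x) = tube_angle Plus (norm x')"
      using eq p unfolding pp by (metis orbit_angle_tube_map)
    moreover have "tube_angle Minus (norm x) \<le> meeting_angle" "meeting_angle \<le> tube_angle Plus (norm x')"
      using tube_angle_range[of "norm x" Minus] tube_angle_range[of "norm x'" Plus] r by auto
    ultimately have ta: "tube_angle Minus (norm x) = meeting_angle" "tube_angle Plus (norm x') = meeting_angle" by auto
    then have n: "norm x = 1" "norm x' = 1"
      using tube_angle_inj[of Minus "norm x" 1] tube_angle_inj[of Plus "norm x'" 1] unfolding tube_angle_1 by auto
    obtain k where k: "k \<in> K_side Minus" "slice_pt Minus x = cj k (b_vec meeting_angle)"
      using slice_pt_normal_form[OF r(3), of Minus] unfolding ta by blast
    let ?h = "g ** k"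
    have h: "rotation_matrix ?h" using r(1) K_side_rotation[OF k(1)] by (rule rotation_matrix_mult)
    have "tube_map Minus p = tube_map Minus (?h, slice_apex Minus)"
      "tube_map Plus p' = tube_map Plus (?h, slice_apex Plus)"
    proof -
      have "tube_map Minus p = cj g (cj k (b_vec meeting_angle))" by (simp add: pp tube_map_def k(2))
      then show "tube_map Minus p = tube_map Minus (?h, slice_apex Minus)"
        "tube_map Plus p' = tube_map Plus (?h, slice_apex Plus)"
        unfolding eq[symmetric] apex' cj_cj by auto
    qed
    then have "slice_assoc Minus p = slice_assoc Minus (?h, slice_apex Minus)"
      "slice_assoc Plus p' = slice_assoc Plus (?h, slice_apex Plus)"
      using slice_assoc_eq_iff p apex[OF h] by blast+
    then have "R (Minus, slice_assoc Minus p) (Plus, slice_assoc Plus p')"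
      using h by (auto simp: R_def)
    then show ?thesis by (rule r_into_equivclp)
  qed
  have GF: "?G e = ?G e' \<longleftrightarrow> F e = F e'" if "e \<in> topspace ?X" "e' \<in> topspace ?X" for e e'
  proof
    show "?G e = ?G e' \<Longrightarrow> F e = F e'" using Gi Fe by blast
    note e_mem = that
    obtain s p s' p' where e: "e = (s, slice_assoc s p)" "p \<in> tube_source" "e' = (s', slice_assoc s' p')" "p' \<in> tube_source"
      using Xc[OF e_mem(1)] Xc[OF e_mem(2)] by (elim exE conjE) (rule that)
    assume "F e = F e'"
    then have eq: "tube_map s p = tube_map s' p'" using e F by simp
    have "equivclp R e e'"
    proof (cases "s = s'")
      case True
      then show ?thesis using e eq slice_assoc_eq_iff[of p p' s] by simp
    next
      case False
      then have "s = Minus \<and> s' = Plus \<or> s = Plus \<and> s' = Minus" by (metis side.exhaust)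
      then show ?thesis using e eq meet[of p p'] meet[of p' p] equivclp_sym by fastforce
    qed
    then show "?G e = ?G e'" using Gi by blast
  qed
  have contF: "continuous_map ?X (top_of_set unit_bivectors) F"
  proof (rule continuous_map_sum_topology)
    fix s
    have "continuous_map (top_of_set tube_source) (top_of_set unit_bivectors) ((\<lambda>c. F (s, c)) \<circ> slice_assoc s)"
    proof (rule continuous_map_eq)
      show "continuous_map (top_of_set tube_source) (top_of_set unit_bivectors) (tube_map s)"
        using smooth_on_imp_continuous_on[OF smooth_on_tube_map] tube_map_unit by auto
    qed (use F in auto)
    then show "continuous_map (disk_bundle_topology (K_side s) (slice_rep s)) (top_of_set unit_bivectors) (\<lambda>c. F (s, c))"
      unfolding disk_bundle_topology_def
      by (rule continuous_compose_quotient_map[OF quotient_map_quotient_topology])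
  qed
  have qG: "quotient_map ?X (double_disk_topology slice_rep slice_apex) ?G"
    unfolding double_disk_topology_def by (rule quotient_map_quotient_topology)
  have "\<exists>\<Phi>. continuous_map (double_disk_topology slice_rep slice_apex) (top_of_set unit_bivectors) \<Phi> \<and>
    \<Phi> ` topspace (double_disk_topology slice_rep slice_apex) = F ` topspace ?X \<and>
    (\<forall>e\<in>topspace ?X. \<Phi> (?G e) = F e)"
  proof (rule quotient_map_lift_exists[OF qG contF])
    fix e e' assume "e \<in> topspace ?X" "e' \<in> topspace ?X" "?G e = ?G e'"
    then show "F e = F e'" using GF by blast
  qed blast
  then obtain \<Phi> where \<Phi>: "continuous_map (double_disk_topology slice_rep slice_apex) (top_of_set unit_bivectors) \<Phi>"
    "\<Phi> ` topspace (double_disk_topology slice_rep slice_apex) = F ` topspace ?X"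
    "\<And>e. e \<in> topspace ?X \<Longrightarrow> \<Phi> (?G e) = F e"
    by blast
  have \<Phi>': "\<Phi> (?G (s, slice_assoc s p)) = tube_map s p" if "p \<in> tube_source" for s p
    using \<Phi>(3)[of "(s, slice_assoc s p)"] that F unfolding tX by auto
  have tD: "topspace (double_disk_topology slice_rep slice_apex) = ?G ` topspace ?X"
    by (simp add: double_disk_topology_def)
  have "inj_on \<Phi> (topspace (double_disk_topology slice_rep slice_apex))"
    unfolding tD inj_on_def using \<Phi>(3) GF by auto
  moreover have "F ` topspace ?X = unit_bivectors"
  proof
    show "F ` topspace ?X \<subseteq> unit_bivectors" unfolding tX using F tube_map_unit by auto
    show "unit_bivectors \<subseteq> F ` topspace ?X"
    proof
      fix A assume "A \<in> unit_bivectors"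
      then obtain \<theta> g where A: "\<theta> \<in> {0..pi/4}" "rotation_matrix g" "A = cj g (b_vec \<theta>)"
        by (rule bivector_normal_form)
      have "\<exists>s. \<theta> \<in> (case s of Minus \<Rightarrow> {0..meeting_angle} | Plus \<Rightarrow> {meeting_angle..pi/4})"
        using A(1) by (cases "\<theta> \<le> meeting_angle") (auto intro: exI[of _ Minus] exI[of _ Plus])
      then obtain s t where t: "t \<in> {0..1}" "tube_angle s t = \<theta>" using tube_angle_surj by blast
      have p: "(g, t *\<^sub>R slice_apex s) \<in> tube_source" using A t slice_apex_sphere[of s] by simp
      have "A = F (s, slice_assoc s (g, t *\<^sub>R slice_apex s))"
        unfolding F[OF p] using A t by (simp add: tube_map_def slice_pt_apex)
      then show "A \<in> F ` topspace ?X" unfolding tX using p by blast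
    qed
  qed
  moreover have "compact_space (double_disk_topology slice_rep slice_apex)"
  proof -
    have "compact tube_source"
      using compact_SO5 by (intro compact_Times compact_cball) (simp add: SO5_def)
    then have "compact_space (disk_bundle_topology (K_side s) (slice_rep s))" for s
      unfolding disk_bundle_topology_def by (intro compact_space_quotient_topology) (simp add: compact_space_subtopology)
    moreover have "(UNIV :: side set) = {Minus, Plus}" using side.exhaust by auto
    then have "finite (UNIV :: side set)" by (metis finite.emptyI finite_insert)
    ultimately show ?thesis
      unfolding double_disk_topology_def by (intro compact_space_quotient_topology compact_space_sum_topology)
  qed
  then have "closed_map (double_disk_topology slice_rep slice_apex) (top_of_set unit_bivectors) \<Phi>"
    by (intro continuous_imp_closed_map_gen \<Phi>(1) Hausdorff_imp_kc_space)
      (simp_all add: Hausdorff_space_subtopology)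
  ultimately have "homeomorphic_map (double_disk_topology slice_rep slice_apex) (top_of_set unit_bivectors) \<Phi>"
    using \<Phi> by (intro bijective_closed_imp_homeomorphic_map) auto
  moreover have "diffeomorphism (disk_bundle (K_side s) (slice_rep s))
      (sub_diff ((\<lambda>c. \<Phi> (?G (s, c))) ` points (disk_bundle (K_side s) (slice_rep s)))) (\<lambda>c. \<Phi> (?G (s, c)))" for s
  proof -
    have "(\<lambda>c. \<Phi> (?G (s, c))) ` points (disk_bundle (K_side s) (slice_rep s)) = tube_map s ` tube_source"
      using \<Phi>' by (simp add: disk_bundle_def quotient_diff_def image_image)
    then show ?thesis
      unfolding disk_bundle_def
      using diffeomorphism_quotient_diff[OF smooth_on_tube_map refl tube_map_local_sections slice_assoc_eq_iff \<Phi>'] by simp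
  qed
  moreover have "\<Phi> (?G (s, slice_assoc s (h ** g, x))) = conj_action h (\<Phi> (?G (s, slice_assoc s (g, x))))"
    if "h \<in> carrier SO5" "g \<in> carrier SO5" "x \<in> cball 0 1" for s h g x
  proof -
    have "(g, x) \<in> tube_source" "(h ** g, x) \<in> tube_source" using that by (auto intro: rotation_matrix_mult)
    then show ?thesis using conj_action_eq[OF tube_map_unit] by (simp add: \<Phi>') (simp add: tube_map_def cj_cj)
  qed
  ultimately show ?thesis
    unfolding double_disk_decomposition_def Let_def by blast
qed


section \<open>The orbit of simple bivectors as the oriented Grassmannian\<close>

lemma wedge_apply: "wedge u v *v x = (v \<bullet> x) *\<^sub>R u - (u \<bullet> x) *\<^sub>R v"
  by (simp add: vec_eq_iff wedge_def matrix_vector_mult_def inner_vec_def sum_5 algebra_simps)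

lemma wedge_bivectors: "wedge u v \<in> bivectors"
  by (simp add: bivectors_def wedge_def transpose_def vec_eq_iff)

lemma rotation_inner: "rotation_matrix g \<Longrightarrow> (g *v u) \<bullet> (g *v w) = u \<bullet> w" for g :: "real^'n^'n"
proof -
  assume g: "rotation_matrix g"
  have "(g *v w) \<bullet> (g *v u) = (transpose g *v (g *v w)) \<bullet> u"
    by (simp add: dot_lmul_matrix[symmetric])
  then show ?thesis using g
    by (simp add: matrix_vector_mul_assoc SO5_D inner_commute del: transpose_matrix_vector)
qed

lemma b_vec_0_wedge: "b_vec 0 = wedge (e_vec 1) (e_vec 2)"
  by (simp add: b_vec_def)

lemma wedge_mult: "wedge u v ** wedge u v = (\<chi> i j. (u \<bullet> v) * (u$i * v$j + v$i * u$j) - (v \<bullet> v) * (u$i * u$j) - (u \<bullet> u) * (v$i * v$j))"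
  by (simp add: vec_eq_iff matrix_matrix_mult_def wedge_def inner_vec_def sum_5 algebra_simps)

lemma inner_outer_product: "(\<chi> i j. u$i * v$j) \<bullet> (\<chi> i j. x$i * y$j) = (u \<bullet> x) * (v \<bullet> y)"
  for u x :: "real^'m" and v y :: "real^'n"
  by (simp add: inner_vec_def sum_product algebra_simps)

text \<open>With \<open>u \<and> v\<close> of norm \<open>1\<close> this is the value \<open>2\<close> of the invariant at \<open>e\<^sub>1\<^sub>2\<close>: the simple unit bivectors
  form the orbit at \<open>\<theta> = 0\<close>.\<close>

lemma quartic_wedge: "quartic (wedge u v) = 2 * (biv_inner (wedge u v) (wedge u v))\<^sup>2"
proof -
  let ?t = "\<lambda>(u :: real^5) (v :: real^5). (\<chi> i j. u$i * v$j) :: real^5^5"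
  have sq: "wedge u v ** wedge u v = (u \<bullet> v) *\<^sub>R (?t u v + ?t v u) - (v \<bullet> v) *\<^sub>R ?t u u - (u \<bullet> u) *\<^sub>R ?t v v"
    unfolding wedge_mult by (simp add: vec_eq_iff)
  show ?thesis
    unfolding quartic_def sq biv_inner_wedge
    by (simp add: inner_add_left inner_add_right inner_diff_left inner_diff_right inner_outer_product inner_commute)
      (simp add: power2_eq_square algebra_simps)
qed

lemma quartic_b_vec_0: "quartic (b_vec 0) = 2"
  by (simp add: quartic_b_vec)

lemma quartic_b_vec_pi_4: "quartic (b_vec (pi/4)) = 1"
  by (simp add: quartic_b_vec)

lemma orthonormal_pairs_iff: "(u, v) \<in> orthonormal_pairs \<longleftrightarrow> u \<bullet> u = 1 \<and> v \<bullet> v = 1 \<and> u \<bullet> v = 0"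
  by (simp add: orthonormal_pairs_def norm_eq_1)

lemma wedge_image: "(\<lambda>(u, v). wedge u v) ` orthonormal_pairs = orbit SO5 conj_action (b_vec 0)"
proof
  show "(\<lambda>(u, v). wedge u v) ` orthonormal_pairs \<subseteq> orbit SO5 conj_action (b_vec 0)"
    by (auto simp: orthonormal_pairs_iff in_orbit_b_vec_iff quartic_b_vec_0 quartic_wedge
        unit_bivectors_def wedge_bivectors biv_inner_wedge)
  show "orbit SO5 conj_action (b_vec 0) \<subseteq> (\<lambda>(u, v). wedge u v) ` orthonormal_pairs"
  proof
    fix A assume "A \<in> orbit SO5 conj_action (b_vec 0)"
    then obtain g where g: "rotation_matrix g" "A = cj g (b_vec 0)" by (auto simp: orbit_eq b_vec_in_unit_bivectors)
    then have "A = wedge (g *v e_vec 1) (g *v e_vec 2)" by (simp add: b_vec_0_wedge cj_def conj_wedge)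
    moreover have "(g *v e_vec 1, g *v e_vec 2) \<in> orthonormal_pairs"
      using g by (simp add: orthonormal_pairs_iff rotation_inner e_vec_inner)
    ultimately show "A \<in> (\<lambda>(u, v). wedge u v) ` orthonormal_pairs" by force
  qed
qed

text \<open>The oriented plane is recovered from the bivector: it is the image of \<open>u \<and> v\<close>, oriented by
  \<open>\<langle>x, (u \<and> v) y\<rangle> > 0\<close>.\<close>

lemma oriented_plane_range:
  assumes "(u, v) \<in> orthonormal_pairs"
  shows "oriented_plane (u, v) = {(x, y) \<in> orthonormal_pairs. span {x, y} = range ((*v) (wedge u v)) \<and>
     x \<bullet> (wedge u v *v y) > 0}"
proof -
  have uv: "u \<bullet> u = 1" "v \<bullet> v = 1" "u \<bullet> v = 0" using assms by (simp_all add: orthonormal_pairs_iff)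
  have "range ((*v) (wedge u v)) = span {u, v}"
  proof
    show "range ((*v) (wedge u v)) \<subseteq> span {u, v}"
      by (auto simp: wedge_apply intro!: span_diff span_scale) (auto intro: span_base)
    have e: "u = wedge u v *v v" "v = wedge u v *v (- u)" using uv by (simp_all add: wedge_apply inner_commute)
    have "u \<in> range ((*v) (wedge u v))" "v \<in> range ((*v) (wedge u v))"
      using range_eqI[of u "(*v) (wedge u v)", OF e(1)] range_eqI[of v "(*v) (wedge u v)", OF e(2)] by simp_all
    moreover have "subspace (range ((*v) (wedge u v)))"
      using matrix_vector_mul_linear by (rule linear_subspace_image[OF _ subspace_UNIV])
    ultimately show "span {u, v} \<subseteq> range ((*v) (wedge u v))"
      by (intro span_minimal) blast+
  qed
  then show ?thesis
    by (auto simp: oriented_plane_def wedge_apply inner_diff_right inner_commute mult.commute)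
qed

text \<open>The bivector \<open>u \<and> v\<close> of an orthonormal basis is the same for all positively oriented
  orthonormal bases of a plane, since it is multiplied by the determinant of a change of basis.\<close>

lemma oriented_plane_eq_iff:
  assumes uv: "(u, v) \<in> orthonormal_pairs" "(u', v') \<in> orthonormal_pairs"
  shows "oriented_plane (u, v) = oriented_plane (u', v') \<longleftrightarrow> wedge u v = wedge u' v'"
proof
  assume "wedge u v = wedge u' v'"
  then show "oriented_plane (u, v) = oriented_plane (u', v')" by (simp add: oriented_plane_range uv)
next
  note o = uv[unfolded orthonormal_pairs_iff]
  assume eq: "oriented_plane (u, v) = oriented_plane (u', v')"
  have "(u, v) \<in> oriented_plane (u, v)" using uv(1) o by (simp add: oriented_plane_def inner_commute)
  then have *: "span {u, v} = span {u', v'}" "(u' \<bullet> u) * (v' \<bullet> v) - (u' \<bullet> v) * (v' \<bullet> u) > 0"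
    unfolding eq by (simp_all add: oriented_plane_def)
  have "u \<in> span {u', v'}" "v \<in> span {u', v'}" unfolding *(1)[symmetric] by (simp_all add: span_base)
  then obtain a b c d where "u = a *\<^sub>R u' + b *\<^sub>R v'" "v = c *\<^sub>R u' + d *\<^sub>R v'"
    by (auto simp: span_insert span_singleton algebra_simps dest!: span_breakdown_eq[THEN iffD1])
  then have w: "wedge u v = (a * d - b * c) *\<^sub>R wedge u' v'"
    by (simp add: wedge_def vec_eq_iff algebra_simps)
  have "biv_inner (wedge u v) (wedge u v) = 1" "biv_inner (wedge u' v') (wedge u' v') = 1"
    using o by (simp_all add: biv_inner_wedge)
  then have "(a * d - b * c)\<^sup>2 = 1" unfolding w by (simp add: biv_inner_scaleR power2_eq_square)
  moreover have "a * d - b * c > 0"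
    using *(2) \<open>biv_inner (wedge u' v') (wedge u' v') = 1\<close> biv_inner_wedge[of u' v' u v]
    unfolding w by (simp add: biv_inner_scaleR)
  ultimately have "a * d - b * c = 1" by (simp add: power2_eq_1_iff)
  then show "wedge u v = wedge u' v'" using w by simp
qed

lemma homogeneous_space_minus_Grassmannian:
  "diffeomorphic (homogeneous_space (carrier SO5) (isotropy (b_vec 0))) oriented_Grassmannian"
proof -
  let ?q = "\<lambda>(u, v). wedge u v" and ?D = "orbit SO5 conj_action (b_vec 0)"
  have s: "smooth_on orthonormal_pairs ?q"
    unfolding smooth_on_iff_smooth_at
  proof
    fix p assume "p \<in> orthonormal_pairs"
    show "smooth_at orthonormal_pairs p ?q"
      by (rule smooth_at_vec, rule smooth_at_vec)
        (simp add: case_prod_unfold wedge_def, intro smooth_intros)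
  qed
  have sec: "has_local_sections orthonormal_pairs ?D ?q"
    unfolding has_local_sections_def
  proof
    fix y assume "y \<in> ?D"
    then obtain \<sigma> where \<sigma>: "smooth_at ?D y \<sigma>"
      "eventually (\<lambda>z. \<sigma> z \<in> carrier SO5 \<and> cj (\<sigma> z) (b_vec 0) = z) (near ?D y)"
      using has_local_sections_b_vec[of 0] by (auto simp: has_local_sections_def)
    have "smooth_at ?D y (\<lambda>z. (\<sigma> z *v e_vec 1, \<sigma> z *v e_vec 2))" by (intro smooth_intros \<sigma>)
    moreover have "eventually (\<lambda>z. (\<sigma> z *v e_vec 1, \<sigma> z *v e_vec 2) \<in> orthonormal_pairs \<and>
        ?q (\<sigma> z *v e_vec 1, \<sigma> z *v e_vec 2) = z) (near ?D y)"
      using \<sigma>(2) by eventually_elim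
        (auto simp: orthonormal_pairs_iff rotation_inner e_vec_inner b_vec_0_wedge cj_def conj_wedge)
    ultimately show "\<exists>\<sigma>. smooth_at ?D y \<sigma> \<and> eventually (\<lambda>z. \<sigma> z \<in> orthonormal_pairs \<and> ?q (\<sigma> z) = z) (near ?D y)"
      by blast
  qed
  have fib: "oriented_plane p = oriented_plane p' \<longleftrightarrow> ?q p = ?q p'"
    if "p \<in> orthonormal_pairs" "p' \<in> orthonormal_pairs" for p p'
    using that oriented_plane_eq_iff by (cases p, cases p') auto
  obtain \<psi> where \<psi>: "diffeomorphism oriented_Grassmannian (sub_diff ?D) \<psi>"
    unfolding oriented_Grassmannian_def
    using diffeomorphism_quotient_diff_ex[OF s wedge_image sec fib] by metis
  obtain \<phi> where \<phi>: "diffeomorphism (homogeneous_space (carrier SO5) (isotropy (b_vec 0))) (sub_diff ?D) \<phi>"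
    using orbit_is_homogeneous_b_vec[of 0] by (auto simp: orbit_is_homogeneous_def)
  show ?thesis
    using diffeomorphic_quotients_common_image \<phi> \<psi>
    unfolding homogeneous_space_def oriented_Grassmannian_def by blast
qed


section \<open>Half spinors: the second singular orbit as complex projective space\<close>

text \<open>The vector of the signed Pfaffians of the \<open>4 \<times> 4\<close> diagonal minors, that is, the Hodge dual of
  \<open>(a \<and> a) / 2\<close>.\<close>

definition pfaff :: "real^5^5 \<Rightarrow> real^5" where
  "pfaff a = vector
     [a$2$3 * a$4$5 - a$2$4 * a$3$5 + a$2$5 * a$3$4,
      - (a$1$3 * a$4$5 - a$1$4 * a$3$5 + a$1$5 * a$3$4),
      a$1$2 * a$4$5 - a$1$4 * a$2$5 + a$1$5 * a$2$4,
      - (a$1$2 * a$3$5 - a$1$3 * a$2$5 + a$1$5 * a$2$3),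
      a$1$2 * a$3$4 - a$1$3 * a$2$4 + a$1$4 * a$2$3]"

lemma pfaff_scaleR: "pfaff (r *\<^sub>R a) = r\<^sup>2 *\<^sub>R pfaff a"
  by (simp add: pfaff_def vec_eq_iff forall_5 power2_eq_square algebra_simps)

text \<open>The Hodge dual of the trivector \<open>a \<and> p\<close>.\<close>

definition star_pfaff :: "real^5^5 \<Rightarrow> real^5 \<Rightarrow> real^5^5" where
  "star_pfaff a p = biv
     (a$3$4 * p$5 - a$3$5 * p$4 + a$4$5 * p$3)
     (- a$2$4 * p$5 + a$2$5 * p$4 - a$4$5 * p$2)
     (a$2$3 * p$5 - a$2$5 * p$3 + a$3$5 * p$2)
     (- a$2$3 * p$4 + a$2$4 * p$3 - a$3$4 * p$2)
     (a$1$4 * p$5 - a$1$5 * p$4 + a$4$5 * p$1)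
     (- a$1$3 * p$5 + a$1$5 * p$3 - a$3$5 * p$1)
     (a$1$3 * p$4 - a$1$4 * p$3 + a$3$4 * p$1)
     (a$1$2 * p$5 - a$1$5 * p$2 + a$2$5 * p$1)
     (- a$1$2 * p$4 + a$1$4 * p$2 - a$2$4 * p$1)
     (a$1$2 * p$3 - a$1$3 * p$2 + a$2$3 * p$1)"

lemma pfaff_kernel:
  assumes "a \<in> bivectors" shows "a *v pfaff a = 0"
proof -
  obtain b c d e f g h i j k where a: "a = biv b c d e f g h i j k" using assms by (rule bivectors_cases)
  show ?thesis
    by (simp add: vec_eq_iff forall_5 matrix_vector_mult_def sum_5 a biv_def pfaff_def algebra_simps)
qed

lemma star_pfaff_pfaff:
  assumes "a \<in> bivectors"
  shows "star_pfaff a (pfaff a) = a ** a ** a + biv_inner a a *\<^sub>R a"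
proof -
  obtain b c d e f g h i j k where a: "a = biv b c d e f g h i j k" using assms by (rule bivectors_cases)
  show ?thesis
    unfolding a biv_inner_biv
    by (simp add: matrix_eq_iff_5 matrix_mult_nth_5 biv_def star_pfaff_def pfaff_def algebra_simps)
qed

text \<open>The adjugate of a skew-symmetric \<open>5 \<times> 5\<close> matrix is \<open>p p\<^sup>T\<close>, where \<open>p\<close> is its vector of Pfaffians, and the
  right-hand side is the adjugate expressed by the characteristic polynomial.\<close>

lemma pfaff_outer:
  assumes "a \<in> bivectors"
  shows "(\<chi> i j. pfaff a $ i * pfaff a $ j) = a ** (a ** a ** a) + biv_inner a a *\<^sub>R (a ** a) + (pfaff a \<bullet> pfaff a) *\<^sub>R mat 1"
proof -
  obtain b c d e f g h i j k where a: "a = biv b c d e f g h i j k" using assms by (rule bivectors_cases)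
  show ?thesis
    unfolding a biv_inner_biv
    by (simp add: matrix_eq_iff_5 matrix_mult_nth_5 biv_def pfaff_def inner_vec_def sum_5 mat_1_nth algebra_simps)
qed

text \<open>For \<open>a\<close> with \<open>a\<^sup>3 = - a\<close> and \<open>|a|\<^sup>2 = 2\<close>, put \<open>n = - pfaff a\<close>.  The hypotheses are the resulting
  quadratic relations: \<open>p\<close> the definition of \<open>n\<close>, \<open>g\<close> the identity \<open>n n\<^sup>T = 1 + a\<^sup>2\<close>, \<open>s\<close> the identity
  \<open>star (a \<and> n) = - a\<close>, \<open>k\<close> the equation \<open>a n = 0\<close>, and \<open>N\<close> the norm of \<open>n\<close>.  With \<open>N\<^sub>i\<close> and
  \<open>x\<^sub>i\<^sub>j + \<i> y\<^sub>i\<^sub>j\<close> the entries of a Hermitian \<open>4 \<times> 4\<close> matrix, the conclusions say that every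
  \<open>2 \<times> 2\<close> minor containing a diagonal entry vanishes; as the trace is \<open>4\<close>, the matrix has rank one.  Each minor is a linear
  combination, with constant coefficients, of the relations named in its proof.\<close>

lemma spin_minors:
  fixes a12 a13 a14 a15 a23 a24 a25 a34 a35 a45 n1 n2 n3 n4 n5
    N1 N2 N3 N4 x12 x13 x14 x23 x24 x34 y12 y13 y14 y23 y24 y34 :: real
  assumes
    p1: "a23 * a45 - a24 * a35 + a25 * a34 + n1 = 0"
    and p2: "- a13 * a45 + a14 * a35 - a15 * a34 + n2 = 0"
    and p3: "a12 * a45 - a14 * a25 + a15 * a24 + n3 = 0"
    and p4: "- a12 * a35 + a13 * a25 - a15 * a23 + n4 = 0"
    and p5: "a12 * a34 - a13 * a24 + a14 * a23 + n5 = 0"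
    and g11: "a12 * a12 + a13 * a13 + a14 * a14 + a15 * a15 + n1 * n1 - 1 = 0"
    and g13: "- a12 * a23 + a14 * a34 + a15 * a35 + n1 * n3 = 0"
    and g14: "- a12 * a24 - a13 * a34 + a15 * a45 + n1 * n4 = 0"
    and g15: "- a12 * a25 - a13 * a35 - a14 * a45 + n1 * n5 = 0"
    and g22: "a12 * a12 + a23 * a23 + a24 * a24 + a25 * a25 + n2 * n2 - 1 = 0"
    and g23: "a12 * a13 + a24 * a34 + a25 * a35 + n2 * n3 = 0"
    and g24: "a12 * a14 - a23 * a34 + a25 * a45 + n2 * n4 = 0"
    and g25: "a12 * a15 - a23 * a35 - a24 * a45 + n2 * n5 = 0"
    and g33: "a13 * a13 + a23 * a23 + a34 * a34 + a35 * a35 + n3 * n3 - 1 = 0"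
    and g35: "a13 * a15 + a23 * a25 - a34 * a45 + n3 * n5 = 0"
    and g44: "a14 * a14 + a24 * a24 + a34 * a34 + a45 * a45 + n4 * n4 - 1 = 0"
    and g45: "a14 * a15 + a24 * a25 + a34 * a35 + n4 * n5 = 0"
    and g55: "a15 * a15 + a25 * a25 + a35 * a35 + a45 * a45 + n5 * n5 - 1 = 0"
    and s12: "a34 * n5 - a35 * n4 + a45 * n3 + a12 = 0"
    and s13: "- a24 * n5 + a25 * n4 - a45 * n2 + a13 = 0"
    and s14: "a23 * n5 - a25 * n3 + a35 * n2 + a14 = 0"
    and s15: "- a23 * n4 + a24 * n3 - a34 * n2 + a15 = 0"
    and s23: "a14 * n5 - a15 * n4 + a45 * n1 + a23 = 0"
    and s24: "- a13 * n5 + a15 * n3 - a35 * n1 + a24 = 0"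
    and s25: "a13 * n4 - a14 * n3 + a34 * n1 + a25 = 0"
    and s34: "a12 * n5 - a15 * n2 + a25 * n1 + a34 = 0"
    and s35: "- a12 * n4 + a14 * n2 - a24 * n1 + a35 = 0"
    and s45: "a12 * n3 - a13 * n2 + a23 * n1 + a45 = 0"
    and k1: "a12 * n2 + a13 * n3 + a14 * n4 + a15 * n5 = 0"
    and k2: "- a12 * n1 + a23 * n3 + a24 * n4 + a25 * n5 = 0"
    and k3: "- a13 * n1 - a23 * n2 + a34 * n4 + a35 * n5 = 0"
    and k4: "- a14 * n1 - a24 * n2 - a34 * n3 + a45 * n5 = 0"
    and N: "n1 * n1 + n2 * n2 + n3 * n3 + n4 * n4 + n5 * n5 - 1 = 0"
    and d: "N1 = a12 - a34 + n5 + 1"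
      "N2 = - a12 + a34 + n5 + 1"
      "N3 = a12 + a34 - n5 + 1"
      "N4 = - a12 - a34 - n5 + 1"
      "x12 = - a14 + a23"
      "x13 = a35 + n4"
      "x14 = a15 - n2"
      "x23 = a15 + n2"
      "x24 = - a35 + n4"
      "x34 = a14 + a23"
      "y12 = a13 + a24"
      "y13 = a45 - n3"
      "y14 = - a25 - n1"
      "y23 = a25 - n1"
      "y24 = a45 + n3"
      "y34 = a13 - a24"
  shows "x12 * x12 + y12 * y12 = N1 * N2"
    "x12 * x13 + y12 * y13 = N1 * x23"
    "- y12 * x13 + x12 * y13 = N1 * y23"
    "x12 * x14 + y12 * y14 = N1 * x24"
    "- y12 * x14 + x12 * y14 = N1 * y24"
    "x13 * x13 + y13 * y13 = N1 * N3"
    "x13 * x14 + y13 * y14 = N1 * x34"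
    "- y13 * x14 + x13 * y14 = N1 * y34"
    "x14 * x14 + y14 * y14 = N1 * N4"
    "x12 * x23 - y12 * y23 = N2 * x13"
    "y12 * x23 + x12 * y23 = N2 * y13"
    "x12 * x24 - y12 * y24 = N2 * x14"
    "y12 * x24 + x12 * y24 = N2 * y14"
    "x23 * x23 + y23 * y23 = N2 * N3"
    "x23 * x24 + y23 * y24 = N2 * x34"
    "- y23 * x24 + x23 * y24 = N2 * y34"
    "x24 * x24 + y24 * y24 = N2 * N4"
    "x13 * x23 + y13 * y23 = N3 * x12"
    "y13 * x23 - x13 * y23 = N3 * y12"
    "x13 * x34 - y13 * y34 = N3 * x14"
    "y13 * x34 + x13 * y34 = N3 * y14"
    "x23 * x34 - y23 * y34 = N3 * x24"
    "y23 * x34 + x23 * y34 = N3 * y24"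
    "x34 * x34 + y34 * y34 = N3 * N4"
    "x14 * x24 + y14 * y24 = N4 * x12"
    "y14 * x24 - x14 * y24 = N4 * y12"
    "x14 * x34 + y14 * y34 = N4 * x13"
    "y14 * x34 - x14 * y34 = N4 * y13"
    "x24 * x34 + y24 * y34 = N4 * x23"
    "y24 * x34 - x24 * y34 = N4 * y23"
proof -
  show "x12 * x12 + y12 * y12 = N1 * N2"
    using p5 g11 g22 g33 g44 g55 N unfolding d by algebra
  show "x12 * x13 + y12 * y13 = N1 * x23"
    using p2 g25 s15 k1 unfolding d by algebra
  show "- y12 * x13 + x12 * y13 = N1 * y23"
    using p1 g15 s25 k2 unfolding d by algebra
  show "x12 * x14 + y12 * y14 = N1 * x24"
    using p4 g45 s35 k3 unfolding d by algebra
  show "- y12 * x14 + x12 * y14 = N1 * y24"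
    using p3 g35 s45 k4 unfolding d by algebra
  show "x13 * x13 + y13 * y13 = N1 * N3"
    using g11 g22 g33 g44 g55 s12 N unfolding d by algebra
  show "x13 * x14 + y13 * y14 = N1 * x34"
    using g13 g24 s14 s23 unfolding d by algebra
  show "- y13 * x14 + x13 * y14 = N1 * y34"
    using g14 g23 s13 s24 unfolding d by algebra
  show "x14 * x14 + y14 * y14 = N1 * N4"
    using g11 g22 g33 g44 g55 s34 N unfolding d by algebra
  show "x12 * x23 - y12 * y23 = N2 * x13"
    using p4 g45 s35 k3 unfolding d by algebra
  show "y12 * x23 + x12 * y23 = N2 * y13"
    using p3 g35 s45 k4 unfolding d by algebra
  show "x12 * x24 - y12 * y24 = N2 * x14"
    using p2 g25 s15 k1 unfolding d by algebra
  show "y12 * x24 + x12 * y24 = N2 * y14"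
    using p1 g15 s25 k2 unfolding d by algebra
  show "x23 * x23 + y23 * y23 = N2 * N3"
    using g11 g22 g33 g44 g55 s34 N unfolding d by algebra
  show "x23 * x24 + y23 * y24 = N2 * x34"
    using g13 g24 s14 s23 unfolding d by algebra
  show "- y23 * x24 + x23 * y24 = N2 * y34"
    using g14 g23 s13 s24 unfolding d by algebra
  show "x24 * x24 + y24 * y24 = N2 * N4"
    using g11 g22 g33 g44 g55 s12 N unfolding d by algebra
  show "x13 * x23 + y13 * y23 = N3 * x12"
    using g13 g24 s14 s23 unfolding d by algebra
  show "y13 * x23 - x13 * y23 = N3 * y12"
    using g14 g23 s13 s24 unfolding d by algebra
  show "x13 * x34 - y13 * y34 = N3 * x14"
    using p2 g25 s15 k1 unfolding d by algebra
  show "y13 * x34 + x13 * y34 = N3 * y14"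
    using p1 g15 s25 k2 unfolding d by algebra
  show "x23 * x34 - y23 * y34 = N3 * x24"
    using p4 g45 s35 k3 unfolding d by algebra
  show "y23 * x34 + x23 * y34 = N3 * y24"
    using p3 g35 s45 k4 unfolding d by algebra
  show "x34 * x34 + y34 * y34 = N3 * N4"
    using p5 g11 g22 g33 g44 g55 N unfolding d by algebra
  show "x14 * x24 + y14 * y24 = N4 * x12"
    using g13 g24 s14 s23 unfolding d by algebra
  show "y14 * x24 - x14 * y24 = N4 * y12"
    using g14 g23 s13 s24 unfolding d by algebra
  show "x14 * x34 + y14 * y34 = N4 * x13"
    using p4 g45 s35 k3 unfolding d by algebra
  show "y14 * x34 - x14 * y34 = N4 * y13"
    using p3 g35 s45 k4 unfolding d by algebra
  show "x24 * x34 + y24 * y34 = N4 * x23"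
    using p2 g25 s15 k1 unfolding d by algebra
  show "y24 * x34 - x24 * y34 = N4 * y23"
    using p1 g15 s25 k2 unfolding d by algebra
qed

text \<open>The matrix \<open>1 + n \<cdot> \<gamma> + a \<cdot> \<gamma>\<gamma>\<close>, where the \<open>\<gamma>\<^sub>i\<close> are Hermitian \<open>4 \<times> 4\<close> Clifford matrices and
  \<open>n = - pfaff a\<close>.  On the orbit it is four times the projection to the line of the bivector.\<close>

definition spin_herm :: "real^5^5 \<Rightarrow> complex^4^4" where
  "spin_herm a = (let n = - pfaff a;
      N1 = a$1$2 - a$3$4 + n$5 + 1; N2 = - a$1$2 + a$3$4 + n$5 + 1;
      N3 = a$1$2 + a$3$4 - n$5 + 1; N4 = - a$1$2 - a$3$4 - n$5 + 1;
      z12 = Complex (- a$1$4 + a$2$3) (a$1$3 + a$2$4);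
      z13 = Complex (a$3$5 + n$4) (a$4$5 - n$3);
      z14 = Complex (a$1$5 - n$2) (- a$2$5 - n$1);
      z23 = Complex (a$1$5 + n$2) (a$2$5 - n$1);
      z24 = Complex (- a$3$5 + n$4) (a$4$5 + n$3);
      z34 = Complex (a$1$4 + a$2$3) (a$1$3 - a$2$4)
    in vector
     [vector [of_real N1, z12, z13, z14],
      vector [cnj z12, of_real N2, z23, z24],
      vector [cnj z13, cnj z23, of_real N3, z34],
      vector [cnj z14, cnj z24, cnj z34, of_real N4]])"

text \<open>For \<open>r = z z\<^sup>*\<close>, the components of \<open>spin_form r\<close>, \<open>spin_kernel r\<close> and \<open>spin_trace r\<close> are the expectation values
  of \<open>z\<close> with respect to the products \<open>\<gamma>\<^sub>i \<gamma>\<^sub>j\<close> (up to powers of \<open>\<i>\<close>), the \<open>\<gamma>\<^sub>i\<close>, and the identity.  Since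
  these sixteen matrices form a basis of the Hermitian matrices, nothing is lost.\<close>

definition spin_form :: "complex^4^4 \<Rightarrow> real^5^5" where
  "spin_form r = biv
     (Re (r$1$1) - Re (r$2$2) + Re (r$3$3) - Re (r$4$4))
     (2 * Im (r$1$2) + 2 * Im (r$3$4)) (- 2 * Re (r$1$2) + 2 * Re (r$3$4)) (2 * Re (r$1$4) + 2 * Re (r$2$3))
     (2 * Re (r$1$2) + 2 * Re (r$3$4)) (2 * Im (r$1$2) - 2 * Im (r$3$4)) (- 2 * Im (r$1$4) + 2 * Im (r$2$3))
     (- Re (r$1$1) + Re (r$2$2) + Re (r$3$3) - Re (r$4$4))
     (2 * Re (r$1$3) - 2 * Re (r$2$4)) (2 * Im (r$1$3) + 2 * Im (r$2$4))"

definition spin_trace :: "complex^4^4 \<Rightarrow> real" where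
  "spin_trace r = Re (r$1$1) + Re (r$2$2) + Re (r$3$3) + Re (r$4$4)"

definition spin_kernel :: "complex^4^4 \<Rightarrow> real^5" where
  "spin_kernel r = vector
     [- 2 * Im (r$1$4) - 2 * Im (r$2$3), - 2 * Re (r$1$4) + 2 * Re (r$2$3),
      - 2 * Im (r$1$3) + 2 * Im (r$2$4), 2 * Re (r$1$3) + 2 * Re (r$2$4),
      Re (r$1$1) + Re (r$2$2) - Re (r$3$3) - Re (r$4$4)]"

definition outer :: "complex^4 \<Rightarrow> complex^4^4" where
  "outer z = (\<chi> a b. z$a * cnj (z$b))"

text \<open>The moment map of the spin representation.  The factor \<open>1 / \<surd>2\<close> makes the values unit vectors.\<close>

definition spin_biv :: "complex^4 \<Rightarrow> real^5^5" where
  "spin_biv z = (1 / (sqrt 2 * spin_trace (outer z))) *\<^sub>R spin_form (outer z)"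

lemma vector_4 [simp]:
  "(vector [a, b, c, d] :: ('a::zero)^4) $ 1 = a"
  "(vector [a, b, c, d] :: ('a::zero)^4) $ 2 = b"
  "(vector [a, b, c, d] :: ('a::zero)^4) $ 3 = c"
  "(vector [a, b, c, d] :: ('a::zero)^4) $ 4 = d"
  unfolding vector_def by simp_all

lemma spin_form_herm: "a \<in> bivectors \<Longrightarrow> spin_form (spin_herm a) = 4 *\<^sub>R a"
  by (erule bivectors_cases) (simp add: spin_form_def spin_herm_def Let_def biv_def matrix_eq_iff_5)

lemma spin_trace_herm: "spin_trace (spin_herm a) = 4"
  by (simp add: spin_trace_def spin_herm_def Let_def)

lemma spin_trace_outer: "spin_trace (outer z) = (\<Sum>a\<in>UNIV. (cmod (z$a))\<^sup>2)"
  by (simp add: spin_trace_def outer_def sum_4 complex_mult_cnj cmod_power2)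

lemma spin_trace_pos: "z \<noteq> 0 \<Longrightarrow> 0 < spin_trace (outer z)"
proof -
  assume "z \<noteq> 0"
  then obtain i where "z $ i \<noteq> 0" by (auto simp: vec_eq_iff)
  then show ?thesis unfolding spin_trace_outer by (intro sum_pos2[of _ i]) auto
qed

definition spin_real :: "real \<Rightarrow> real \<Rightarrow> real \<Rightarrow> real \<Rightarrow> real \<Rightarrow> real \<Rightarrow> real \<Rightarrow> real \<Rightarrow> complex^4" where
  "spin_real p q r s t u v w = vector [Complex p q, Complex r s, Complex t u, Complex v w]"

lemma spin_real_cases: obtains p q r s t u v w where "z = spin_real p q r s t u v w"
proof
  show "z = spin_real (Re (z$1)) (Im (z$1)) (Re (z$2)) (Im (z$2)) (Re (z$3)) (Im (z$3)) (Re (z$4)) (Im (z$4))"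
    by (simp add: spin_real_def vec_eq_iff forall_4)
qed

lemma spin_kernel_norm: "spin_kernel (outer z) \<bullet> spin_kernel (outer z) = (spin_trace (outer z))\<^sup>2"
proof -
  obtain p q r s t u v w where z: "z = spin_real p q r s t u v w" by (rule spin_real_cases)
  show ?thesis
    by (simp add: z spin_real_def spin_kernel_def spin_trace_def outer_def inner_vec_def sum_5 power2_eq_square) algebra
qed

lemma spin_form_pfaff: "pfaff (spin_form (outer z)) = - (spin_trace (outer z) *\<^sub>R spin_kernel (outer z))"
proof -
  obtain p q r s t u v w where z: "z = spin_real p q r s t u v w" by (rule spin_real_cases)
  show ?thesis
    by (simp add: z spin_real_def spin_kernel_def spin_trace_def outer_def spin_form_def pfaff_def biv_def
        vec_eq_iff forall_5) (intro conjI; algebra)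
qed

text \<open>The relations of this lemma and the two before it are the Fierz identities of a spinor in
  dimension five.\<close>

lemma spin_form_square: "spin_form (outer z) ** spin_form (outer z) =
   (\<chi> i j. spin_kernel (outer z) $ i * spin_kernel (outer z) $ j) - (spin_trace (outer z))\<^sup>2 *\<^sub>R mat 1"
proof -
  obtain p q r s t u v w where z: "z = spin_real p q r s t u v w" by (rule spin_real_cases)
  show ?thesis
    by (simp add: z spin_real_def spin_kernel_def spin_trace_def outer_def spin_form_def biv_def
        matrix_eq_iff_5 matrix_mult_nth_5 mat_1_nth power2_eq_square) (intro conjI; algebra)
qed

lemma inner_rank_one_minus_scalar:
  fixes n :: "real^5" and c :: real
  defines "P \<equiv> (\<chi> i j. n $ i * n $ j) - c *\<^sub>R mat 1"
  shows "P \<bullet> P = (n \<bullet> n)\<^sup>2 - 2 * c * (n \<bullet> n) + 5 * c\<^sup>2"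
  unfolding P_def
  by (simp add: inner_matrix_5 mat_1_nth inner_vec_def sum_5 power2_eq_square algebra_simps)

lemma bivectors_norm_trace:
  "a \<in> bivectors \<Longrightarrow> biv_inner a a = - ((a ** a)$1$1 + (a ** a)$2$2 + (a ** a)$3$3 + (a ** a)$4$4 + (a ** a)$5$5) / 2"
  by (erule bivectors_cases) (simp only: biv_inner_biv matrix_mult_nth_5, simp add: biv_def)

lemma spin_form_bivectors: "spin_form r \<in> bivectors"
  by (simp add: spin_form_def)

lemma spin_biv_in_orbit:
  assumes "z \<noteq> 0"
  shows "spin_biv z \<in> orbit SO5 conj_action (b_vec (pi/4))"
proof -
  let ?s = "spin_trace (outer z)" and ?a = "spin_form (outer z)" and ?n = "spin_kernel (outer z)"
  have s: "0 < ?s" using assms by (rule spin_trace_pos)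
  have n: "(\<Sum>i\<in>UNIV. ?n$i * ?n$i) = ?s\<^sup>2" using spin_kernel_norm[of z] by (simp add: inner_vec_def)
  have "biv_inner ?a ?a = 2 * ?s\<^sup>2"
    unfolding bivectors_norm_trace[OF spin_form_bivectors] spin_form_square
    using n by (simp add: mat_1_nth sum_5)
  then have 1: "biv_inner (spin_biv z) (spin_biv z) = 1"
    using s by (simp add: spin_biv_def biv_inner_scaleR power2_eq_square)
  have "quartic ?a = 4 * ?s ^ 4"
    unfolding quartic_def spin_form_square inner_rank_one_minus_scalar spin_kernel_norm by algebra
  moreover have "(sqrt 2 * ?s) ^ 4 = 4 * ?s ^ 4" by (simp add: power_mult_distrib power4_eq_xxxx)
  ultimately have "quartic (spin_biv z) = 1"
    using s by (simp add: spin_biv_def quartic_scaleR power_one_over)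
  moreover have "spin_biv z \<in> bivectors"
    unfolding spin_biv_def by (intro subspace_scale subspace_bivectors spin_form_bivectors)
  ultimately show ?thesis using 1 by (simp add: in_orbit_b_vec_iff unit_bivectors_def quartic_b_vec_pi_4)
qed

text \<open>At \<open>\<theta> = \<pi>/4\<close> all nonzero eigenvalues of \<open>\<surd>2 A\<close> are \<open>\<plusminus>\<i>\<close>.\<close>

lemma orbit_plus_cubic:
  assumes "A \<in> orbit SO5 conj_action (b_vec (pi/4))"
  defines "a \<equiv> sqrt 2 *\<^sub>R A"
  shows "a \<in> bivectors" "biv_inner a a = 2" "a ** a ** a = - a"
proof -
  obtain g where g: "rotation_matrix g" "A = cj g (b_vec (pi/4))"
    using assms(1) by (auto simp: orbit_eq b_vec_in_unit_bivectors)
  have A: "A \<in> unit_bivectors" using g by (simp add: cj_unit_bivectors b_vec_in_unit_bivectors)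
  show "a \<in> bivectors" unfolding a_def using A by (intro subspace_scale subspace_bivectors) (simp add: unit_bivectors_def)
  show "biv_inner a a = 2" using A by (simp add: a_def biv_inner_scaleR unit_bivectors_def)
  let ?b = "biv 1 0 0 0 0 0 0 1 0 0"
  have a: "a = cj g ?b"
  proof -
    have "sqrt 2 *\<^sub>R b_vec (pi/4) = ?b" by (simp add: b_vec_biv biv_scaleR cos_45 sin_45)
    then show ?thesis unfolding a_def g(2) cj_scaleR[symmetric] by simp
  qed
  have "?b ** ?b ** ?b = - ?b" by (simp add: matrix_eq_iff_5 matrix_mult_nth_5 biv_def)
  then show "a ** a ** a = - a" unfolding a by (simp add: cj_mult[OF g(1), symmetric] cj_uminus)
qed

lemma spin_herm_rank_one:
  assumes "A \<in> orbit SO5 conj_action (b_vec (pi/4))"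
  defines "Z \<equiv> spin_herm (sqrt 2 *\<^sub>R A)"
  shows "Z $ \<beta> $ \<alpha> * cnj (Z $ \<gamma> $ \<alpha>) = of_real (Re (Z $ \<alpha> $ \<alpha>)) * Z $ \<beta> $ \<gamma>"
proof -
  define a where "a = sqrt 2 *\<^sub>R A"
  note a = orbit_plus_cubic[OF assms(1), folded a_def]
  define p where "p = pfaff a"
  define n where "n = - p"
  obtain a12 a13 a14 a15 a23 a24 a25 a34 a35 a45 where ab: "a = biv a12 a13 a14 a15 a23 a24 a25 a34 a35 a45"
    using a(1) by (rule bivectors_cases)
  \<comment> \<open>Relations between \<open>a\<close> and its Pfaffian vector; the trace of the first one gives \<open>|p| = 1\<close>.\<close>
  have out: "(\<chi> i j. p $ i * p $ j) = a ** a + (p \<bullet> p) *\<^sub>R mat 1"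
  proof -
    have "a ** (a ** a ** a) = - (a ** a)" unfolding a(3) by (rule matrix_neg_right)
    then have "(\<chi> i j. p $ i * p $ j) = - (a ** a) + 2 *\<^sub>R (a ** a) + (p \<bullet> p) *\<^sub>R mat 1"
      using pfaff_outer[OF a(1)] a(2) by (simp add: p_def)
    then show ?thesis by (simp add: scaleR_2)
  qed
  have e: "p $ i * p $ j = (a ** a) $ i $ j + (p \<bullet> p) * mat 1 $ i $ j" for i j
    using arg_cong[OF out, of "\<lambda>M. M $ i $ j"] by simp
  have pp: "p \<bullet> p = 1"
  proof -
    have "p \<bullet> p = p$1 * p$1 + p$2 * p$2 + p$3 * p$3 + p$4 * p$4 + p$5 * p$5" by (simp add: inner_vec_def sum_5)
    also have "\<dots> = (a ** a)$1$1 + (a ** a)$2$2 + (a ** a)$3$3 + (a ** a)$4$4 + (a ** a)$5$5 + 5 * (p \<bullet> p)"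
      unfolding e by (simp add: mat_1_nth)
    finally show ?thesis using bivectors_norm_trace[OF a(1)] a(2) by simp
  qed
  have st: "star_pfaff a p = a"
    using star_pfaff_pfaff[OF a(1)] a(2,3) by (simp add: p_def scaleR_2)
  have ker: "a *v p = 0" unfolding p_def using a(1) by (rule pfaff_kernel)
  have g: "n$i * n$j = (a ** a) $ i $ j + mat 1 $ i $ j" for i j
    using e[of i j] by (simp add: n_def pp)
  have s: "star_pfaff a n $ i $ j = - a $ i $ j" for i j
  proof -
    have "star_pfaff a n = - star_pfaff a p" by (simp add: star_pfaff_def n_def matrix_eq_iff_5 biv_def)
    then show ?thesis using st by simp
  qed
  have k: "(a *v n) $ i = 0" for i using ker by (simp add: n_def matrix_vector_minus)
  have N: "n$1 * n$1 + n$2 * n$2 + n$3 * n$3 + n$4 * n$4 + n$5 * n$5 = 1"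
    using pp by (simp add: n_def inner_vec_def sum_5)
  note unf = ab biv_def matrix_mult_nth_5 mat_1_nth star_pfaff_def matrix_vector_mult_def sum_5
  have hyps:
    "a23 * a45 - a24 * a35 + a25 * a34 + n$1 = 0" "- a13 * a45 + a14 * a35 - a15 * a34 + n$2 = 0"
    "a12 * a45 - a14 * a25 + a15 * a24 + n$3 = 0" "- a12 * a35 + a13 * a25 - a15 * a23 + n$4 = 0"
    "a12 * a34 - a13 * a24 + a14 * a23 + n$5 = 0"
    by (simp_all add: n_def p_def pfaff_def ab biv_def)
  have h_g11: "a12 * a12 + a13 * a13 + a14 * a14 + a15 * a15 + n$1 * n$1 - 1 = 0"
    using g[of 1 1] by (simp add: unf algebra_simps)
  have h_g13: "- a12 * a23 + a14 * a34 + a15 * a35 + n$1 * n$3 = 0"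
    using g[of 1 3] by (simp add: unf algebra_simps)
  have h_g14: "- a12 * a24 - a13 * a34 + a15 * a45 + n$1 * n$4 = 0"
    using g[of 1 4] by (simp add: unf algebra_simps)
  have h_g15: "- a12 * a25 - a13 * a35 - a14 * a45 + n$1 * n$5 = 0"
    using g[of 1 5] by (simp add: unf algebra_simps)
  have h_g22: "a12 * a12 + a23 * a23 + a24 * a24 + a25 * a25 + n$2 * n$2 - 1 = 0"
    using g[of 2 2] by (simp add: unf algebra_simps)
  have h_g23: "a12 * a13 + a24 * a34 + a25 * a35 + n$2 * n$3 = 0"
    using g[of 2 3] by (simp add: unf algebra_simps)
  have h_g24: "a12 * a14 - a23 * a34 + a25 * a45 + n$2 * n$4 = 0"
    using g[of 2 4] by (simp add: unf algebra_simps)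
  have h_g25: "a12 * a15 - a23 * a35 - a24 * a45 + n$2 * n$5 = 0"
    using g[of 2 5] by (simp add: unf algebra_simps)
  have h_g33: "a13 * a13 + a23 * a23 + a34 * a34 + a35 * a35 + n$3 * n$3 - 1 = 0"
    using g[of 3 3] by (simp add: unf algebra_simps)
  have h_g35: "a13 * a15 + a23 * a25 - a34 * a45 + n$3 * n$5 = 0"
    using g[of 3 5] by (simp add: unf algebra_simps)
  have h_g44: "a14 * a14 + a24 * a24 + a34 * a34 + a45 * a45 + n$4 * n$4 - 1 = 0"
    using g[of 4 4] by (simp add: unf algebra_simps)
  have h_g45: "a14 * a15 + a24 * a25 + a34 * a35 + n$4 * n$5 = 0"
    using g[of 4 5] by (simp add: unf algebra_simps)
  have h_g55: "a15 * a15 + a25 * a25 + a35 * a35 + a45 * a45 + n$5 * n$5 - 1 = 0"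
    using g[of 5 5] by (simp add: unf algebra_simps)
  have h_s12: "a34 * n$5 - a35 * n$4 + a45 * n$3 + a12 = 0"
    using s[of 1 2] by (simp add: unf algebra_simps)
  have h_s13: "- a24 * n$5 + a25 * n$4 - a45 * n$2 + a13 = 0"
    using s[of 1 3] by (simp add: unf algebra_simps)
  have h_s14: "a23 * n$5 - a25 * n$3 + a35 * n$2 + a14 = 0"
    using s[of 1 4] by (simp add: unf algebra_simps)
  have h_s15: "- a23 * n$4 + a24 * n$3 - a34 * n$2 + a15 = 0"
    using s[of 1 5] by (simp add: unf algebra_simps)
  have h_s23: "a14 * n$5 - a15 * n$4 + a45 * n$1 + a23 = 0"
    using s[of 2 3] by (simp add: unf algebra_simps)
  have h_s24: "- a13 * n$5 + a15 * n$3 - a35 * n$1 + a24 = 0"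
    using s[of 2 4] by (simp add: unf algebra_simps)
  have h_s25: "a13 * n$4 - a14 * n$3 + a34 * n$1 + a25 = 0"
    using s[of 2 5] by (simp add: unf algebra_simps)
  have h_s34: "a12 * n$5 - a15 * n$2 + a25 * n$1 + a34 = 0"
    using s[of 3 4] by (simp add: unf algebra_simps)
  have h_s35: "- a12 * n$4 + a14 * n$2 - a24 * n$1 + a35 = 0"
    using s[of 3 5] by (simp add: unf algebra_simps)
  have h_s45: "a12 * n$3 - a13 * n$2 + a23 * n$1 + a45 = 0"
    using s[of 4 5] by (simp add: unf algebra_simps)
  have h_k1: "a12 * n$2 + a13 * n$3 + a14 * n$4 + a15 * n$5 = 0"
    using k[of 1] by (simp add: unf algebra_simps)
  have h_k2: "- a12 * n$1 + a23 * n$3 + a24 * n$4 + a25 * n$5 = 0"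
    using k[of 2] by (simp add: unf algebra_simps)
  have h_k3: "- a13 * n$1 - a23 * n$2 + a34 * n$4 + a35 * n$5 = 0"
    using k[of 3] by (simp add: unf algebra_simps)
  have h_k4: "- a14 * n$1 - a24 * n$2 - a34 * n$3 + a45 * n$5 = 0"
    using k[of 4] by (simp add: unf algebra_simps)
  have h_N: "n$1 * n$1 + n$2 * n$2 + n$3 * n$3 + n$4 * n$4 + n$5 * n$5 - 1 = 0"
    using N by (simp add: unf algebra_simps)
  obtain N1 N2 N3 N4 x12 x13 x14 x23 x24 x34 y12 y13 y14 y23 y24 y34 :: real where d: "N1 = a12 - a34 + n$5 + 1"
    "N2 = - a12 + a34 + n$5 + 1"
    "N3 = a12 + a34 - n$5 + 1"
    "N4 = - a12 - a34 - n$5 + 1"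
    "x12 = - a14 + a23"
    "x13 = a35 + n$4"
    "x14 = a15 - n$2"
    "x23 = a15 + n$2"
    "x24 = - a35 + n$4"
    "x34 = a14 + a23"
    "y12 = a13 + a24"
    "y13 = a45 - n$3"
    "y14 = - a25 - n$1"
    "y23 = a25 - n$1"
    "y24 = a45 + n$3"
    "y34 = a13 - a24"
    by blast
  note m = spin_minors[OF hyps h_g11 h_g13 h_g14 h_g15 h_g22 h_g23 h_g24 h_g25 h_g33 h_g35 h_g44 h_g45 h_g55 h_s12 h_s13 h_s14 h_s15 h_s23 h_s24 h_s25 h_s34 h_s35 h_s45 h_k1 h_k2 h_k3 h_k4 h_N d]
  have ent: "a$1$2 = a12" "a$1$3 = a13" "a$1$4 = a14" "a$1$5 = a15" "a$2$3 = a23" "a$2$4 = a24" "a$2$5 = a25"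
    "a$3$4 = a34" "a$3$5 = a35" "a$4$5 = a45"
    by (simp_all add: ab biv_def)
  have Z: "Z = vector
     [vector [of_real N1, Complex x12 y12, Complex x13 y13, Complex x14 y14],
      vector [cnj (Complex x12 y12), of_real N2, Complex x23 y23, Complex x24 y24],
      vector [cnj (Complex x13 y13), cnj (Complex x23 y23), of_real N3, Complex x34 y34],
      vector [cnj (Complex x14 y14), cnj (Complex x24 y24), cnj (Complex x34 y34), of_real N4]]"
    unfolding d Z_def a_def[symmetric] spin_herm_def Let_def p_def[symmetric] n_def[symmetric] ent ..
  have "\<forall>\<alpha> \<beta> \<gamma>. Z $ \<beta> $ \<alpha> * cnj (Z $ \<gamma> $ \<alpha>) = of_real (Re (Z $ \<alpha> $ \<alpha>)) * Z $ \<beta> $ \<gamma>"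
    using m unfolding Z forall_4 by (simp add: complex_eq_iff algebra_simps)
  then show ?thesis by blast
qed

text \<open>A Hermitian matrix of rank one is recovered from any column whose diagonal entry does not vanish.
  This gives surjectivity of the moment map, and smooth local sections.\<close>

lemma spin_herm_column:
  assumes A: "A \<in> orbit SO5 conj_action (b_vec (pi/4))" and \<alpha>: "Re (spin_herm (sqrt 2 *\<^sub>R A) $ \<alpha> $ \<alpha>) \<noteq> 0"
  shows "spin_biv (column \<alpha> (spin_herm (sqrt 2 *\<^sub>R A))) = A" "column \<alpha> (spin_herm (sqrt 2 *\<^sub>R A)) \<noteq> 0"
proof -
  let ?Z = "spin_herm (sqrt 2 *\<^sub>R A)"
  let ?r = "Re (?Z $ \<alpha> $ \<alpha>)"
  have o: "outer (column \<alpha> ?Z) $ b $ c = of_real ?r * ?Z $ b $ c" for b c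
    unfolding outer_def column_def using spin_herm_rank_one[OF A, of b \<alpha> c] by simp
  have "sqrt 2 *\<^sub>R A \<in> bivectors" using orbit_plus_cubic[OF A] by simp
  then have "spin_form (outer (column \<alpha> ?Z)) = (4 * ?r) *\<^sub>R (sqrt 2 *\<^sub>R A)"
  proof -
    have "spin_form (outer (column \<alpha> ?Z)) = ?r *\<^sub>R spin_form ?Z"
      unfolding spin_form_def biv_scaleR biv_eq_iff by (simp add: o algebra_simps)
    also have "spin_form ?Z = 4 *\<^sub>R (sqrt 2 *\<^sub>R A)" using orbit_plus_cubic[OF A] by (intro spin_form_herm)
    finally show ?thesis by simp
  qed
  moreover have t: "spin_trace (outer (column \<alpha> ?Z)) = 4 * ?r"
  proof -
    have "spin_trace (outer (column \<alpha> ?Z)) = ?r * spin_trace ?Z"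
      unfolding spin_trace_def by (simp add: o algebra_simps)
    then show ?thesis by (simp add: spin_trace_herm)
  qed
  ultimately show "spin_biv (column \<alpha> ?Z) = A" using \<alpha> by (simp add: spin_biv_def)
  show "column \<alpha> ?Z \<noteq> 0"
  proof
    assume "column \<alpha> ?Z = 0"
    then have "column \<alpha> ?Z $ \<alpha> = 0" by simp
    then show False using \<alpha> by (simp add: column_def)
  qed
qed

lemma spin_herm_diagonal: obtains \<alpha> where "Re (spin_herm a $ \<alpha> $ \<alpha>) \<noteq> 0"
  using spin_trace_herm[of a] unfolding spin_trace_def by (metis add.right_neutral zero_neq_numeral)

text \<open>The projection to the line of \<open>z\<close> is expanded in the Clifford basis, with the coefficients that the
  moment map and its Pfaffian vector provide.\<close>

lemma spin_herm_spin_biv: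
  assumes "z \<noteq> 0"
  shows "spin_herm (sqrt 2 *\<^sub>R spin_biv z) $ b $ c = of_real (4 / spin_trace (outer z)) * (z $ b * cnj (z $ c))"
proof -
  let ?s = "spin_trace (outer z)" and ?n = "spin_kernel (outer z)"
  have s: "0 < ?s" using assms by (rule spin_trace_pos)
  have a: "sqrt 2 *\<^sub>R spin_biv z = (1 / ?s) *\<^sub>R spin_form (outer z)"
    by (simp add: spin_biv_def)
  have n: "- pfaff ((1 / ?s) *\<^sub>R spin_form (outer z)) = (1 / ?s) *\<^sub>R ?n"
    unfolding pfaff_scaleR spin_form_pfaff using s by (simp add: power2_eq_square)
  define \<kappa> where "\<kappa> = 1 / ?s"
  have \<kappa>: "\<kappa> * ?s = 1" using s by (simp add: \<kappa>_def)
  obtain p q r t u v w x where z: "z = spin_real p q r t u v w x" by (rule spin_real_cases)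
  have o: "outer y $ b $ c = y $ b * cnj (y $ c)" for y b c by (simp add: outer_def)
  have h: "\<kappa> * (p * p) + \<kappa> * (q * q) + \<kappa> * (r * r) + \<kappa> * (t * t) + \<kappa> * (u * u) + \<kappa> * (v * v) + \<kappa> * (w * w) + \<kappa> * (x * x) = 1"
    using \<kappa> by (simp add: spin_trace_def o z spin_real_def algebra_simps)
  have "\<forall>b c. spin_herm (\<kappa> *\<^sub>R spin_form (outer z)) $ b $ c = of_real \<kappa> * (4 * outer z $ b $ c)"
    unfolding spin_herm_def n[folded \<kappa>_def] Let_def forall_4
    by (simp add: complex_eq_iff spin_form_def biv_def spin_kernel_def o z spin_real_def algebra_simps)
      (use h in linarith)
  then show ?thesis unfolding a \<kappa>_def[symmetric] by (simp add: outer_def \<kappa>_def)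
qed

text \<open>The moment map is invariant under scaling, and the projection \<open>z z\<^sup>* / |z|\<^sup>2\<close> that it determines
  determines the line.\<close>

lemma complex_line_eq_iff:
  assumes "z \<noteq> 0" "w \<noteq> 0"
  shows "complex_line z = complex_line w \<longleftrightarrow> spin_biv z = spin_biv w"
proof
  assume "complex_line z = complex_line w"
  moreover have "w \<in> complex_line w" unfolding complex_line_def by (rule range_eqI[of _ _ 1]) simp
  ultimately obtain c where c: "w = c *s z" by (auto simp: complex_line_def)
  then have "c \<noteq> 0" using assms by auto
  then have k: "(cmod c)\<^sup>2 \<noteq> 0" by simp
  have o: "outer w $ a $ b = of_real ((cmod c)\<^sup>2) * outer z $ a $ b" for a b
    unfolding c outer_def complex_norm_square by simp
  have "spin_form (outer w) = (cmod c)\<^sup>2 *\<^sub>R spin_form (outer z)"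
    unfolding spin_form_def biv_scaleR biv_eq_iff by (simp add: o algebra_simps)
  moreover have "spin_trace (outer w) = (cmod c)\<^sup>2 * spin_trace (outer z)"
    unfolding spin_trace_def by (simp add: o algebra_simps)
  ultimately show "spin_biv z = spin_biv w" using k by (simp add: spin_biv_def)
next
  assume eq: "spin_biv z = spin_biv w"
  let ?s = "spin_trace (outer z)" and ?t = "spin_trace (outer w)"
  have st: "0 < ?s" "0 < ?t" using assms spin_trace_pos by auto
  obtain b where b: "w $ b \<noteq> 0" using assms(2) by (auto simp: vec_eq_iff)
  have *: "of_real (4 / ?s) * (z $ a * cnj (z $ b)) = of_real (4 / ?t) * (w $ a * cnj (w $ b))" for a
    using spin_herm_spin_biv[OF assms(1), of a b] spin_herm_spin_biv[OF assms(2), of a b] eq by simp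
  define c where "c = of_real (?t / ?s) * cnj (z $ b) / cnj (w $ b)"
  have w: "w $ a = c * z $ a" for a
  proof -
    have "w $ a * cnj (w $ b) = of_real (?t / ?s) * (z $ a * cnj (z $ b))"
      using *[of a] st by (simp add: field_simps)
    moreover have "w $ a = w $ a * cnj (w $ b) / cnj (w $ b)" using b by simp
    ultimately show ?thesis by (simp add: c_def)
  qed
  have "w = c *s z" by (simp add: vec_eq_iff w)
  moreover have "c \<noteq> 0" using w[of b] b by auto
  ultimately show "complex_line z = complex_line w"
    unfolding complex_line_def
  proof (intro equalityI subsetI)
    fix x assume "x \<in> range (\<lambda>d. d *s z)"
    then obtain d where "x = d *s z" by auto
    then have "x = (d / c) *s w" using \<open>w = c *s z\<close> \<open>c \<noteq> 0\<close> by (simp add: vec_eq_iff)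
    then show "x \<in> range (\<lambda>d. d *s w)" by blast
  next
    fix x assume "x \<in> range (\<lambda>d. d *s w)"
    then obtain d where "x = d *s w" by auto
    then have "x = (d * c) *s z" using \<open>w = c *s z\<close> by (simp add: vec_eq_iff)
    then show "x \<in> range (\<lambda>d. d *s z)" by blast
  qed
qed

lemma smooth_at_Re: "smooth_at S x f \<Longrightarrow> smooth_at S x (\<lambda>y. Re (f y))"
  by (rule smooth_at_compose_linear) (auto intro: linearI)

lemma smooth_at_Im: "smooth_at S x f \<Longrightarrow> smooth_at S x (\<lambda>y. Im (f y))"
  by (rule smooth_at_compose_linear) (auto intro: linearI)

lemma smooth_at_cnj: "smooth_at S x f \<Longrightarrow> smooth_at S x (\<lambda>y. cnj (f y))"
  by (rule smooth_at_compose_linear) (auto intro: linearI)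

lemma smooth_at_Complex: "smooth_at S x f \<Longrightarrow> smooth_at S x g \<Longrightarrow> smooth_at S x (\<lambda>y. Complex (f y) (g y))"
proof -
  assume "smooth_at S x f" "smooth_at S x g"
  then have "smooth_at S x (\<lambda>y. f y *\<^sub>R 1 + g y *\<^sub>R \<i>)" by (intro smooth_at_add smooth_at_scaleR smooth_at_const)
  moreover have "f y *\<^sub>R 1 + g y *\<^sub>R \<i> = Complex (f y) (g y)" for y by (simp add: complex_eq_iff)
  ultimately show ?thesis by simp
qed

lemma smooth_at_of_real: "smooth_at S x f \<Longrightarrow> smooth_at S x (\<lambda>y. complex_of_real (f y))"
  by (rule smooth_at_compose_linear) (auto intro: linearI)

lemma smooth_at_biv:
  assumes "smooth_at S x a" "smooth_at S x b" "smooth_at S x c" "smooth_at S x d" "smooth_at S x e"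
    "smooth_at S x f" "smooth_at S x g" "smooth_at S x h" "smooth_at S x i" "smooth_at S x j"
  shows "smooth_at S x (\<lambda>y. biv (a y) (b y) (c y) (d y) (e y) (f y) (g y) (h y) (i y) (j y))"
proof -
  have "\<forall>k l. smooth_at S x (\<lambda>y. biv (a y) (b y) (c y) (d y) (e y) (f y) (g y) (h y) (i y) (j y) $ k $ l)"
    unfolding forall_5 biv_def using assms by (simp add: smooth_at_const smooth_at_minus)
  then show ?thesis by - (rule smooth_at_vec, rule smooth_at_vec, blast)
qed

lemma smooth_at_spin_biv:
  assumes "smooth_at S x f" "x \<in> S" "f x \<noteq> 0"
  shows "smooth_at S x (\<lambda>y. spin_biv (f y))"
proof -
  have *: "sqrt 2 * spin_trace (outer (f x)) \<noteq> 0" using spin_trace_pos[OF assms(3)] by simp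
  have o: "outer z $ a $ b = z $ a * cnj (z $ b)" for z a b by (simp add: outer_def)
  show ?thesis
    using assms * unfolding spin_biv_def spin_form_def spin_trace_def o
    by (intro smooth_at_scaleR smooth_at_divide smooth_at_biv smooth_intros smooth_at_Re smooth_at_Im smooth_at_cnj)
qed

lemma smooth_at_spin_herm:
  assumes "smooth_at S x f"
  shows "smooth_at S x (\<lambda>y. spin_herm (f y))"
proof -
  have p: "smooth_at S x (\<lambda>y. pfaff (f y))"
  proof -
    have "\<forall>i. smooth_at S x (\<lambda>y. pfaff (f y) $ i)"
      unfolding forall_5 pfaff_def using assms by (auto intro!: smooth_intros)
    then show ?thesis by (intro smooth_at_vec) blast
  qed
  have "\<forall>b c. smooth_at S x (\<lambda>y. spin_herm (f y) $ b $ c)"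
    unfolding forall_4 spin_herm_def Let_def using assms p
    by (auto intro!: smooth_at_of_real smooth_at_cnj smooth_at_Complex smooth_intros)
  then show ?thesis by - (rule smooth_at_vec, rule smooth_at_vec, blast)
qed

lemma homogeneous_space_plus_CP3:
  "diffeomorphic (homogeneous_space (carrier SO5) (isotropy (b_vec (pi/4)))) CP3"
proof -
  let ?D = "orbit SO5 conj_action (b_vec (pi/4))" and ?S = "UNIV - {0} :: (complex^4) set"
  have s: "smooth_on ?S spin_biv"
    unfolding smooth_on_iff_smooth_at by (auto intro!: smooth_at_spin_biv smooth_at_ident)
  have im: "spin_biv ` ?S = ?D"
  proof
    show "spin_biv ` ?S \<subseteq> ?D" using spin_biv_in_orbit by auto
    show "?D \<subseteq> spin_biv ` ?S"
    proof
      fix A assume A: "A \<in> ?D"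
      obtain \<alpha> where "Re (spin_herm (sqrt 2 *\<^sub>R A) $ \<alpha> $ \<alpha>) \<noteq> 0" by (rule spin_herm_diagonal)
      from spin_herm_column[OF A this] show "A \<in> spin_biv ` ?S" by (metis DiffI UNIV_I image_eqI singletonD)
    qed
  qed
  have sec: "has_local_sections ?S ?D spin_biv"
    unfolding has_local_sections_def
  proof
    fix A assume A: "A \<in> ?D"
    obtain \<alpha> where \<alpha>: "Re (spin_herm (sqrt 2 *\<^sub>R A) $ \<alpha> $ \<alpha>) \<noteq> 0" by (rule spin_herm_diagonal)
    have h: "smooth_at ?D A (\<lambda>B. spin_herm (sqrt 2 *\<^sub>R B))"
      by (intro smooth_at_spin_herm smooth_intros)
    have "smooth_at ?D A (\<lambda>B. column \<alpha> (spin_herm (sqrt 2 *\<^sub>R B)))"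
      by (rule smooth_at_vec) (simp add: column_def, intro smooth_at_vec_nth h)
    moreover have "eventually (\<lambda>B. Re (spin_herm (sqrt 2 *\<^sub>R B) $ \<alpha> $ \<alpha>) \<noteq> 0) (near ?D A)"
      using A \<alpha> by (intro eventually_near_neq_0 smooth_at_Re smooth_at_vec_nth h)
    then have "eventually (\<lambda>B. column \<alpha> (spin_herm (sqrt 2 *\<^sub>R B)) \<in> ?S \<and>
        spin_biv (column \<alpha> (spin_herm (sqrt 2 *\<^sub>R B))) = B) (near ?D A)"
      using eventually_near_mem[of ?D A] by eventually_elim (simp add: spin_herm_column)
    ultimately show "\<exists>\<sigma>. smooth_at ?D A \<sigma> \<and> eventually (\<lambda>B. \<sigma> B \<in> ?S \<and> spin_biv (\<sigma> B) = B) (near ?D A)"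
      by blast
  qed
  have fib: "complex_line z = complex_line w \<longleftrightarrow> spin_biv z = spin_biv w" if "z \<in> ?S" "w \<in> ?S" for z w
    using that complex_line_eq_iff by blast
  obtain \<psi> where \<psi>: "diffeomorphism CP3 (sub_diff ?D) \<psi>"
    unfolding CP3_def using diffeomorphism_quotient_diff_ex[OF s im sec fib] by metis
  obtain \<phi> where \<phi>: "diffeomorphism (homogeneous_space (carrier SO5) (isotropy (b_vec (pi/4)))) (sub_diff ?D) \<phi>"
    using orbit_is_homogeneous_b_vec[of "pi/4"] by (auto simp: orbit_is_homogeneous_def)
  show ?thesis
    using diffeomorphic_quotients_common_image \<phi> \<psi>
    unfolding homogeneous_space_def CP3_def by blast
qed


section \<open>The unit bivectors as a nine-dimensional sphere\<close>

lemma exhaust_10: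
  fixes x :: 10
  shows "x = 1 \<or> x = 2 \<or> x = 3 \<or> x = 4 \<or> x = 5 \<or> x = 6 \<or> x = 7 \<or> x = 8 \<or> x = 9 \<or> x = 10"
proof (induct x)
  case (of_int z)
  then have "0 \<le> z" and "z < 10" by simp_all
  then have "z = 0 \<or> z = 1 \<or> z = 2 \<or> z = 3 \<or> z = 4 \<or> z = 5 \<or> z = 6 \<or> z = 7 \<or> z = 8 \<or> z = 9" by arith
  then show ?case by auto
qed

lemma UNIV_10: "UNIV = {1, 2, 3, 4, 5, 6, 7, 8, 9, 10 :: 10}"
  using exhaust_10 by auto

lemma sum_10: "sum f (UNIV :: 10 set) = f 1 + f 2 + f 3 + f 4 + f 5 + f 6 + f 7 + f 8 + f 9 + f 10"
  unfolding UNIV_10 by (simp add: ac_simps)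

definition biv_of_vec :: "real^10 \<Rightarrow> real^5^5" where
  "biv_of_vec x = biv (x$1) (x$2) (x$3) (x$4) (x$5) (x$6) (x$7) (x$8) (x$9) (x$10)"

lemma linear_biv_of_vec: "linear biv_of_vec"
  by (rule linearI) (simp_all add: biv_of_vec_def biv_add biv_scaleR)

lemma biv_inner_biv_of_vec: "biv_inner (biv_of_vec x) (biv_of_vec y) = x \<bullet> y"
  by (simp add: biv_of_vec_def biv_inner_biv inner_vec_def sum_10)

lemma range_biv_of_vec: "range biv_of_vec = bivectors"
proof
  show "range biv_of_vec \<subseteq> bivectors" by (auto simp: biv_of_vec_def)
  show "bivectors \<subseteq> range biv_of_vec"
  proof
    fix A assume "A \<in> bivectors"
    then obtain a b c d e f g h i j where A: "A = biv a b c d e f g h i j" by (rule bivectors_cases)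
    define x :: "real^10" where "x = (\<chi> k. if k = 1 then a else if k = 2 then b else if k = 3 then c
      else if k = 4 then d else if k = 5 then e else if k = 6 then f else if k = 7 then g
      else if k = 8 then h else if k = 9 then i else j)"
    have "A = biv_of_vec x" by (simp add: A biv_of_vec_def x_def)
    then show "A \<in> range biv_of_vec" by blast
  qed
qed

lemma inj_biv_of_vec: "inj biv_of_vec"
proof (rule injI)
  fix x y assume "biv_of_vec x = biv_of_vec y"
  then have "biv_inner (biv_of_vec (x - y)) (biv_of_vec (x - y)) = 0"
    by (simp add: linear_diff[OF linear_biv_of_vec] biv_inner_def)
  then show "x = y" by (simp add: biv_inner_biv_of_vec)
qed

lemma biv_of_vec_sphere: "biv_of_vec ` sphere 0 1 = unit_bivectors"
proof -
  have "unit_bivectors = {A \<in> range biv_of_vec. biv_inner A A = 1}"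
    by (simp add: range_biv_of_vec unit_bivectors_def)
  also have "\<dots> = biv_of_vec ` {x. x \<bullet> x = 1}" by (auto simp: biv_inner_biv_of_vec)
  also have "{x :: real^10. x \<bullet> x = 1} = sphere 0 1" by (auto simp: norm_eq_1)
  finally show ?thesis by simp
qed


section \<open>Codimensions\<close>

lemma diffeomorphism_sub_diffI:
  assumes "smooth_on W \<phi>" "smooth_on S \<psi>" "\<phi> ` W \<subseteq> S" "\<psi> ` S \<subseteq> W"
    "\<And>w. w \<in> W \<Longrightarrow> \<psi> (\<phi> w) = w" "\<And>y. y \<in> S \<Longrightarrow> \<phi> (\<psi> y) = y"
  shows "diffeomorphism (sub_diff W) (sub_diff S) \<phi>"
proof -
  have "has_local_sections W S \<phi>"
    unfolding has_local_sections_def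
    using assms by (auto intro!: exI[of _ \<psi>] near_everyI smooth_onD)
  from smooth_on_pullback_iff[OF assms(1,3) this]
  have "smooth_on S f \<longleftrightarrow> smooth_on W (f \<circ> \<phi>)" for f :: "_ \<Rightarrow> real" by (simp add: o_def)
  moreover have "bij_betw \<phi> W S" using assms by (intro bij_betw_byWitness[of _ \<psi>]) auto
  ultimately show ?thesis by (simp add: diffeomorphism_def sub_diff_def)
qed

text \<open>A chart given with its inverse, which allows smoothness to be checked on both maps separately.\<close>

definition has_chart :: "nat \<Rightarrow> 'a::euclidean_space set \<Rightarrow> 'a \<Rightarrow> bool" where
  "has_chart d S x \<longleftrightarrow> (\<exists>U (T :: 'a set) W \<phi> \<psi>. open U \<and> x \<in> U \<and> subspace T \<and> dim T = d \<and>
     openin (top_of_set T) W \<and> smooth_on W \<phi> \<and> smooth_on (S \<inter> U) \<psi> \<and> \<phi> ` W \<subseteq> S \<inter> U \<and> \<psi> ` (S \<inter> U) \<subseteq> W \<and>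
     (\<forall>w\<in>W. \<psi> (\<phi> w) = w) \<and> (\<forall>y\<in>S \<inter> U. \<phi> (\<psi> y) = y))"

lemma has_chartE:
  fixes S :: "'a::euclidean_space set"
  assumes "has_chart d S x"
  obtains U and T :: "'a set" and W \<phi> \<psi> where "open U" "x \<in> U" "subspace T" "dim T = d"
    "openin (top_of_set T) W" "smooth_on W \<phi>" "smooth_on (S \<inter> U) \<psi>" "\<phi> ` W \<subseteq> S \<inter> U" "\<psi> ` (S \<inter> U) \<subseteq> W"
    "\<forall>w\<in>W. \<psi> (\<phi> w) = w" "\<forall>y\<in>S \<inter> U. \<phi> (\<psi> y) = y"
  using assms unfolding has_chart_def by (elim exE conjE) (rule that)

lemma smooth_submanifoldI:
  assumes "\<And>x. x \<in> S \<Longrightarrow> has_chart d S x"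
  shows "smooth_submanifold d S"
  unfolding smooth_submanifold_def
proof
  fix x assume "x \<in> S"
  then have "has_chart d S x" by (rule assms)
  then obtain U and T :: "'a set" and W \<phi> \<psi> where c: "open U" "x \<in> U" "subspace T" "dim T = d"
    "openin (top_of_set T) W" "smooth_on W \<phi>" "smooth_on (S \<inter> U) \<psi>" "\<phi> ` W \<subseteq> S \<inter> U" "\<psi> ` (S \<inter> U) \<subseteq> W"
    "\<forall>w\<in>W. \<psi> (\<phi> w) = w" "\<forall>y\<in>S \<inter> U. \<phi> (\<psi> y) = y"
    by (rule has_chartE)
  have "diffeomorphism (sub_diff W) (sub_diff (S \<inter> U)) \<phi>"
    using c(6-11) by (intro diffeomorphism_sub_diffI[of W \<phi> "S \<inter> U" \<psi>]) auto
  then show "\<exists>U (T :: 'a set) W \<phi>. open U \<and> x \<in> U \<and> subspace T \<and> dim T = d \<and>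
        openin (top_of_set T) W \<and> diffeomorphism (sub_diff W) (sub_diff (S \<inter> U)) \<phi>"
    using c(1-5) by blast
qed

lemma smooth_on_cj_right: "smooth_on S (cj g)"
  unfolding smooth_on_iff_smooth_at by (auto intro: smooth_at_linear linear_cj)

lemma smooth_on_compose:
  assumes "smooth_on T g" "smooth_on S f" "f ` S \<subseteq> T"
  shows "smooth_on S (\<lambda>x. g (f x))"
  unfolding smooth_on_iff_smooth_at
proof
  fix x assume "x \<in> S"
  then show "smooth_at S x (\<lambda>x. g (f x))"
    using assms by (intro smooth_at_compose[of T f x g S] near_everyI) (auto simp: smooth_on_iff_smooth_at)
qed

text \<open>Charts are transported along the orbit by the group.\<close>

lemma smooth_submanifold_orbit:
  assumes D: "D = orbit SO5 conj_action b" "b \<in> unit_bivectors" and ch: "has_chart d D b"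
  shows "smooth_submanifold d D"
proof (rule smooth_submanifoldI)
  fix y assume "y \<in> D"
  then obtain g where g: "rotation_matrix g" "y = cj g b" using D by (auto simp: orbit_eq)
  obtain U and T :: "(real^5^5) set" and W \<phi> \<psi> where c: "open U" "b \<in> U" "subspace T" "dim T = d" "openin (top_of_set T) W"
    "smooth_on W \<phi>" "smooth_on (D \<inter> U) \<psi>" "\<phi> ` W \<subseteq> D \<inter> U" "\<psi> ` (D \<inter> U) \<subseteq> W"
    "\<forall>w\<in>W. \<psi> (\<phi> w) = w" "\<forall>y\<in>D \<inter> U. \<phi> (\<psi> y) = y"
    using ch by (rule has_chartE)
  let ?h = "cj (transpose g)"
  let ?U = "?h -` U"
  have D': "cj k z \<in> D" if zk: "z \<in> D" "rotation_matrix k" for k z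
  proof -
    obtain l where "rotation_matrix l" "z = cj l b" using zk(1) D by (auto simp: orbit_eq)
    then have "rotation_matrix (k ** l)" "cj k z = cj (k ** l) b"
      using zk(2) by (simp_all add: cj_cj rotation_matrix_mult)
    then show ?thesis using D by (auto simp: orbit_eq)
  qed
  have h: "?h ` (D \<inter> ?U) \<subseteq> D \<inter> U" using D' g rotation_matrix_transpose by auto
  show "has_chart d D y"
    unfolding has_chart_def
  proof (intro exI conjI)
    show "open ?U" using c(1) smooth_on_imp_continuous_on[OF smooth_on_cj_right[of UNIV "transpose g"]]
      by (simp add: open_vimage)
    show "y \<in> ?U" using g c(2) by simp
    show "subspace T" "dim T = d" "openin (top_of_set T) W" by fact+
    show "smooth_on W (\<lambda>w. cj g (\<phi> w))" by (rule smooth_on_compose[OF smooth_on_cj_right c(6)]) auto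
    show "smooth_on (D \<inter> ?U) (\<lambda>z. \<psi> (?h z))" by (rule smooth_on_compose[OF c(7) smooth_on_cj_right h])
    show "(\<lambda>w. cj g (\<phi> w)) ` W \<subseteq> D \<inter> ?U" using c(8) D' g by auto
    show "(\<lambda>z. \<psi> (?h z)) ` (D \<inter> ?U) \<subseteq> W" using h c(9) by blast
    show "\<forall>w\<in>W. \<psi> (?h (cj g (\<phi> w))) = w" using c(10) g by simp
    show "\<forall>z\<in>D \<inter> ?U. cj g (\<phi> (\<psi> (?h z))) = z"
    proof
      fix z assume "z \<in> D \<inter> ?U"
      then have "\<phi> (\<psi> (?h z)) = ?h z" using c(11) h by blast
      then show "cj g (\<phi> (\<psi> (?h z))) = z" using g by simp
    qed
  qed
qed

text \<open>Charts of a submanifold are modelled on a linear subspace of the ambient space; for the singular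
  orbits it is the span of the \<open>e\<^sub>i \<and> e\<^sub>j\<close> with \<open>i \<le> 2 < j\<close>.\<close>

definition chart_coords :: "(real^3) \<times> (real^3) \<Rightarrow> real^5^5" where
  "chart_coords = (\<lambda>(a, b). biv 0 (a$1) (a$2) (a$3) (b$1) (b$2) (b$3) 0 0 0)"

lemma chart_coords_subspace: "subspace (range chart_coords)" "dim (range chart_coords) = 6"
proof -
  have l: "linear chart_coords"
    by (rule linearI) (auto simp: chart_coords_def biv_add biv_scaleR)
  have i: "inj chart_coords"
    by (rule injI) (clarsimp simp: chart_coords_def biv_eq_iff, simp add: vec_eq_iff forall_3)
  show "subspace (range chart_coords)" using l by (rule linear_subspace_image[OF _ subspace_UNIV])
  have "dim (range chart_coords) = dim (UNIV :: ((real^3) \<times> (real^3)) set)"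
    using l i by (intro dim_image_eq) auto
  also have "\<dots> = 6" by (simp add: dim_UNIV)
  finally show "dim (range chart_coords) = 6" .
qed

lemma chart_coords_range: "A \<in> range chart_coords \<longleftrightarrow> (\<exists>a b c d e f. A = biv 0 a b c d e f 0 0 0)"
proof
  assume "\<exists>a b c d e f. A = biv 0 a b c d e f 0 0 0"
  then obtain a b c d e f where "A = biv 0 a b c d e f 0 0 0" by blast
  then have "A = chart_coords (vector [a, b, c], vector [d, e, f])" by (simp add: chart_coords_def)
  then show "A \<in> range chart_coords" by blast
qed (auto simp: chart_coords_def biv_eq_iff)

text \<open>\<open>(e\<^sub>1 + \<alpha>) \<and> (e\<^sub>2 + \<beta>)\<close> with \<open>\<alpha>\<close>, \<open>\<beta>\<close> in the span of \<open>e\<^sub>3, e\<^sub>4, e\<^sub>5\<close>: the graph coordinates of a plane near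
  \<open>\<langle>e\<^sub>1, e\<^sub>2\<rangle>\<close>.  The signs make the entries of \<open>X\<close> reappear in the bivector.\<close>

definition simple_biv :: "real^5^5 \<Rightarrow> real^5^5" where
  "simple_biv X = wedge (vector [1, 0, - X$2$3, - X$2$4, - X$2$5]) (vector [0, 1, X$1$3, X$1$4, X$1$5])"

lemma simple_biv_eq: "simple_biv X = biv 1 (X$1$3) (X$1$4) (X$1$5) (X$2$3) (X$2$4) (X$2$5)
   (X$2$4 * X$1$3 - X$2$3 * X$1$4) (X$2$5 * X$1$3 - X$2$3 * X$1$5) (X$2$5 * X$1$4 - X$2$4 * X$1$5)"
  by (simp add: simple_biv_def wedge_def biv_def matrix_eq_iff_5)

definition biv_normalise :: "real^5^5 \<Rightarrow> real^5^5" where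
  "biv_normalise A = inverse (sqrt (biv_inner A A)) *\<^sub>R A"

lemma wedge_normalise_in_orbit:
  assumes "biv_inner (wedge u v) (wedge u v) \<noteq> 0"
  shows "biv_normalise (wedge u v) \<in> orbit SO5 conj_action (b_vec 0)"
proof -
  let ?A = "wedge u v"
  let ?n = "biv_inner ?A ?A"
  have n: "0 < ?n" using assms inner_ge_zero[of ?A] unfolding biv_inner_def by linarith
  have "sqrt ?n ^ 4 = ?n\<^sup>2" using n power_mult[of "sqrt ?n" 2 2] by simp
  then have "quartic (biv_normalise ?A) = inverse (?n\<^sup>2) * (2 * ?n\<^sup>2)"
    by (simp only: biv_normalise_def quartic_scaleR quartic_wedge power_inverse)
  then have "quartic (biv_normalise ?A) = 2" using n by simp
  moreover have "biv_inner (biv_normalise ?A) (biv_normalise ?A) = 1"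
    using n by (simp add: biv_normalise_def biv_inner_scaleR field_simps)
  moreover have "biv_normalise ?A \<in> bivectors"
    unfolding biv_normalise_def by (intro subspace_scale subspace_bivectors wedge_bivectors)
  ultimately show ?thesis by (simp add: in_orbit_b_vec_iff unit_bivectors_def quartic_b_vec_0)
qed

lemma simple_biv_pos: "0 < biv_inner (simple_biv X) (simple_biv X)"
proof -
  have "biv_inner (simple_biv X) (simple_biv X) = 1 + ((X$1$3)\<^sup>2 + (X$1$4)\<^sup>2 + (X$1$5)\<^sup>2 + (X$2$3)\<^sup>2 + (X$2$4)\<^sup>2 + (X$2$5)\<^sup>2
     + (X$2$4 * X$1$3 - X$2$3 * X$1$4)\<^sup>2 + (X$2$5 * X$1$3 - X$2$3 * X$1$5)\<^sup>2 + (X$2$5 * X$1$4 - X$2$4 * X$1$5)\<^sup>2)"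
    by (simp only: simple_biv_eq biv_inner_biv power2_eq_square)
  moreover have "0 \<le> (X$1$3)\<^sup>2 + (X$1$4)\<^sup>2 + (X$1$5)\<^sup>2 + (X$2$3)\<^sup>2 + (X$2$4)\<^sup>2 + (X$2$5)\<^sup>2
     + (X$2$4 * X$1$3 - X$2$3 * X$1$4)\<^sup>2 + (X$2$5 * X$1$3 - X$2$3 * X$1$5)\<^sup>2 + (X$2$5 * X$1$4 - X$2$4 * X$1$5)\<^sup>2"
    by (intro add_nonneg_nonneg zero_le_power2)
  ultimately show ?thesis by linarith
qed

text \<open>The inverse of the graph coordinates divides by the \<open>(1,2)\<close> entry; the remaining three entries are
  determined by the Pluecker relations.\<close>

lemma has_chart_minus:
  defines "D \<equiv> orbit SO5 conj_action (b_vec 0)"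
  shows "has_chart 6 D (b_vec 0)"
proof -
  define \<phi> where "\<phi> X = biv_normalise (simple_biv X)" for X
  define \<psi> where "\<psi> M = biv 0 (M$1$3 / M$1$2) (M$1$4 / M$1$2) (M$1$5 / M$1$2) (M$2$3 / M$1$2) (M$2$4 / M$1$2) (M$2$5 / M$1$2) 0 0 0"
    for M :: "real^5^5"
  let ?U = "{M :: real^5^5. 0 < M$1$2}"
  have \<phi>: "\<phi> X \<in> D \<inter> ?U" for X
  proof -
    have "\<phi> X \<in> D" unfolding \<phi>_def D_def simple_biv_def
      using simple_biv_pos[of X] by (intro wedge_normalise_in_orbit) (simp add: simple_biv_def)
    moreover have "simple_biv X $ 1 $ 2 = 1" by (simp add: simple_biv_eq biv_def)
    ultimately show ?thesis using simple_biv_pos[of X] by (simp add: \<phi>_def biv_normalise_def)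
  qed
  have \<psi>\<phi>: "\<psi> (\<phi> X) = X" if X': "X \<in> range chart_coords" for X
  proof -
    obtain a b c d e f where X: "X = biv 0 a b c d e f 0 0 0" using X' unfolding chart_coords_range by blast
    define r where "r = inverse (sqrt (biv_inner (simple_biv X) (simple_biv X)))"
    have r: "0 < r" using simple_biv_pos[of X] by (simp add: r_def)
    have "\<phi> X = r *\<^sub>R simple_biv X" by (simp add: \<phi>_def biv_normalise_def r_def)
    then show ?thesis using r unfolding \<psi>_def simple_biv_eq by (simp add: X biv_def)
  qed
  have \<phi>\<psi>: "\<phi> (\<psi> M) = M" if M: "M \<in> D \<inter> ?U" for M
  proof -
    obtain u v where uv: "M = wedge u v" using M wedge_image unfolding D_def by force
    have pos: "0 < M$1$2" using M by simp
    have M1: "biv_inner M M = 1" using M orbit_subset[OF b_vec_in_unit_bivectors] by (auto simp: D_def unit_bivectors_def)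
    have pl: "M$2$4 * M$1$3 - M$2$3 * M$1$4 = M$1$2 * M$3$4" "M$2$5 * M$1$3 - M$2$3 * M$1$5 = M$1$2 * M$3$5"
      "M$2$5 * M$1$4 - M$2$4 * M$1$5 = M$1$2 * M$4$5"
      unfolding uv wedge_def by (simp_all add: algebra_simps)
    have "simple_biv (\<psi> M) = (1 / M$1$2) *\<^sub>R M"
    proof -
      have "M \<in> bivectors" unfolding uv by (rule wedge_bivectors)
      then have "(1 / M$1$2) *\<^sub>R M = biv 1 (M$1$3 / M$1$2) (M$1$4 / M$1$2) (M$1$5 / M$1$2) (M$2$3 / M$1$2) (M$2$4 / M$1$2) (M$2$5 / M$1$2)
        (M$3$4 / M$1$2) (M$3$5 / M$1$2) (M$4$5 / M$1$2)"
        using pos by (subst (2) bivectors_iff[THEN iffD1]) (simp_all add: biv_scaleR)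
      moreover have "simple_biv (\<psi> M) = biv 1 (M$1$3 / M$1$2) (M$1$4 / M$1$2) (M$1$5 / M$1$2) (M$2$3 / M$1$2) (M$2$4 / M$1$2) (M$2$5 / M$1$2)
         ((M$2$4 * M$1$3 - M$2$3 * M$1$4) / (M$1$2 * M$1$2)) ((M$2$5 * M$1$3 - M$2$3 * M$1$5) / (M$1$2 * M$1$2))
         ((M$2$5 * M$1$4 - M$2$4 * M$1$5) / (M$1$2 * M$1$2))"
        unfolding simple_biv_eq \<psi>_def by (simp add: biv_eq_iff) (simp add: biv_def diff_divide_distrib)
      ultimately show ?thesis using pos unfolding pl by simp
    qed
    moreover have "sqrt (1 / M$1$2 * (1 / M$1$2)) = 1 / M$1$2" using pos by (simp only: real_sqrt_abs2) simp
    ultimately show ?thesis using pos M1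
      by (simp add: \<phi>_def biv_normalise_def biv_inner_scaleR)
  qed
  have s\<phi>: "smooth_on (range chart_coords) \<phi>"
    unfolding smooth_on_iff_smooth_at
  proof
    fix X assume X: "X \<in> range chart_coords"
    have "smooth_at (range chart_coords) X simple_biv"
      unfolding simple_biv_eq by (intro smooth_at_biv smooth_intros)
    then show "smooth_at (range chart_coords) X \<phi>"
      unfolding \<phi>_def biv_normalise_def biv_inner_def using X simple_biv_pos[of X, unfolded biv_inner_def]
      by (intro smooth_intros) auto
  qed
  have s\<psi>: "smooth_on (D \<inter> ?U) \<psi>"
    unfolding smooth_on_iff_smooth_at
  proof
    fix M assume "M \<in> D \<inter> ?U"
    then show "smooth_at (D \<inter> ?U) M \<psi>"
      unfolding \<psi>_def by (intro smooth_at_biv smooth_intros) auto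
  qed
  have "open ?U" by (intro open_Collect_less continuous_intros)
  moreover have "\<psi> M \<in> range chart_coords" for M unfolding chart_coords_range \<psi>_def by blast
  moreover have "b_vec 0 \<in> ?U" by (simp add: b_vec_biv biv_def)
  ultimately show ?thesis
    unfolding has_chart_def using chart_coords_subspace \<phi> \<psi>\<phi> \<phi>\<psi> s\<phi> s\<psi>
    by (intro exI[of _ ?U] exI[of _ "range chart_coords"] exI[of _ \<phi>] exI[of _ \<psi>] conjI) auto
qed

lemma complex_line_scale:
  assumes "c \<noteq> 0" shows "complex_line (c *s z) = complex_line z"
proof -
  have "range (\<lambda>d. d *s (c *s z)) = (\<lambda>d. d *s z) ` range (\<lambda>d. d * c)" by (simp add: image_image)
  also have "range (\<lambda>d. d * c) = UNIV" using assms by (intro surjI[of _ "\<lambda>d. d / c"]) simp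
  finally show ?thesis by (simp add: complex_line_def)
qed

text \<open>The affine chart of \<open>\<complex>P\<^sup>3\<close> on which the third coordinate is \<open>1\<close>.  At \<open>b\<^sub>\<pi>\<^sub>/\<^sub>4\<close> the diagonal of the Hermitian
  matrix is \<open>(0, 0, 4, 0)\<close>, so that this chart, and none of the other three affine charts, contains the
  base point.\<close>

lemma has_chart_plus:
  defines "D \<equiv> orbit SO5 conj_action (b_vec (pi/4))"
  shows "has_chart 6 D (b_vec (pi/4))"
proof -
  define H where "H M = spin_herm (sqrt 2 *\<^sub>R M)" for M
  define z :: "real^5^5 \<Rightarrow> complex^4" where
    "z X = vector [Complex (X$1$3) (X$1$4), Complex (X$1$5) (X$2$3), 1, Complex (X$2$4) (X$2$5)]" for X
  define \<zeta> where "\<zeta> M b = (1 / Re (H M$3$3)) *\<^sub>R H M$b$3" for M b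
  define \<psi> where "\<psi> M = biv 0 (Re (\<zeta> M 1)) (Im (\<zeta> M 1)) (Re (\<zeta> M 2)) (Im (\<zeta> M 2)) (Re (\<zeta> M 4)) (Im (\<zeta> M 4)) 0 0 0"
    for M :: "real^5^5"
  let ?\<phi> = "\<lambda>X. spin_biv (z X)"
  let ?U = "{M :: real^5^5. 0 < Re (H M$3$3)}"
  have z0: "z X \<noteq> 0" for X
  proof
    assume "z X = 0"
    then have "z X $ 3 = 0" by simp
    then show False by (simp add: z_def)
  qed
  have H: "H (?\<phi> X) $ b $ 3 = of_real (4 / spin_trace (outer (z X))) * z X $ b" for X b
    unfolding H_def spin_herm_spin_biv[OF z0] by (simp add: z_def)
  have tr: "0 < 4 / spin_trace (outer (z X))" for X using spin_trace_pos[OF z0[of X]] by simp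
  have H3: "Re (H (?\<phi> X)$3$3) = 4 / spin_trace (outer (z X))" for X
    unfolding H by (simp add: z_def)
  have \<phi>: "?\<phi> X \<in> D \<inter> ?U" for X
    using spin_biv_in_orbit[OF z0] tr[of X] by (simp add: D_def H3)
  have \<zeta>: "\<zeta> (?\<phi> X) b = z X $ b" for X b
    unfolding \<zeta>_def H3 unfolding H using tr[of X] by (simp add: scaleR_conv_of_real)
  have \<psi>\<phi>: "\<psi> (?\<phi> X) = X" if X': "X \<in> range chart_coords" for X
  proof -
    obtain a b c d e f where X: "X = biv 0 a b c d e f 0 0 0" using X' unfolding chart_coords_range by blast
    show ?thesis unfolding \<psi>_def \<zeta> by (simp add: z_def X) (simp add: biv_def)
  qed
  have \<phi>\<psi>: "?\<phi> (\<psi> M) = M" if M: "M \<in> D \<inter> ?U" for M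
  proof -
    have MD: "M \<in> orbit SO5 conj_action (b_vec (pi/4))" and pos: "0 < Re (H M$3$3)" using M by (simp_all add: D_def)
    let ?c = "column 3 (H M)"
    have c: "spin_biv ?c = M" "?c \<noteq> 0"
      using spin_herm_column[OF MD, of 3] pos by (simp_all add: H_def)
    have "H M $ 3 $ 3 = of_real (Re (H M $ 3 $ 3))"
      by (simp add: H_def spin_herm_def Let_def)
    then obtain r where "H M $ 3 $ 3 = of_real r" by blast
    then have "\<zeta> M 3 = 1" using pos by (simp add: \<zeta>_def scaleR_conv_of_real)
    then have "z (\<psi> M) $ b = \<zeta> M b" for b
      using exhaust_4[of b] by (auto simp: z_def \<psi>_def biv_def)
    then have zc: "z (\<psi> M) = of_real (1 / Re (H M$3$3)) *s ?c"
      by (simp add: vec_eq_iff \<zeta>_def column_def scaleR_conv_of_real)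
    have "complex_line (z (\<psi> M)) = complex_line ?c"
    proof -
      have k: "of_real (1 / Re (H M$3$3)) \<noteq> (0 :: complex)" using pos by simp
      show ?thesis unfolding zc by (rule complex_line_scale[OF k])
    qed
    then show ?thesis using complex_line_eq_iff[OF z0 c(2)] c(1) by simp
  qed
  have sH: "smooth_at S M H" for S M unfolding H_def by (intro smooth_at_spin_herm smooth_intros)
  have s\<phi>: "smooth_on (range chart_coords) ?\<phi>"
    unfolding smooth_on_iff_smooth_at
  proof
    fix X assume X: "X \<in> range chart_coords"
    have "\<forall>b. smooth_at (range chart_coords) X (\<lambda>X. z X $ b)"
      unfolding forall_4 z_def by (auto intro!: smooth_at_Complex smooth_intros)
    then have "smooth_at (range chart_coords) X z" by (intro smooth_at_vec) blast
    then show "smooth_at (range chart_coords) X ?\<phi>" using X z0 by (rule smooth_at_spin_biv)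
  qed
  have s\<psi>: "smooth_on (D \<inter> ?U) \<psi>"
    unfolding smooth_on_iff_smooth_at
  proof
    fix M assume "M \<in> D \<inter> ?U"
    then show "smooth_at (D \<inter> ?U) M \<psi>"
      unfolding \<psi>_def \<zeta>_def
      by (intro smooth_at_biv smooth_at_Re smooth_at_Im smooth_intros sH) auto
  qed
  have "continuous_on UNIV H" by (intro smooth_on_imp_continuous_on) (simp add: smooth_on_iff_smooth_at sH)
  then have "open ?U" by (intro open_Collect_less continuous_intros)
  moreover have "\<psi> M \<in> range chart_coords" for M unfolding chart_coords_range \<psi>_def by blast
  moreover have "b_vec (pi/4) \<in> ?U"
  proof -
    have "sqrt 2 *\<^sub>R b_vec (pi/4) = biv 1 0 0 0 0 0 0 1 0 0"
      by (simp add: b_vec_biv biv_scaleR cos_45 sin_45)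
    then have "H (b_vec (pi/4)) = spin_herm (biv 1 0 0 0 0 0 0 1 0 0)" by (simp only: H_def)
    then show ?thesis by (simp add: spin_herm_def pfaff_def biv_def Let_def)
  qed
  ultimately show ?thesis
    unfolding has_chart_def using chart_coords_subspace \<phi> \<psi>\<phi> \<phi>\<psi> s\<phi> s\<psi>
    by (intro exI[of _ ?U] exI[of _ "range chart_coords"] exI[of _ ?\<phi>] exI[of _ \<psi>] conjI) auto
qed

text \<open>The chart at \<open>A\<close> is the inverse of the orthogonal projection of the hemisphere around \<open>A\<close> to the
  hyperplane orthogonal to \<open>A\<close>.\<close>

lemma smooth_submanifold_unit_bivectors: "smooth_submanifold 9 unit_bivectors"
proof (rule smooth_submanifoldI)
  fix A assume A: "A \<in> unit_bivectors"
  have AA: "biv_inner A A = 1" "A \<in> bivectors" using A by (simp_all add: unit_bivectors_def)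
  let ?U = "{M. 0 < biv_inner M A}"
  let ?T = "{X \<in> bivectors. biv_inner X A = 0}"
  let ?W = "{X \<in> ?T. biv_inner X X < 1}"
  let ?\<phi> = "\<lambda>X. X + sqrt (1 - biv_inner X X) *\<^sub>R A"
  let ?\<psi> = "\<lambda>M. M - biv_inner M A *\<^sub>R A"
  obtain a where a: "A = biv_of_vec a" using AA(2) range_biv_of_vec by blast
  have T: "?T = biv_of_vec ` {x. a \<bullet> x = 0}"
    unfolding range_biv_of_vec[symmetric] a by (auto simp: biv_inner_biv_of_vec inner_commute)
  have "a \<noteq> 0" using AA(1) by (auto simp: a biv_inner_biv_of_vec)
  have st: "subspace ?T" unfolding T using linear_biv_of_vec subspace_hyperplane by (rule linear_subspace_image)
  have "dim ?T = dim {x. a \<bullet> x = 0}"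
    unfolding T using inj_biv_of_vec by (intro dim_image_eq linear_biv_of_vec) (auto intro: inj_on_subset)
  also have "\<dots> = 9" using \<open>a \<noteq> 0\<close> by (simp add: dim_hyperplane)
  finally have dt: "dim ?T = 9" .
  have e: "biv_inner M X = (M \<bullet> X) / 2" for M X by (simp add: biv_inner_def)
  have s: "smooth_on ?W ?\<phi>" "smooth_on (unit_bivectors \<inter> ?U) ?\<psi>"
  proof -
    have "smooth_at S X (\<lambda>X. X + sqrt (1 - biv_inner X X) *\<^sub>R A)" if "X \<in> S" "biv_inner X X < 1" for S X
      using that unfolding e by (intro smooth_intros) simp_all
    then show "smooth_on ?W ?\<phi>" by (simp add: smooth_on_iff_smooth_at)
    have "smooth_at S M (\<lambda>M. M - biv_inner M A *\<^sub>R A)" if "M \<in> S" for S M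
      using that unfolding e by (intro smooth_intros) simp_all
    then show "smooth_on (unit_bivectors \<inter> ?U) ?\<psi>" by (simp add: smooth_on_iff_smooth_at)
  qed
  have U: "open ?U" unfolding e by (intro open_Collect_less continuous_intros) auto
  have W: "openin (top_of_set ?T) ?W"
  proof -
    have "open {X :: real^5^5. biv_inner X X < 1}" unfolding e by (intro open_Collect_less continuous_intros) auto
    then have "openin (top_of_set ?T) (?T \<inter> {X. biv_inner X X < 1})" by (rule openin_open_Int)
    moreover have "?T \<inter> {X. biv_inner X X < 1} = ?W" by auto
    ultimately show ?thesis by argo
  qed
  have \<phi>: "?\<phi> X \<in> unit_bivectors \<inter> ?U \<and> ?\<psi> (?\<phi> X) = X" if X: "X \<in> ?W" for X
  proof -
    have x: "X \<in> bivectors" "biv_inner X A = 0" "biv_inner A X = 0" "biv_inner X X < 1"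
      using X by (auto simp: biv_inner_commute)
    have "?\<phi> X \<in> bivectors" using x AA by (intro subspace_add subspace_scale subspace_bivectors)
    moreover have "biv_inner (?\<phi> X) (?\<phi> X) = 1"
      using x AA by (simp add: biv_inner_add biv_inner_scaleR)
    moreover have "biv_inner (?\<phi> X) A = sqrt (1 - biv_inner X X)"
      using x AA by (simp add: biv_inner_add biv_inner_scaleR)
    ultimately show ?thesis using x by (simp add: unit_bivectors_def)
  qed
  have \<psi>: "?\<psi> M \<in> ?W \<and> ?\<phi> (?\<psi> M) = M" if M: "M \<in> unit_bivectors \<inter> ?U" for M
  proof -
    have m: "M \<in> bivectors" "biv_inner M M = 1" "0 < biv_inner M A" using M by (auto simp: unit_bivectors_def)
    have d: "biv_inner (B - C) D = biv_inner B D - biv_inner C D" "biv_inner D (B - C) = biv_inner D B - biv_inner D C" for B C D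
      by (simp_all add: e inner_diff_left inner_diff_right diff_divide_distrib)
    have "?\<psi> M \<in> bivectors" using m AA by (intro subspace_diff subspace_scale subspace_bivectors)
    moreover have "biv_inner (?\<psi> M) A = 0" using AA by (simp add: d biv_inner_scaleR)
    moreover have 1: "biv_inner (?\<psi> M) (?\<psi> M) = 1 - (biv_inner M A)\<^sup>2"
      using m AA by (simp add: d biv_inner_scaleR power2_eq_square biv_inner_commute[of A M])
    ultimately show ?thesis using m by simp
  qed
  show "has_chart 9 unit_bivectors A"
    unfolding has_chart_def
  proof (intro exI conjI)
    show "A \<in> ?U" using AA by simp
    show "?\<phi> ` ?W \<subseteq> unit_bivectors \<inter> ?U" "\<forall>X\<in>?W. ?\<psi> (?\<phi> X) = X" using \<phi> by blast+
    show "?\<psi> ` (unit_bivectors \<inter> ?U) \<subseteq> ?W" "\<forall>M\<in>unit_bivectors \<inter> ?U. ?\<phi> (?\<psi> M) = M" using \<psi> by blast+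
  qed (fact U st dt W s)+
qed

lemma has_codimension_singular:
  "has_codimension (orbit SO5 conj_action (singular_vec s)) unit_bivectors 3"
proof -
  have "smooth_submanifold 6 (orbit SO5 conj_action (singular_vec s))"
    using has_chart_minus has_chart_plus
    by (cases s) (auto intro!: smooth_submanifold_orbit[OF refl b_vec_in_unit_bivectors])
  moreover have "smooth_submanifold (6 + 3) unit_bivectors" using smooth_submanifold_unit_bivectors by simp
  ultimately show ?thesis
    unfolding has_codimension_def using orbit_subset[OF b_vec_in_unit_bivectors] b_vec_in_orbit by blast
qed

theorem theorem17p1:
  shows
    "group_action SO5 unit_bivectors conj_action \<and>
     (\<exists>L :: real^10 \<Rightarrow> real^5^5. linear L \<and> range L = bivectors \<and>
        (\<forall>x y. biv_inner (L x) (L y) = x \<bullet> y) \<and> L ` sphere 0 1 = unit_bivectors) \<and>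
     (\<forall>A\<in>unit_bivectors. \<exists>\<theta>\<in>{0..pi/4}. \<exists>g\<in>carrier SO5. A = conj_action g (b_vec \<theta>)) \<and>
     homeomorphic_map (top_of_set {0..pi/4}) biv_orbit_space (\<lambda>\<theta>. orbit SO5 conj_action (b_vec \<theta>)) \<and>
     (\<forall>\<theta>\<in>{0<..<pi/4}. isotropy (b_vec \<theta>) = T2) \<and>
     (\<forall>s. isotropy (b_vec (singular_angle s)) = K_side s \<and> T2 \<subseteq> K_side s \<and> K_side s \<subseteq> carrier SO5) \<and>
     (\<forall>\<theta>\<in>{0<..<pi/4}. orbit_is_homogeneous (b_vec \<theta>) T2) \<and>
     (\<forall>s. orbit_is_homogeneous (b_vec (singular_angle s)) (K_side s)) \<and>
     diffeomorphic (homogeneous_space (carrier SO5) (K_side Minus)) oriented_Grassmannian \<and>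
     diffeomorphic (homogeneous_space (carrier SO5) (K_side Plus)) CP3 \<and>
     (\<forall>s. diffeomorphic (homogeneous_space (K_side s) T2) (sub_diff (sphere (0 :: real^3) 1))) \<and>
     (\<forall>s. has_codimension (orbit SO5 conj_action (b_vec (singular_angle s))) unit_bivectors 3) \<and>
     (\<exists>\<rho> v. (\<forall>s. disk_representation (K_side s) T2 (\<rho> s) (v s)) \<and>
        double_disk_decomposition \<rho> v unit_bivectors)"
proof (intro conjI ballI allI)
  show "group_action SO5 unit_bivectors conj_action" by (rule group_action_SO5)
  show "\<exists>L :: real^10 \<Rightarrow> real^5^5. linear L \<and> range L = bivectors \<and>
        (\<forall>x y. biv_inner (L x) (L y) = x \<bullet> y) \<and> L ` sphere 0 1 = unit_bivectors"
    using linear_biv_of_vec range_biv_of_vec biv_inner_biv_of_vec biv_of_vec_sphere by blast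
  show "\<exists>\<theta>\<in>{0..pi/4}. \<exists>g\<in>carrier SO5. A = conj_action g (b_vec \<theta>)" if "A \<in> unit_bivectors" for A
    using bivector_normal_form[OF that] conj_action_eq[OF b_vec_in_unit_bivectors] by (metis SO5_simps(3))
  show "homeomorphic_map (top_of_set {0..pi/4}) biv_orbit_space (\<lambda>\<theta>. orbit SO5 conj_action (b_vec \<theta>))"
    by (rule biv_orbit_space_homeomorphic)
  show "isotropy (b_vec \<theta>) = T2" if "\<theta> \<in> {0<..<pi/4}" for \<theta> using that by (rule isotropy_generic)
  show "isotropy (singular_vec s) = K_side s" for s by (rule isotropy_singular)
  show "T2 \<subseteq> K_side s" for s by (rule T2_subset_K_side)
  show "K_side s \<subseteq> carrier SO5" for s by (rule K_side_subset)
  show "orbit_is_homogeneous (b_vec \<theta>) T2" if "\<theta> \<in> {0<..<pi/4}" for \<theta>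
    using orbit_is_homogeneous_b_vec[of \<theta>] isotropy_generic[OF that] that by simp
  show "orbit_is_homogeneous (singular_vec s) (K_side s)" for s
    using orbit_is_homogeneous_b_vec[OF singular_angle_range] unfolding isotropy_singular .
  show "diffeomorphic (homogeneous_space (carrier SO5) (K_side Minus)) oriented_Grassmannian"
    using homogeneous_space_minus_Grassmannian isotropy_singular[of Minus] by simp
  show "diffeomorphic (homogeneous_space (carrier SO5) (K_side Plus)) CP3"
    using homogeneous_space_plus_CP3 isotropy_singular[of Plus] by simp
  show "diffeomorphic (homogeneous_space (K_side s) T2) (sub_diff (sphere (0 :: real^3) 1))" for s
    by (rule K_side_mod_T2_sphere)
  show "has_codimension (orbit SO5 conj_action (singular_vec s)) unit_bivectors 3" for s
    by (rule has_codimension_singular)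
  show "\<exists>\<rho> v. (\<forall>s. disk_representation (K_side s) T2 (\<rho> s) (v s)) \<and> double_disk_decomposition \<rho> v unit_bivectors"
    using disk_representation_slice_rep double_disk_decomposition_slices by blast
qed

end
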